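(* Let $0<\alpha<2-\sqrt2$. Let $\{\xi_k,\ -\infty<k<\infty\}$ be independent standard normal random variables, let $\{\psi_k,\ k\ge 0\}$ be real weights with $\psi_k\sim k^{-(1+\alpha)/2}$ as $k\to\infty$, and put $$\eta_j=\sum_{k=0}^\infty\psi_k\xi_{j-k},\qquad \sigma^2={\rm E}(\eta_0^2)=\sum_{k=0}^\infty\psi_k^2,\qquad \tilde\eta_j=\eta_j/\sigma,\qquad j=0,1,2,\ldots .$$ Let $G:\mathbb R\to\mathbb R$ be Borel measurable with $J_1:={\rm E}(G(\tilde\eta_0)\tilde\eta_0)\neq 0$, let $Y_j=G(\tilde\eta_j)$, and assume $\mu:={\rm E}Y_0>0$ and ${\rm E}(Y_0^2)<\infty$. Then, for every $y\in\mathbb R$, $$\lim_{T\to\infty}{\rm P}\left(Q(T)\,T^{-(1-\alpha/2)^2}\le y\right)=\int_{-\infty}^{\infty}\varphi(x)\,\Phi\left(\frac{y\,\sigma^{2-\alpha/2}\mu^{1-\alpha/2}}{|x|^{1-\alpha/2}(|J_1|\kappa_\alpha)^{2-\alpha/2}}\right)dx .$$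
   Context: For $t\ge 0$ (with $[t]$ the integer part of $t$) define $$S(t)=\sum_{i=1}^{[t]}Y_i,\qquad N(t)=\inf\{s\ge 1:\ S(s)>t\},\qquad Q(t)=S(t)+\mu N(\mu t)-2\mu t .$$ The constant $\kappa_\alpha>0$ is given by $$\kappa_\alpha^2=2\,\frac{\int_0^\infty x^{-(\alpha+1)/2}(1+x)^{-(\alpha+1)/2}\,dx}{(1-\alpha)(2-\alpha)}.$$ $\Phi$ and $\varphi$ are the standard normal distribution function and density. *)

theory Defs
  imports "HOL-Probability.Probability" "HOL-Library.Landau_Symbols"
begin

text \<open>
  The series is taken pointwise. It is not absolutely convergent in general, but for independent
  standard normal innovations and square summable weights it converges almost surely; on the
  exceptional null set \<open>suminf\<close> is a fixed junk value.
\<close>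

definition linear_process :: "(nat \<Rightarrow> real) \<Rightarrow> (int \<Rightarrow> 'a \<Rightarrow> real) \<Rightarrow> nat \<Rightarrow> 'a \<Rightarrow> real" where
  "linear_process \<psi> \<xi> j \<omega> = (\<Sum>k. \<psi> k * \<xi> (int j - int k) \<omega>)"

definition partial_sum :: "(nat \<Rightarrow> 'a \<Rightarrow> real) \<Rightarrow> real \<Rightarrow> 'a \<Rightarrow> real" where
  "partial_sum Y t \<omega> = (\<Sum>i = 1..nat \<lfloor>t\<rfloor>. Y i \<omega>)"

text \<open>
  Extended real values are used so that the infimum of the empty set (the level is never
  exceeded) is \<open>\<infinity>\<close>.
\<close>

definition renewal_time :: "(nat \<Rightarrow> 'a \<Rightarrow> real) \<Rightarrow> real \<Rightarrow> 'a \<Rightarrow> ereal" where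
  "renewal_time Y t \<omega> = Inf (ereal ` {s. 1 \<le> s \<and> partial_sum Y s \<omega> > t})"

definition vervaat_process :: "real \<Rightarrow> (nat \<Rightarrow> 'a \<Rightarrow> real) \<Rightarrow> real \<Rightarrow> 'a \<Rightarrow> ereal" where
  "vervaat_process \<mu> Y t \<omega> =
     ereal (partial_sum Y t \<omega>) + ereal \<mu> * renewal_time Y (\<mu> * t) \<omega> - ereal (2 * \<mu> * t)"

definition kappa :: "real \<Rightarrow> real" where
  "kappa \<alpha> = sqrt (2 * (LINT x:{0<..}|lborel.
       x powr (- (\<alpha> + 1) / 2) * (1 + x) powr (- (\<alpha> + 1) / 2)) / ((1 - \<alpha>) * (2 - \<alpha>)))"

end

theory Submission
  imports Defs "HOL-Real_Asymp.Real_Asymp"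
begin

text \<open>
  Write \<open>H = 1 - \<alpha>/2\<close> and let \<open>Sb k = S k - \<mu> k\<close> be the centred sums. If \<open>N\<close> is the first passage
  over \<open>\<mu> T\<close>, then \<open>Q T\<close> is, up to the overshoot, the increment \<open>Sb T - Sb N\<close>, and \<open>N - T\<close> is close to
  \<open>- Sb T / \<mu>\<close>, which is of order \<open>T powr H\<close>. Up to a remainder of smaller order, \<open>Sb k\<close> is
  \<open>J1 / \<sigma>\<close> times the Gaussian sum \<open>Z k\<close>, whose variance is asymptotic to \<open>kappa^2 k powr (2 H)\<close>.
  An increment of \<open>Z\<close> over a window of length \<open>T powr H\<close> at \<open>T\<close> is asymptotically uncorrelated with
  \<open>Z T\<close>. Regressing it on \<open>Z T\<close> and conditioning on \<open>Z T\<close> therefore leaves a normal variable with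
  standard deviation proportional to \<open>(\<bar>Z T\<bar> / \<mu>) powr H\<close>, which is the asserted mixture; the order
  of \<open>Q T\<close> is \<open>T powr (H^2)\<close>. A maximal inequality for sums whose increments have variance of order
  \<open>n powr (2 H)\<close> with \<open>2 H > 1\<close> controls the modulus of continuity when \<open>N\<close> is replaced by a function of \<open>Z T\<close>.
\<close>

section \<open>Sums of regularly varying sequences\<close>

text \<open>Two approximation errors rest on the same inequality \<open>(1 - H)^2 > 0\<close>, that
  is, \<open>2 H - 1 < H^2\<close>. The non-linear part of the summands has sums of order
  \<open>T powr max (1/2) (2 H - 1)\<close>, up to small powers, and the regression of the increment
  on \<open>Z T\<close> contributes \<open>T powr H * T powr H / T\<close>, again
  \<open>T powr (2 H - 1)\<close>. Only the order \<open>T powr (1/2)\<close>, present even without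
  memory, forces \<open>H^2 > 1/2\<close>, which is \<alpha> < 2 - sqrt 2. No functional limit
  theorem or strong approximation enters: the comparisons are made path by path outside an event of
  vanishing probability, and the limit law is found by conditioning at a single time, where the
  conditional laws are exactly normal. The almost sure convergence of the moving average, whose
  weights are not absolutely summable, comes from the same maximal inequality, applied to dyadic
  blocks of the series.\<close>

lemma stolz_cesaro:
  fixes A B :: "nat \<Rightarrow> real"
  assumes incr: "\<And>n. B n < B (Suc n)" and lim: "filterlim B at_top sequentially"
    and quot: "(\<lambda>n. (A (Suc n) - A n) / (B (Suc n) - B n)) \<longlonglongrightarrow> l"
  shows "(\<lambda>n. A n / B n) \<longlonglongrightarrow> l"
proof (rule LIMSEQ_I)
  fix r :: real assume r: "0 < r"
  define e where "e = r / 2"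
  have e: "e > 0" using r by (simp add: e_def)
  \<comment> \<open>Passing to \<open>C\<close> reduces to limit 0: its increments are eventually at
    most \<open>e\<close> times those of \<open>B\<close>, and since \<open>B\<close> increases
    these bounds telescope.\<close>
  define C where "C n = A n - l * B n" for n
  obtain N where N: "\<And>n. n \<ge> N \<Longrightarrow> \<bar>(A (Suc n) - A n) / (B (Suc n) - B n) - l\<bar> < e"
    using LIMSEQ_D[OF quot e] by auto
  have step: "\<bar>C (Suc n) - C n\<bar> \<le> e * (B (Suc n) - B n)" if "n \<ge> N" for n
  proof -
    have p: "B (Suc n) - B n > 0" using incr[of n] by simp
    have "C (Suc n) - C n = ((A (Suc n) - A n) / (B (Suc n) - B n) - l) * (B (Suc n) - B n)"
      using p by (simp add: C_def field_simps)
    then have "\<bar>C (Suc n) - C n\<bar> = \<bar>(A (Suc n) - A n) / (B (Suc n) - B n) - l\<bar> * (B (Suc n) - B n)"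
      using p by (simp add: abs_mult)
    also have "\<dots> \<le> e * (B (Suc n) - B n)"
      using N[OF that] p by (intro mult_right_mono) auto
    finally show ?thesis .
  qed
  have bd: "\<bar>C n - C N\<bar> \<le> e * (B n - B N)" if "n \<ge> N" for n
    using that
  proof (induction n rule: dec_induct)
    case (step n)
    then show ?case using \<open>\<And>n. n \<ge> N \<Longrightarrow> \<bar>C (Suc n) - C n\<bar> \<le> e * (B (Suc n) - B n)\<close>[of n]
      by (simp add: algebra_simps)
  qed simp
  \<comment> \<open>Beyond this point \<open>B n\<close> outweighs the fixed starting error divided
    by \<open>e\<close>, so that error costs at most one further \<open>e * B n\<close>.\<close>
  have ev: "eventually (\<lambda>n. B n > max 1 ((\<bar>C N\<bar> + e * \<bar>B N\<bar>) / e)) sequentially"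
    using lim unfolding filterlim_at_top_dense by blast
  then obtain N' where N': "\<And>n. n \<ge> N' \<Longrightarrow> B n > max 1 ((\<bar>C N\<bar> + e * \<bar>B N\<bar>) / e)"
    by (auto simp: eventually_sequentially)
  show "\<exists>no. \<forall>n\<ge>no. norm (A n / B n - l) < r"
  proof (intro exI[of _ "max N N'"] allI impI)
    fix n assume n: "max N N' \<le> n"
    have B: "B n > 1" "B n > (\<bar>C N\<bar> + e * \<bar>B N\<bar>) / e" using N'[of n] n by auto
    have "\<bar>C N\<bar> + e * \<bar>B N\<bar> < e * B n" using B(2) e by (simp add: field_simps)
    moreover have "\<bar>C n\<bar> \<le> \<bar>C N\<bar> + e * (B n - B N)" using bd[of n] n by auto
    moreover have "e * (- B N) \<le> e * \<bar>B N\<bar>"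
      using e by (intro mult_left_mono) auto
    ultimately have "\<bar>C n\<bar> < 2 * e * B n" by (simp add: algebra_simps)
    moreover have "A n / B n - l = C n / B n" using B by (simp add: C_def field_simps)
    ultimately show "norm (A n / B n - l) < r" using B by (simp add: e_def field_simps)
  qed
qed

text \<open>Discrete form of Karamata's theorem: the increments of \<open>n powr (p + 1)\<close> are
  asymptotic to \<open>(p + 1) * n powr p\<close>, and \<open>p > -1\<close> makes these
  denominators diverge.\<close>

lemma sum_regularly_varying:
  fixes a :: "nat \<Rightarrow> real"
  assumes p: "p > -1" and lim: "(\<lambda>n. a n / real n powr p) \<longlonglongrightarrow> l"
  shows "(\<lambda>n. (\<Sum>k<n. a k) / real n powr (p + 1)) \<longlonglongrightarrow> l / (p + 1)"
proof (rule stolz_cesaro)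
  show "real n powr (p + 1) < real (Suc n) powr (p + 1)" for n
    using p by (intro powr_less_mono2) auto
  show "filterlim (\<lambda>n. real n powr (p + 1)) at_top sequentially"
    using p by real_asymp
  have "(\<lambda>n. real n powr p / ((real n + 1) powr (p + 1) - real n powr (p + 1))) \<longlonglongrightarrow> 1 / (p + 1)"
    using p by (real_asymp simp: field_simps)
  from tendsto_mult[OF lim this]
  have "(\<lambda>n. a n / real n powr p * (real n powr p / ((real n + 1) powr (p + 1) - real n powr (p + 1))))
     \<longlonglongrightarrow> l / (p + 1)" by simp
  then show "(\<lambda>n. (sum a {..<Suc n} - sum a {..<n}) / (real (Suc n) powr (p + 1) - real n powr (p + 1))) \<longlonglongrightarrow> l / (p + 1)"
    by (rule Lim_transform_eventually)
      (use eventually_gt_at_top[of 0] in eventually_elim, simp add: add.commute)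
qed

text \<open>Comparison with an integral: \<open>x powr -\<beta>\<close> decreases, so its value at
  \<open>m + 1\<close> is below the increment of its primitive over
  \<open>[m, m + 1]\<close>.\<close>

lemma sum_powr_neg_le:
  assumes "0 < \<beta>" "\<beta> < 1"
  shows "(\<Sum>k<m. (real k + 1) powr (-\<beta>)) \<le> real m powr (1 - \<beta>) / (1 - \<beta>)"
proof (induction m)
  case (Suc m)
  have "(real m + 1) powr (-\<beta>) \<le> ((real m + 1) powr (1 - \<beta>) - real m powr (1 - \<beta>)) / (1 - \<beta>)"
  \<comment> \<open>The primitive is not differentiable at 0, so the first term is compared
    directly: \<open>1 \<le> 1 / (1 - \<beta>)\<close>.\<close>
  proof (cases "m = 0")
    case True
    then show ?thesis using assms by (simp add: field_simps)
  next
    case False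
    then have m: "real m > 0" by simp
    have "\<exists>z. real m < z \<and> z < real m + 1 \<and> (real m + 1) powr (1 - \<beta>) - real m powr (1 - \<beta>)
      = (real m + 1 - real m) * ((1 - \<beta>) * z powr (1 - \<beta> - 1))"
      using m by (intro MVT2 has_real_derivative_powr) auto
    then obtain z where z: "real m < z" "z < real m + 1"
      "(real m + 1) powr (1 - \<beta>) - real m powr (1 - \<beta>) = (1 - \<beta>) * z powr (-\<beta>)" by auto
    have "(real m + 1) powr (-\<beta>) \<le> z powr (-\<beta>)"
      using z m assms by (intro powr_mono2') auto
    then show ?thesis using z(3) assms by simp
  qed
  then show ?case using Suc assms by (simp add: field_simps add.commute)
qed simp

text \<open>Reading a sum as the integral of a step function with cells of length
  \<open>1 / n\<close> brings limits of sums under dominated convergence. Each point lies in at most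
  one cell, so the interchange of sum and integral needs only summable cell integrals.\<close>

lemma integral_step_function:
  fixes g :: "nat \<Rightarrow> real"
  assumes n: "n > 0" and g: "summable (\<lambda>k. \<bar>g k\<bar>)"
  shows "(LINT x|lborel. indicator {0..} x * g (nat \<lfloor>real n * x\<rfloor>)) = (\<Sum>k. g k) / real n"
proof -
  define I where "I k = {real k / n ..< (real k + 1) / n}" for k
  have meas: "measure lborel (I k) = 1 / n" for k
    using n by (simp add: I_def divide_simps)
  have I: "x \<in> I k \<longleftrightarrow> 0 \<le> x \<and> nat \<lfloor>real n * x\<rfloor> = k" for x k
  proof -
    have "x \<in> I k \<longleftrightarrow> real k \<le> real n * x \<and> real n * x < real k + 1"
      using n by (auto simp: I_def field_simps)
    also have "\<dots> \<longleftrightarrow> \<lfloor>real n * x\<rfloor> = int k"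
      by (auto simp: floor_eq_iff)
    also have "\<dots> \<longleftrightarrow> 0 \<le> real n * x \<and> nat \<lfloor>real n * x\<rfloor> = k"
      by linarith
    also have "0 \<le> real n * x \<longleftrightarrow> 0 \<le> x" using n by (simp add: zero_le_mult_iff)
    finally show ?thesis .
  qed
  have sums: "(\<lambda>k. indicator (I k) x * g k) sums (indicator {0..} x * g (nat \<lfloor>real n * x\<rfloor>))" for x
  proof (cases "0 \<le> x")
    case True
    have "(\<lambda>k. if k = nat \<lfloor>real n * x\<rfloor> then g k else 0) sums g (nat \<lfloor>real n * x\<rfloor>)"
      by (rule sums_single)
    also have "(\<lambda>k. if k = nat \<lfloor>real n * x\<rfloor> then g k else 0) = (\<lambda>k. indicator (I k) x * g k)"
      using True I[of x] by (auto simp: fun_eq_iff indicator_def)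
    finally show ?thesis using True by simp
  next
    case False
    then have "(\<lambda>k. indicator (I k) x * g k) = (\<lambda>k. 0)" using I[of x] by (auto simp: fun_eq_iff indicator_def)
    then show ?thesis using False by simp
  qed
  have fin: "emeasure lborel (I k) < \<infinity>" for k using n by (simp add: I_def divide_right_mono)
  have int: "integrable lborel (\<lambda>x. indicator (I k) x * g k :: real)" for k
    using fin[of k] by (intro integrable_mult_left integrable_real_indicator) (auto simp: I_def)
  have "(LINT x|lborel. indicator {0..} x * g (nat \<lfloor>real n * x\<rfloor>))
      = (LINT x|lborel. (\<Sum>k. indicator (I k) x * g k))"
    using sums by (simp add: sums_iff)
  also have "\<dots> = (\<Sum>k. LINT x|lborel. indicator (I k) x * g k)"
  proof (rule integral_suminf[OF int])
    show "AE x in lborel. summable (\<lambda>i. norm (indicator (I i) x * g i))"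
    proof (rule AE_I2)
      fix x :: real
      have "(\<lambda>i. norm (indicator (I i) x * g i)) = (\<lambda>i. if i = nat \<lfloor>real n * x\<rfloor> then norm (indicator (I i) x * g i) else 0)"
        using I[of x] by (auto simp: fun_eq_iff indicator_def)
      then show "summable (\<lambda>i. norm (indicator (I i) x * g i))"
        using summable_single[of "nat \<lfloor>real n * x\<rfloor>"] by simp
    qed
    show "summable (\<lambda>i. LINT x|lborel. norm (indicator (I i) x * g i))"
      using g by (simp add: abs_mult meas summable_divide)
  qed
  also have "\<dots> = (\<Sum>k. g k / n)"
    by (simp add: meas)
  also have "\<dots> = (\<Sum>k. g k) / n"
    using g summable_rabs_cancel by (intro suminf_divide) auto
  finally show ?thesis .
qed

text \<open>Near 0 the integrand is below \<open>x powr -\<gamma>\<close>, integrable as \<gamma> <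
  1; near infinity it is below \<open>x powr (-2*\<gamma>)\<close>, integrable as
  \<open>2 * \<gamma> > 1\<close>. The point 1, in neither open interval, is a null set.\<close>

lemma integrable_powr_convolution:
  fixes \<gamma> :: real
  assumes "1/2 < \<gamma>" "\<gamma> < 1"
  shows "set_integrable lborel {0<..} (\<lambda>x. x powr (-\<gamma>) * (1 + x) powr (-\<gamma>))"
proof -
  have i1: "set_integrable lborel (einterval 0 1) (\<lambda>x::real. x powr (-\<gamma>))"
  proof (rule interval_integral_FTC_nonneg(1)[where F="\<lambda>x. x powr (1 - \<gamma>) / (1 - \<gamma>)" and A = 0 and B = "1 / (1 - \<gamma>)"])
    show "((\<lambda>x. x powr (1 - \<gamma>) / (1 - \<gamma>)) has_real_derivative x powr - \<gamma>) (at x)" if "0 < ereal x" for x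
      using that assms by (auto intro!: derivative_eq_intros simp: zero_ereal_def)
    show "(((\<lambda>x. x powr (1 - \<gamma>) / (1 - \<gamma>)) \<circ> real_of_ereal) \<longlongrightarrow> 0) (at_right 0)"
      unfolding zero_ereal_def ereal_tendsto_simps using assms by real_asymp
    show "(((\<lambda>x. x powr (1 - \<gamma>) / (1 - \<gamma>)) \<circ> real_of_ereal) \<longlongrightarrow> 1 / (1 - \<gamma>)) (at_left 1)"
      unfolding one_ereal_def ereal_tendsto_simps using assms by (auto intro!: tendsto_eq_intros)
  qed (use assms in \<open>auto intro!: continuous_intros simp: zero_ereal_def\<close>)
  have i2: "set_integrable lborel (einterval 1 \<infinity>) (\<lambda>x::real. x powr (-2*\<gamma>))"
  proof (rule interval_integral_FTC_nonneg(1)[where F="\<lambda>x. x powr (1 - 2*\<gamma>) / (1 - 2*\<gamma>)" and A = "1 / (1 - 2*\<gamma>)" and B = 0])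
    show "((\<lambda>x. x powr (1 - 2*\<gamma>) / (1 - 2*\<gamma>)) has_real_derivative x powr (-2*\<gamma>)) (at x)" if "1 < ereal x" for x
      using that assms by (auto intro!: derivative_eq_intros simp: one_ereal_def)
    show "(((\<lambda>x. x powr (1 - 2*\<gamma>) / (1 - 2*\<gamma>)) \<circ> real_of_ereal) \<longlongrightarrow> 1 / (1 - 2*\<gamma>)) (at_right 1)"
      unfolding one_ereal_def ereal_tendsto_simps using assms by (auto intro!: tendsto_eq_intros)
    show "(((\<lambda>x. x powr (1 - 2*\<gamma>) / (1 - 2*\<gamma>)) \<circ> real_of_ereal) \<longlongrightarrow> 0) (at_left \<infinity>)"
      unfolding ereal_tendsto_simps using assms by real_asymp
  qed (use assms in \<open>auto intro!: continuous_intros simp: one_ereal_def\<close>)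
  have e: "einterval 0 1 = {0<..<1::real}" "einterval 1 \<infinity> = {1::real<..}"
    by (auto simp: einterval_def zero_ereal_def one_ereal_def)
  have "integrable lborel (\<lambda>x. indicator {0<..<1} x *\<^sub>R x powr (-\<gamma>) + indicator {1<..} x *\<^sub>R x powr (-2*\<gamma>))"
    using i1 i2 unfolding e set_integrable_def by (rule Bochner_Integration.integrable_add)
  then show ?thesis unfolding set_integrable_def
  proof (rule Bochner_Integration.integrable_bound)
    show "AE x in lborel. norm (indicator {0<..} x *\<^sub>R (x powr - \<gamma> * (1 + x) powr - \<gamma>))
       \<le> norm (indicator {0<..<1} x *\<^sub>R x powr - \<gamma> + indicator {1<..} x *\<^sub>R x powr (- 2 * \<gamma>))"
      using AE_lborel_singleton[of 1]
    proof eventually_elim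
      fix x :: real assume x: "x \<noteq> 1"
      have a: "(1 + x) powr -\<gamma> \<le> 1" if "x > 0"
        using that assms powr_mono2'[of "-\<gamma>" 1 "1 + x"] by simp
      have b: "(1 + x) powr -\<gamma> \<le> x powr -\<gamma>" if "x > 0"
        using that assms by (intro powr_mono2') auto
      have c: "x powr (-2*\<gamma>) = x powr -\<gamma> * x powr -\<gamma>" if "x > 0"
        using that by (simp add: powr_add[symmetric])
      show "norm (indicator {0<..} x *\<^sub>R (x powr - \<gamma> * (1 + x) powr - \<gamma>))
       \<le> norm (indicator {0<..<1} x *\<^sub>R x powr - \<gamma> + indicator {1<..} x *\<^sub>R x powr (- 2 * \<gamma>))"
        using x a b c by (auto simp: indicator_def abs_mult intro!: mult_left_mono mult_left_le)
    qed
  qed auto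
qed

text \<open>The shift to \<open>k + 1\<close> is there because \<open>0 powr -\<gamma>\<close> is 0:
  with \<open>k\<close> itself the bound would force \<open>\<psi> 0 = 0\<close>.\<close>

lemma powr_decay_bound:
  fixes \<psi> :: "nat \<Rightarrow> real"
  assumes "(\<lambda>k. \<psi> k / real k powr (-\<gamma>)) \<longlonglongrightarrow> l"
  shows "\<exists>C>0. \<forall>k. \<bar>\<psi> k\<bar> \<le> C * (real k + 1) powr (-\<gamma>)"
proof -
  have "(\<lambda>k. real k powr (-\<gamma>) / (real k + 1) powr (-\<gamma>)) \<longlonglongrightarrow> 1" by real_asymp
  from tendsto_mult[OF assms this]
  have "(\<lambda>k. \<psi> k / real k powr (-\<gamma>) * (real k powr (-\<gamma>) / (real k + 1) powr (-\<gamma>))) \<longlonglongrightarrow> l" by simp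
  then have "(\<lambda>k. \<psi> k / (real k + 1) powr (-\<gamma>)) \<longlonglongrightarrow> l"
    by (rule Lim_transform_eventually) (use eventually_gt_at_top[of 0] in eventually_elim, simp)
  then have "Bseq (\<lambda>k. \<psi> k / (real k + 1) powr (-\<gamma>))"
    by (intro convergent_imp_Bseq) (auto simp: convergent_def)
  then obtain C where "C > 0" "\<And>k. \<bar>\<psi> k / (real k + 1) powr (-\<gamma>)\<bar> \<le> C"
    by (auto simp: Bseq_def)
  then show ?thesis by (intro exI[of _ C]) (auto simp: abs_divide field_simps)
qed

lemma floor_scaling_tendsto:
  fixes x :: real
  assumes "x > 0"
  shows "(\<lambda>n. real (nat \<lfloor>real n * x\<rfloor>) / real n) \<longlonglongrightarrow> x"
    and "filterlim (\<lambda>n. nat \<lfloor>real n * x\<rfloor>) at_top sequentially"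
proof -
  have *: "real (nat \<lfloor>real n * x\<rfloor>) = of_int \<lfloor>real n * x\<rfloor>" for n using assms by simp
  show "(\<lambda>n. real (nat \<lfloor>real n * x\<rfloor>) / real n) \<longlonglongrightarrow> x" unfolding * using assms by real_asymp
  have "filterlim (\<lambda>n. real (nat \<lfloor>real n * x\<rfloor>)) at_top sequentially"
    unfolding * using assms by real_asymp
  then show "filterlim (\<lambda>n. nat \<lfloor>real n * x\<rfloor>) at_top sequentially"
    by (simp add: filterlim_sequentially_iff_filterlim_real)
qed

text \<open>The substitution \<open>k = n x\<close> turns the sum into an integral, and the bound
  \<open>\<bar>\<psi> k\<bar> \<le> C (k + 1) powr - \<gamma>\<close> scales to the same dominating function for every \<open>n\<close>.\<close>

lemma autocovariance_asymptotics:
  fixes \<psi> :: "nat \<Rightarrow> real"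
  assumes \<gamma>: "1/2 < \<gamma>" "\<gamma> < 1" and lim: "(\<lambda>k. \<psi> k / real k powr (-\<gamma>)) \<longlonglongrightarrow> 1"
  shows "summable (\<lambda>k. \<bar>\<psi> k * \<psi> (k + n)\<bar>)"
    and "(\<lambda>n. (\<Sum>k. \<psi> k * \<psi> (k + n)) / real n powr (1 - 2*\<gamma>)) \<longlonglongrightarrow>
       (LINT x:{0<..}|lborel. x powr (-\<gamma>) * (1 + x) powr (-\<gamma>))"
proof -
  obtain C where C: "C > 0" "\<And>k. \<bar>\<psi> k\<bar> \<le> C * (real k + 1) powr (-\<gamma>)"
    using powr_decay_bound[OF lim] by auto
  have summ: "summable (\<lambda>k. \<bar>\<psi> k * \<psi> (k + n)\<bar>)" for n
  proof (rule summable_comparison_test')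
    have "summable (\<lambda>k. real k powr (-2*\<gamma>))" using \<gamma> by (subst summable_real_powr_iff) auto
    then have "summable (\<lambda>k. real (Suc k) powr (-2*\<gamma>))" by (subst summable_Suc_iff)
    then show "summable (\<lambda>k. C * C * (real (Suc k) powr (-2*\<gamma>)))" by (rule summable_mult)
    fix k :: nat
    have "\<bar>\<psi> k * \<psi> (k + n)\<bar> \<le> (C * (real k + 1) powr (-\<gamma>)) * (C * (real (k + n) + 1) powr (-\<gamma>))"
      unfolding abs_mult by (intro mult_mono C) (auto simp: C less_imp_le)
    also have "\<dots> \<le> (C * (real k + 1) powr (-\<gamma>)) * (C * (real k + 1) powr (-\<gamma>))"
      using C(1) \<gamma> by (intro mult_left_mono powr_mono2') auto
    also have "\<dots> = C * C * (real (Suc k) powr (-2*\<gamma>))"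
      by (simp add: powr_add[symmetric] add.commute)
    finally show "norm \<bar>\<psi> k * \<psi> (k + n)\<bar> \<le> C * C * (real (Suc k) powr (-2*\<gamma>))" by simp
  qed
  then show "summable (\<lambda>k. \<bar>\<psi> k * \<psi> (k + n)\<bar>)" .
  define s where "s n x = indicator {0<..} x * (real n powr (2*\<gamma>) * (\<psi> (nat \<lfloor>real n * x\<rfloor>) * \<psi> (nat \<lfloor>real n * x\<rfloor> + n)))" for n x
  have r: "(\<Sum>k. \<psi> k * \<psi> (k + n)) / real n powr (1 - 2*\<gamma>) = (LINT x|lborel. s n x)" if n: "n > 0" for n
  proof -
    have "(LINT x|lborel. s n x) = (LINT x|lborel. indicator {0..} x * (real n powr (2*\<gamma>) * (\<psi> (nat \<lfloor>real n * x\<rfloor>) * \<psi> (nat \<lfloor>real n * x\<rfloor> + n))))"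
    proof (rule integral_cong_AE)
      show "AE x in lborel. s n x = indicator {0..} x * (real n powr (2*\<gamma>) * (\<psi> (nat \<lfloor>real n * x\<rfloor>) * \<psi> (nat \<lfloor>real n * x\<rfloor> + n)))"
        using AE_lborel_singleton[of 0] by eventually_elim (auto simp: s_def indicator_def)
    qed (auto simp: s_def)
    also have "\<dots> = (\<Sum>k. real n powr (2*\<gamma>) * (\<psi> k * \<psi> (k + n))) / real n"
      using summ n by (intro integral_step_function) (auto simp: abs_mult summable_mult)
    also have "\<dots> = real n powr (2*\<gamma>) * (\<Sum>k. \<psi> k * \<psi> (k + n)) / real n"
      using summ[of n] by (subst suminf_mult) (auto intro: summable_rabs_cancel)
    also have "\<dots> = (\<Sum>k. \<psi> k * \<psi> (k + n)) / real n powr (1 - 2*\<gamma>)"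
      using n by (simp add: powr_diff)
    finally show ?thesis by simp
  qed
  have "(\<lambda>n. LINT x|lborel. s n x) \<longlonglongrightarrow> (LINT x|lborel. indicator {0<..} x *\<^sub>R (x powr (-\<gamma>) * (1 + x) powr (-\<gamma>)))"
  proof (rule integral_dominated_convergence)
    show "integrable lborel (\<lambda>x. C * C * (indicator {0<..} x *\<^sub>R (x powr (-\<gamma>) * (1 + x) powr (-\<gamma>))))"
      using integrable_powr_convolution[OF \<gamma>] unfolding set_integrable_def by (rule integrable_mult_right)
    show "AE x in lborel. (\<lambda>n. s n x) \<longlonglongrightarrow> indicator {0<..} x *\<^sub>R (x powr (-\<gamma>) * (1 + x) powr (-\<gamma>))"
    proof (rule AE_I2)
      fix x :: real
      show "(\<lambda>n. s n x) \<longlonglongrightarrow> indicator {0<..} x *\<^sub>R (x powr (-\<gamma>) * (1 + x) powr (-\<gamma>))"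
      proof (cases "x > 0")
        case x: True
        let ?k = "\<lambda>n. nat \<lfloor>real n * x\<rfloor>"
        have k: "(\<lambda>n. real (?k n) / real n) \<longlonglongrightarrow> x" "filterlim ?k at_top sequentially"
          using floor_scaling_tendsto[OF x] by auto
        \<comment> \<open>The rescaled weights converge along every index sequence
          \<open>j n\<close> of order \<open>y * n\<close>; the choices \<open>y = x\<close> and
          \<open>y = x + 1\<close> give the two factors of the integrand.\<close>
        have *: "(\<lambda>n. \<psi> (j n) * real n powr \<gamma>) \<longlonglongrightarrow> y powr (-\<gamma>)"
          if j: "(\<lambda>n. real (j n) / real n) \<longlonglongrightarrow> y" "filterlim j at_top sequentially" "y > 0" for j y
        proof -
          have "(\<lambda>n. \<psi> (j n) / real (j n) powr (-\<gamma>) * (real (j n) / real n) powr (-\<gamma>)) \<longlonglongrightarrow> 1 * y powr (-\<gamma>)"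
            using j by (intro tendsto_mult filterlim_compose[OF lim j(2)] tendsto_powr tendsto_const) auto
          then have "(\<lambda>n. \<psi> (j n) / real (j n) powr (-\<gamma>) * (real (j n) / real n) powr (-\<gamma>)) \<longlonglongrightarrow> y powr (-\<gamma>)" by simp
          moreover have "eventually (\<lambda>n. j n \<ge> 1) sequentially"
            using j(2) unfolding filterlim_at_top by blast
          then have "eventually (\<lambda>n. \<psi> (j n) / real (j n) powr (-\<gamma>) * (real (j n) / real n) powr (-\<gamma>) = \<psi> (j n) * real n powr \<gamma>) sequentially"
            using eventually_gt_at_top[of 0]
            by eventually_elim (simp add: powr_divide powr_minus field_simps)
          ultimately show ?thesis by (rule Lim_transform_eventually)
        qed
        have k2: "(\<lambda>n. real (?k n + n) / real n) \<longlonglongrightarrow> x + 1"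
        proof (rule Lim_transform_eventually)
          show "(\<lambda>n. real (?k n) / real n + 1) \<longlonglongrightarrow> x + 1" by (intro tendsto_intros k)
          show "eventually (\<lambda>n. real (?k n) / real n + 1 = real (?k n + n) / real n) sequentially"
            using eventually_gt_at_top[of 0] by eventually_elim (simp add: field_simps)
        qed
        have k3: "filterlim (\<lambda>n. ?k n + n) at_top sequentially"
          by (rule filterlim_at_top_mono[OF k(2)]) auto
        have "(\<lambda>n. (\<psi> (?k n) * real n powr \<gamma>) * (\<psi> (?k n + n) * real n powr \<gamma>)) \<longlonglongrightarrow> x powr (-\<gamma>) * (x + 1) powr (-\<gamma>)"
          using x by (intro tendsto_mult * k k2 k3) auto
        also have "(\<lambda>n. (\<psi> (?k n) * real n powr \<gamma>) * (\<psi> (?k n + n) * real n powr \<gamma>)) = (\<lambda>n. s n x)"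
        proof
          fix n
          have "real n powr (2*\<gamma>) = real n powr \<gamma> * real n powr \<gamma>" by (simp add: powr_add[symmetric])
          then show "(\<psi> (?k n) * real n powr \<gamma>) * (\<psi> (?k n + n) * real n powr \<gamma>) = s n x"
            using x by (simp add: s_def)
        qed
        finally show ?thesis using x by (simp add: add.commute)
      qed (simp add: s_def)
    qed
    show "AE x in lborel. norm (s n x) \<le> C * C * (indicator {0<..} x *\<^sub>R (x powr (-\<gamma>) * (1 + x) powr (-\<gamma>)))" for n
    proof (rule AE_I2)
      fix x :: real
      show "norm (s n x) \<le> C * C * (indicator {0<..} x *\<^sub>R (x powr (-\<gamma>) * (1 + x) powr (-\<gamma>)))"
      proof (cases "x > 0 \<and> n > 0")
        case True
        define k where "k = nat \<lfloor>real n * x\<rfloor>"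
        have k: "real n * x \<le> real k + 1" using True unfolding k_def by linarith
        have 1: "\<bar>\<psi> k\<bar> \<le> C * (real n * x) powr (-\<gamma>)"
        proof -
          have "(real k + 1) powr (-\<gamma>) \<le> (real n * x) powr (-\<gamma>)"
            using k True \<gamma> by (intro powr_mono2') auto
          then show ?thesis using C(2)[of k] mult_left_mono[OF _ less_imp_le[OF C(1)]] order_trans by blast
        qed
        have 2: "\<bar>\<psi> (k + n)\<bar> \<le> C * (real n * (1 + x)) powr (-\<gamma>)"
        proof -
          have "(real (k + n) + 1) powr (-\<gamma>) \<le> (real n * (1 + x)) powr (-\<gamma>)"
            using k True \<gamma> by (intro powr_mono2') (auto simp: algebra_simps intro!: add_pos_pos)
          then show ?thesis using C(2)[of "k + n"] mult_left_mono[OF _ less_imp_le[OF C(1)]] order_trans by blast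
        qed
        have "\<bar>\<psi> k\<bar> * \<bar>\<psi> (k + n)\<bar> \<le> (C * (real n * x) powr (-\<gamma>)) * (C * (real n * (1 + x)) powr (-\<gamma>))"
          using C(1) by (intro mult_mono 1 2) auto
        also have "\<dots> = C * C * (x powr (-\<gamma>) * (1 + x) powr (-\<gamma>)) * (real n powr (-\<gamma>) * real n powr (-\<gamma>))"
          using True by (simp add: powr_mult)
        also have "real n powr (-\<gamma>) * real n powr (-\<gamma>) = real n powr (-(2*\<gamma>))" by (simp add: powr_add[symmetric])
        finally have "real n powr (2*\<gamma>) * (\<bar>\<psi> k\<bar> * \<bar>\<psi> (k + n)\<bar>) \<le> real n powr (2*\<gamma>) * (C * C * (x powr (-\<gamma>) * (1 + x) powr (-\<gamma>)) * real n powr (-(2*\<gamma>)))"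
          by (intro mult_left_mono) auto
        also have "\<dots> = C * C * (x powr (-\<gamma>) * (1 + x) powr (-\<gamma>))"
          using True by (simp add: powr_minus)
        finally show ?thesis using True by (simp add: s_def k_def abs_mult)
      qed (auto simp: s_def indicator_def)
    qed
  qed (auto simp: s_def)
  then show "(\<lambda>n. (\<Sum>k. \<psi> k * \<psi> (k + n)) / real n powr (1 - 2*\<gamma>)) \<longlonglongrightarrow>
       (LINT x:{0<..}|lborel. x powr (-\<gamma>) * (1 + x) powr (-\<gamma>))"
    unfolding set_lebesgue_integral_def
    by (rule Lim_transform_eventually) (use eventually_gt_at_top[of 0] in eventually_elim, simp add: r)
qed

section \<open>A maximal inequality\<close>

definition max_sq_sum :: "(nat \<Rightarrow> 'a \<Rightarrow> real) \<Rightarrow> nat \<Rightarrow> nat \<Rightarrow> 'a \<Rightarrow> real" where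
  "max_sq_sum X a n \<omega> = Max ((\<lambda>j. (\<Sum>i<j. X (a + i) \<omega>)\<^sup>2) ` {..n})"

lemma max_sq_sum_ge: "j \<le> n \<Longrightarrow> (\<Sum>i<j. X (a + i) \<omega>)\<^sup>2 \<le> max_sq_sum X a n \<omega>"
  unfolding max_sq_sum_def by (intro Max_ge) auto

lemma max_sq_sum_nonneg: "0 \<le> max_sq_sum X a n \<omega>"
  using max_sq_sum_ge[of 0 n X a \<omega>] by simp

lemma max_sq_sum_mono: "m \<le> n \<Longrightarrow> max_sq_sum X a m \<omega> \<le> max_sq_sum X a n \<omega>"
  unfolding max_sq_sum_def by (intro Max_mono) auto

text \<open>A partial sum ending in the second half is the total \<open>u\<close> of the first half
  plus a partial sum \<open>v\<close> of the second, and
  \<open>(u + v)^2 \<le> (1 + \<theta>) v^2 + (1 + 1/\<theta>) u^2\<close>. The large factor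
  \<open>1 + 1/\<theta>\<close> falls only on \<open>u\<close>, whose second moment is bounded
  without taking a maximum. The sum of the two maxima replaces their maximum, which is simpler to
  integrate.\<close>

lemma max_sq_sum_double:
  assumes \<theta>: "\<theta> > 0"
  shows "max_sq_sum X a (2 * n) \<omega> \<le>
    (1 + \<theta>) * (max_sq_sum X a n \<omega> + max_sq_sum X (a + n) n \<omega>) + (1 + 1/\<theta>) * (\<Sum>i<n. X (a + i) \<omega>)\<^sup>2"
    (is "_ \<le> ?R")
proof -
  have A: "max_sq_sum X a n \<omega> \<ge> 0" "max_sq_sum X (a + n) n \<omega> \<ge> 0" by (rule max_sq_sum_nonneg)+
  have "(\<Sum>i<j. X (a + i) \<omega>)\<^sup>2 \<le> ?R" if j: "j \<le> 2 * n" for j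
  proof (cases "j \<le> n")
    case True
    have "(\<Sum>i<j. X (a + i) \<omega>)\<^sup>2 \<le> 1 * (max_sq_sum X a n \<omega> + max_sq_sum X (a + n) n \<omega>) + 0"
      using max_sq_sum_ge[OF True, of X a \<omega>] A by simp
    also have "\<dots> \<le> ?R" using A \<theta> by (intro add_mono mult_right_mono) auto
    finally show ?thesis .
  next
    case False
    then obtain k where k: "j = n + k" "k \<le> n" using j by (metis add_le_cancel_left le_add_diff_inverse mult_2 nat_le_linear)
    define u where "u = (\<Sum>i<n. X (a + i) \<omega>)"
    define v where "v = (\<Sum>i<k. X (a + n + i) \<omega>)"
    have s: "(\<Sum>i<j. X (a + i) \<omega>) = u + v"
      unfolding k u_def v_def by (induction k) (auto simp: add.assoc)
    have "0 \<le> (sqrt (1/\<theta>) * u - sqrt \<theta> * v)\<^sup>2" by simp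
    also have "\<dots> = u\<^sup>2 / \<theta> + \<theta> * v\<^sup>2 - 2 * (sqrt (1/\<theta>) * sqrt \<theta>) * (u * v)"
      using \<theta> by (simp add: power2_diff power_mult_distrib)
    also have "sqrt (1/\<theta>) * sqrt \<theta> = 1" using \<theta> by (simp add: real_sqrt_mult[symmetric])
    finally have "(u + v)\<^sup>2 \<le> (1 + \<theta>) * v\<^sup>2 + (1 + 1/\<theta>) * u\<^sup>2"
      by (simp add: power2_sum algebra_simps)
    also have "v\<^sup>2 \<le> max_sq_sum X a n \<omega> + max_sq_sum X (a + n) n \<omega>"
      using max_sq_sum_ge[OF k(2), of X "a + n" \<omega>] A by (simp add: v_def)
    finally show ?thesis using \<theta> unfolding s u_def by (simp add: mult_left_mono)
  qed
  then show ?thesis unfolding max_sq_sum_def[of X a "2*n"] by (intro Max.boundedI) auto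
qed

text \<open>Doubling the range gives \<open>m (2 n) \<le> 2 (1 + \<theta>) m n + (1 + 1/\<theta>) C n powr p\<close> for the expected
  maximum \<open>m\<close>. The choice \<open>\<theta> = 2 powr p / 4 - 1/2\<close> makes \<open>2 (1 + \<theta>) < 2 powr p\<close>, so the recursion
  preserves the order \<open>n powr p\<close>; the factor \<open>2 powr p\<close> rounds \<open>n\<close> up to a power of two.\<close>

definition maximal_const :: "real \<Rightarrow> real" where
  "maximal_const p = 2 powr p * (1 + (1 + 1 / (2 powr p / 4 - 1/2)) / (2 powr p / 2 - 1))"

lemma two_powr_gt_2: "p > 1 \<Longrightarrow> (2::real) powr p > 2"
  using powr_less_mono[of 1 p "2::real"] by simp

lemma maximal_const_pos:
  assumes "p > 1"
  shows "maximal_const p > 0"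
  using two_powr_gt_2[OF assms] unfolding maximal_const_def
  by (intro mult_pos_pos add_pos_nonneg divide_nonneg_nonneg) auto

context prob_space
begin

context
  fixes X :: "nat \<Rightarrow> 'a \<Rightarrow> real" and p C :: real
  assumes p: "1 < p" and C: "0 \<le> C" and X[measurable]: "\<And>i. X i \<in> borel_measurable M"
    and int: "\<And>a n. integrable M (\<lambda>\<omega>. (\<Sum>i<n. X (a + i) \<omega>)\<^sup>2)"
    and bound: "\<And>a n. expectation (\<lambda>\<omega>. (\<Sum>i<n. X (a + i) \<omega>)\<^sup>2) \<le> C * real n powr p"
begin

lemma borel_measurable_max_sq_sum[measurable]: "max_sq_sum X a n \<in> borel_measurable M"
  unfolding max_sq_sum_def[abs_def] by (intro borel_measurable_Max) auto

lemma integrable_max_sq_sum: "integrable M (max_sq_sum X a n)"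
proof (rule Bochner_Integration.integrable_bound)
  show "integrable M (\<lambda>\<omega>. \<Sum>j\<le>n. (\<Sum>i<j. X (a + i) \<omega>)\<^sup>2)"
    using int by (intro Bochner_Integration.integrable_sum) auto
  show "AE \<omega> in M. norm (max_sq_sum X a n \<omega>) \<le> norm (\<Sum>j\<le>n. (\<Sum>i<j. X (a + i) \<omega>)\<^sup>2)"
  proof (rule AE_I2)
    fix \<omega>
    have "max_sq_sum X a n \<omega> \<le> (\<Sum>j\<le>n. (\<Sum>i<j. X (a + i) \<omega>)\<^sup>2)"
      unfolding max_sq_sum_def
      by (intro Max.boundedI) (auto intro!: member_le_sum)
    then show "norm (max_sq_sum X a n \<omega>) \<le> norm (\<Sum>j\<le>n. (\<Sum>i<j. X (a + i) \<omega>)\<^sup>2)"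
      using max_sq_sum_nonneg[of X a n \<omega>] by simp
  qed
qed simp

text \<open>The start \<open>a\<close> is generalised because the second half of a block begins at
  \<open>a + 2 ^ k\<close>.\<close>

lemma expectation_max_sq_sum_dyadic:
  "expectation (max_sq_sum X a (2 ^ k))
     \<le> (1 + (1 + 1 / (2 powr p / 4 - 1/2)) / (2 powr p / 2 - 1)) * C * real (2 ^ k) powr p"
proof (induction k arbitrary: a)
  define t where "t = (2::real) powr p"
  have t: "t > 2" using p two_powr_gt_2 by (simp add: t_def)
  define \<theta> where "\<theta> = t / 4 - 1/2"
  have \<theta>: "\<theta> > 0" using t by (simp add: \<theta>_def)
  define K where "K = (1 + (1 + 1 / \<theta>) / (t / 2 - 1))"
  have K1: "K \<ge> 1" using t \<theta> by (simp add: K_def)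
  \<comment> \<open>Here \<open>2 * (1 + \<theta>) = t / 2 + 1\<close>, so the recursion closes as
    soon as \<open>K * (t / 2 - 1)\<close> covers \<open>1 + 1/\<theta>\<close>. The second summand
    of \<open>K\<close> achieves exactly this; the summand 1 serves the base case.\<close>
  have Kt: "(1 + \<theta>) * 2 * K + (1 + 1/\<theta>) \<le> K * t"
  proof -
    have "K * t - (1 + \<theta>) * 2 * K = K * (t / 2 - 1)" by (simp add: \<theta>_def algebra_simps)
    also have "\<dots> = (t / 2 - 1) + (1 + 1/\<theta>)" 
    proof -
      have gen: "x / y * y = x" if "y \<noteq> 0" for x y :: real using that by simp
      have "(1 + 1/\<theta>) / (t / 2 - 1) * (t / 2 - 1) = 1 + 1/\<theta>"
        by (rule gen) (use t in simp)
      then show ?thesis unfolding K_def distrib_right by simp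
    qed
    finally show ?thesis using t by simp
  qed
  {
    case 0
    have "expectation (max_sq_sum X a (2 ^ 0)) = expectation (\<lambda>\<omega>. (\<Sum>i<1. X (a + i) \<omega>)\<^sup>2)"
      by (intro Bochner_Integration.integral_cong) (auto simp: max_sq_sum_def atMost_Suc)
    also have "\<dots> \<le> C" using bound[of a 1] by simp
    also have "\<dots> \<le> K * C" using K1 C by (simp add: mult_right_mono[of 1 K C, simplified])
    finally show ?case by (simp add: K_def \<theta>_def t_def)
  next
    case (Suc k)
    have IH: "expectation (max_sq_sum X a (2 ^ k)) \<le> K * C * real (2 ^ k) powr p" for a
      using Suc[of a] by (simp add: K_def \<theta>_def t_def)
    have "expectation (max_sq_sum X a (2 ^ Suc k)) \<le> expectation (\<lambda>\<omega>.
        (1 + \<theta>) * (max_sq_sum X a (2^k) \<omega> + max_sq_sum X (a + 2^k) (2^k) \<omega>)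
          + (1 + 1/\<theta>) * (\<Sum>i<2^k. X (a + i) \<omega>)\<^sup>2)"
      using max_sq_sum_double[OF \<theta>, of X a "2^k"]
      by (intro integral_mono integrable_max_sq_sum Bochner_Integration.integrable_add
            integrable_mult_right int) auto
    also have "\<dots> = (1 + \<theta>) * (expectation (max_sq_sum X a (2^k)) + expectation (max_sq_sum X (a + 2^k) (2^k)))
          + (1 + 1/\<theta>) * expectation (\<lambda>\<omega>. (\<Sum>i<2^k. X (a + i) \<omega>)\<^sup>2)"
      using int by (simp add: integrable_max_sq_sum)
    also have "\<dots> \<le> (1 + \<theta>) * (K * C * real (2 ^ k) powr p + K * C * real (2 ^ k) powr p)
          + (1 + 1/\<theta>) * (C * real (2 ^ k) powr p)"
      using \<theta> by (intro add_mono mult_left_mono IH bound) (auto simp: add_nonneg_nonneg)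
    also have "\<dots> = ((1 + \<theta>) * 2 * K + (1 + 1/\<theta>)) * (C * real (2 ^ k) powr p)"
      by (simp add: algebra_simps)
    also have "\<dots> \<le> K * t * (C * real (2 ^ k) powr p)"
      using C by (intro mult_right_mono Kt) auto
    also have "\<dots> = K * C * real (2 ^ Suc k) powr p"
      by (simp add: powr_mult t_def)
    finally show ?case by (simp add: K_def \<theta>_def t_def)
  }
qed

lemma expectation_max_sq_sum:
  "expectation (max_sq_sum X a n) \<le> maximal_const p * C * real n powr p"
proof (cases "n = 0")
  case True
  then show ?thesis by (simp add: max_sq_sum_def[abs_def])
next
  case False
  let ?K = "1 + (1 + 1 / (2 powr p / 4 - 1/2)) / (2 powr p / 2 - 1)"
  have K: "?K \<ge> 0" using two_powr_gt_2[OF p] by (intro add_nonneg_nonneg divide_nonneg_nonneg) auto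
  obtain k where k: "2 ^ k \<le> n" "n < 2 ^ (Suc k)"
    using ex_power_ivl1[of 2 n] False by auto
  have "expectation (max_sq_sum X a n) \<le> expectation (max_sq_sum X a (2 ^ Suc k))"
    using k(2) max_sq_sum_mono[of n "2 ^ Suc k" X a] by (intro integral_mono integrable_max_sq_sum) auto
  also have "\<dots> \<le> ?K * C * real (2 ^ Suc k) powr p"
    by (rule expectation_max_sq_sum_dyadic)
  also have "\<dots> \<le> ?K * C * (2 * real n) powr p"
  proof (intro mult_left_mono powr_mono2)
    have "real (2 ^ k) \<le> real n" using k(1) of_nat_le_iff by blast
    then show "real (2 ^ Suc k) \<le> 2 * real n" by simp
  qed (use p K C in auto)
  also have "\<dots> = maximal_const p * C * real n powr p"
    by (simp add: powr_mult maximal_const_def)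
  finally show ?thesis .
qed

lemma prob_max_sum_ge:
  assumes B: "B > 0"
  shows "prob {\<omega>\<in>space M. \<exists>j\<le>n. B \<le> \<bar>\<Sum>i<j. X (a + i) \<omega>\<bar>} \<le> maximal_const p * C * real n powr p / B\<^sup>2"
proof -
  have "prob {\<omega>\<in>space M. \<exists>j\<le>n. B \<le> \<bar>\<Sum>i<j. X (a + i) \<omega>\<bar>} \<le> prob {\<omega>\<in>space M. B\<^sup>2 \<le> max_sq_sum X a n \<omega>}"
  proof (intro finite_measure_mono subsetI)
    fix \<omega> assume "\<omega> \<in> {\<omega>\<in>space M. \<exists>j\<le>n. B \<le> \<bar>\<Sum>i<j. X (a + i) \<omega>\<bar>}"
    then obtain j where j: "\<omega> \<in> space M" "j \<le> n" "B \<le> \<bar>\<Sum>i<j. X (a + i) \<omega>\<bar>" by auto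
    have "B\<^sup>2 \<le> (\<Sum>i<j. X (a + i) \<omega>)\<^sup>2" using j(3) B by (metis abs_le_square_iff abs_of_pos)
    also have "\<dots> \<le> max_sq_sum X a n \<omega>" by (rule max_sq_sum_ge[OF j(2)])
    finally show "\<omega> \<in> {\<omega>\<in>space M. B\<^sup>2 \<le> max_sq_sum X a n \<omega>}" using j(1) by simp
  qed measurable
  also have "\<dots> \<le> expectation (max_sq_sum X a n) / B\<^sup>2"
    using B by (intro integral_Markov_inequality_measure[where A="{}"] integrable_max_sq_sum)
      (auto intro!: AE_I2 max_sq_sum_nonneg)
  also have "\<dots> \<le> maximal_const p * C * real n powr p / B\<^sup>2"
    by (intro divide_right_mono expectation_max_sq_sum) auto
  finally show ?thesis .
qed

end

end

section \<open>Gaussian variables and Mehler's kernel\<close>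

lemma cos_mult_iexp: "complex_of_real (cos b) * iexp a = (iexp (a + b) + iexp (a + - b)) / 2"
  and sin_mult_iexp: "complex_of_real (sin b) * iexp a = (iexp (a + b) - iexp (a + - b)) / (2 * \<i>)"
  by (simp_all add: complex_eq_iff Re_exp Im_exp Re_divide Im_divide cos_add sin_add cos_diff sin_diff)

context prob_space
begin

text \<open>After division by \<open>c\<close> the weight is a probability density, and under the
  new measure \<open>X\<close> keeps its characteristic function, hence its law. Thus
  \<open>f\<close> is uncorrelated with every event about \<open>X\<close>.\<close>

lemma char_weighted_unique:
  fixes X f :: "'a \<Rightarrow> real"
  assumes X[measurable]: "X \<in> borel_measurable M" and f[measurable]: "f \<in> borel_measurable M"
    and nonneg: "\<And>\<omega>. 0 \<le> f \<omega>" and int: "integrable M f" and c: "c = expectation f" "c > 0"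
    and char: "\<And>s. (CLINT \<omega>|M. f \<omega> *\<^sub>R iexp (s * X \<omega>)) = c *\<^sub>R char (distr M borel X) s"
    and A[measurable]: "A \<in> sets borel"
  shows "expectation (\<lambda>\<omega>. f \<omega> * indicator A (X \<omega>)) = c * prob (X -` A \<inter> space M)"
proof -
  let ?D = "density M (\<lambda>\<omega>. ennreal (f \<omega> / c))"
  have D: "emeasure ?D B = ennreal (expectation (\<lambda>\<omega>. f \<omega> * indicator B \<omega>) / c)" if [measurable]: "B \<in> sets M" for B
  proof -
    have "emeasure ?D B = (\<integral>\<^sup>+\<omega>. ennreal (f \<omega> * indicator B \<omega> / c) \<partial>M)"
      by (subst emeasure_density) (auto intro!: nn_integral_cong simp: indicator_def)
    also have "\<dots> = ennreal (expectation (\<lambda>\<omega>. f \<omega> * indicator B \<omega> / c))"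
      using int c nonneg by (intro nn_integral_eq_integral) (auto intro!: integrable_real_mult_indicator)
    finally show ?thesis by simp
  qed
  interpret D: prob_space ?D
  proof
    have "expectation (\<lambda>\<omega>. f \<omega> * indicator (space M) \<omega>) = expectation f"
      by (intro Bochner_Integration.integral_cong) auto
    then show "emeasure ?D (space ?D) = 1" using c D[of "space M"] by simp
  qed
  have "distr ?D borel X = distr M borel X"
  proof (rule Levy_uniqueness)
    show "real_distribution (distr ?D borel X)" "real_distribution (distr M borel X)"
      using D.real_distribution_distr[of X] real_distribution_distr[of X] by auto
    show "char (distr ?D borel X) = char (distr M borel X)"
    proof
      fix s
      have "char (distr ?D borel X) s = (CLINT \<omega>|?D. iexp (s * X \<omega>))"
        unfolding char_def by (subst integral_distr) auto
      also have "\<dots> = (CLINT \<omega>|M. (f \<omega> / c) *\<^sub>R iexp (s * X \<omega>))"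
        using nonneg c by (subst integral_density) auto
      also have "\<dots> = (CLINT \<omega>|M. (1 / c) *\<^sub>R (f \<omega> *\<^sub>R iexp (s * X \<omega>)))"
        by simp
      also have "\<dots> = (1 / c) *\<^sub>R (CLINT \<omega>|M. f \<omega> *\<^sub>R iexp (s * X \<omega>))"
        by (rule integral_scaleR_right)
      also have "\<dots> = char (distr M borel X) s"
        unfolding char using c(2) by simp
      finally show "char (distr ?D borel X) s = char (distr M borel X) s" .
    qed
  qed
  then have "emeasure (distr ?D borel X) A = emeasure (distr M borel X) A" by simp
  then have "emeasure ?D (X -` A \<inter> space M) = emeasure M (X -` A \<inter> space M)"
    by (simp add: emeasure_distr)
  then have "ennreal (expectation (\<lambda>\<omega>. f \<omega> * indicator (X -` A \<inter> space M) \<omega>) / c) = ennreal (prob (X -` A \<inter> space M))"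
    by (subst (asm) D) (auto simp: emeasure_eq_measure)
  moreover have "expectation (\<lambda>\<omega>. f \<omega> * indicator (X -` A \<inter> space M) \<omega>) = expectation (\<lambda>\<omega>. f \<omega> * indicator A (X \<omega>))"
    by (intro Bochner_Integration.integral_cong) (auto simp: indicator_def)
  moreover have "0 \<le> expectation (\<lambda>\<omega>. f \<omega> * indicator A (X \<omega>))"
    using nonneg by (intro integral_nonneg_AE) auto
  ultimately show ?thesis using c by (simp add: field_simps)
qed

text \<open>Kac's criterion. Weighting the law with the nonnegative functions \<open>2 + cos (t Y)\<close> and
  \<open>2 + sin (t Y)\<close> reduces it to uniqueness of characteristic functions on the line.\<close>

lemma indep_var_char:
  fixes X Y :: "'a \<Rightarrow> real"
  assumes X[measurable]: "X \<in> borel_measurable M" and Y[measurable]: "Y \<in> borel_measurable M"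
    and char: "\<And>s t. (CLINT \<omega>|M. iexp (s * X \<omega> + t * Y \<omega>)) = char (distr M borel X) s * char (distr M borel Y) t"
  shows "indep_var borel X borel Y"
proof -
  let ?\<phi> = "char (distr M borel X)" and ?\<psi> = "char (distr M borel Y)"
  interpret DY: real_distribution "distr M borel Y" by (rule real_distribution_distr) simp
  have iint: "integrable M (\<lambda>\<omega>. iexp (g \<omega>))" if [measurable]: "g \<in> borel_measurable M" for g :: "'a \<Rightarrow> real"
    by (intro integrable_const_bound[of _ 1]) auto
  have psi: "?\<psi> t = (CLINT \<omega>|M. iexp (t * Y \<omega>))" for t
    unfolding char_def by (subst integral_distr) auto
  have phi: "?\<phi> t = (CLINT \<omega>|M. iexp (t * X \<omega>))" for t
    unfolding char_def by (subst integral_distr) auto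
  have psi_norm: "norm (?\<psi> t) \<le> 1" for t by (rule DY.cmod_char_le_1)
  have cosint: "integrable M (\<lambda>\<omega>. cos (t * Y \<omega>))" "integrable M (\<lambda>\<omega>. sin (t * Y \<omega>))" for t
    by (intro integrable_const_bound[of _ 1], auto)+
  have Epsi: "expectation (\<lambda>\<omega>. cos (t * Y \<omega>)) = Re (?\<psi> t)" "expectation (\<lambda>\<omega>. sin (t * Y \<omega>)) = Im (?\<psi> t)" for t
  proof -
    have "Re (?\<psi> t) = expectation (\<lambda>\<omega>. Re (iexp (t * Y \<omega>)))" "Im (?\<psi> t) = expectation (\<lambda>\<omega>. Im (iexp (t * Y \<omega>)))"
      unfolding psi by (auto intro!: integral_Re[symmetric] integral_Im[symmetric] iint simp del: of_real_mult)
    then show "expectation (\<lambda>\<omega>. cos (t * Y \<omega>)) = Re (?\<psi> t)" "expectation (\<lambda>\<omega>. sin (t * Y \<omega>)) = Im (?\<psi> t)"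
      by (auto simp: Re_exp Im_exp)
  qed
  have cnj: "?\<psi> (-t) = cnj (?\<psi> t)" for t
  proof -
    have "?\<psi> (-t) = (CLINT \<omega>|M. cnj (iexp (t * Y \<omega>)))"
      unfolding psi by (intro Bochner_Integration.integral_cong) (auto simp: exp_cnj)
    also have "\<dots> = cnj (?\<psi> t)"
      unfolding psi by (rule Bochner_Integration.integral_cnj)
    finally show ?thesis .
  qed
  have lin: "(CLINT \<omega>|M. 2 * A \<omega> + (B \<omega> + D \<omega>) / c) = 2 * (CLINT \<omega>|M. A \<omega>) + ((CLINT \<omega>|M. B \<omega>) + (CLINT \<omega>|M. D \<omega>)) / c"
    "(CLINT \<omega>|M. 2 * A \<omega> + (B \<omega> - D \<omega>) / c) = 2 * (CLINT \<omega>|M. A \<omega>) + ((CLINT \<omega>|M. B \<omega>) - (CLINT \<omega>|M. D \<omega>)) / c"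
    if "complex_integrable M A" "complex_integrable M B" "complex_integrable M D" for A B D :: "'a \<Rightarrow> complex" and c
    using that by simp_all
  have wc: "(CLINT \<omega>|M. (2 + cos (t * Y \<omega>)) *\<^sub>R iexp (s * X \<omega>)) = (2 + Re (?\<psi> t)) *\<^sub>R ?\<phi> s" for s t
  proof -
    have "(CLINT \<omega>|M. (2 + cos (t * Y \<omega>)) *\<^sub>R iexp (s * X \<omega>)) =
      (CLINT \<omega>|M. 2 * iexp (s * X \<omega>) + (iexp (s * X \<omega> + t * Y \<omega>) + iexp (s * X \<omega> + (-t) * Y \<omega>)) / 2)"
    proof (intro Bochner_Integration.integral_cong refl)
      fix \<omega>
      show "(2 + cos (t * Y \<omega>)) *\<^sub>R iexp (s * X \<omega>) = 2 * iexp (s * X \<omega>) + (iexp (s * X \<omega> + t * Y \<omega>) + iexp (s * X \<omega> + (-t) * Y \<omega>)) / 2"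
        unfolding mult_minus_left cos_mult_iexp[symmetric]
        by (simp add: scaleR_conv_of_real distrib_right)
    qed
    also have "\<dots> = 2 * ?\<phi> s + (?\<phi> s * ?\<psi> t + ?\<phi> s * ?\<psi> (-t)) / 2"
      by (subst lin, simp_all only: char[symmetric] iint borel_measurable_times borel_measurable_const borel_measurable_add X Y)
        (simp only: phi)
    also have "\<dots> = (2 + (?\<psi> t + cnj (?\<psi> t)) / 2) * ?\<phi> s" by (simp add: cnj field_simps)
    also have "(?\<psi> t + cnj (?\<psi> t)) / 2 = of_real (Re (?\<psi> t))" by (simp add: complex_eq_iff)
    finally show ?thesis by (simp add: scaleR_conv_of_real)
  qed
  have ws: "(CLINT \<omega>|M. (2 + sin (t * Y \<omega>)) *\<^sub>R iexp (s * X \<omega>)) = (2 + Im (?\<psi> t)) *\<^sub>R ?\<phi> s" for s t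
  proof -
    have "(CLINT \<omega>|M. (2 + sin (t * Y \<omega>)) *\<^sub>R iexp (s * X \<omega>)) =
      (CLINT \<omega>|M. 2 * iexp (s * X \<omega>) + (iexp (s * X \<omega> + t * Y \<omega>) - iexp (s * X \<omega> + (-t) * Y \<omega>)) / (2 * \<i>))"
    proof (intro Bochner_Integration.integral_cong refl)
      fix \<omega>
      show "(2 + sin (t * Y \<omega>)) *\<^sub>R iexp (s * X \<omega>) = 2 * iexp (s * X \<omega>) + (iexp (s * X \<omega> + t * Y \<omega>) - iexp (s * X \<omega> + (-t) * Y \<omega>)) / (2 * \<i>)"
        unfolding mult_minus_left sin_mult_iexp[symmetric]
        by (simp add: scaleR_conv_of_real distrib_right)
    qed
    also have "\<dots> = 2 * ?\<phi> s + (?\<phi> s * ?\<psi> t - ?\<phi> s * ?\<psi> (-t)) / (2 * \<i>)"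
      by (subst lin, simp_all only: char[symmetric] iint borel_measurable_times borel_measurable_const borel_measurable_add X Y)
        (simp only: phi)
    also have "\<dots> = (2 + (?\<psi> t - cnj (?\<psi> t)) / (2 * \<i>)) * ?\<phi> s" by (simp add: cnj field_simps)
    also have "(?\<psi> t - cnj (?\<psi> t)) / (2 * \<i>) = of_real (Im (?\<psi> t))" by (simp add: complex_eq_iff Re_divide Im_divide)
    finally show ?thesis by (simp add: scaleR_conv_of_real)
  qed
  \<comment> \<open>The constant 2 makes the weights nonnegative and, as characteristic functions
    are bounded by 1, gives them strictly positive means.\<close>
  have ReIm: "2 + Re (?\<psi> t) > 0" "2 + Im (?\<psi> t) > 0" for t
    using psi_norm[of t] abs_Re_le_cmod[of "?\<psi> t"] abs_Im_le_cmod[of "?\<psi> t"] by linarith+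
  have pos: "0 \<le> 2 + cos x" "0 \<le> 2 + sin x" for x :: real
    using cos_ge_minus_one[of x] sin_ge_minus_one[of x] by linarith+
  \<comment> \<open>The roles are now exchanged: the first round shows that
    \<open>indicator A (X \<omega>)\<close> is uncorrelated with all
    \<open>cos (t * Y \<omega>)\<close> and \<open>sin (t * Y \<omega>)\<close>, so this indicator
    can serve as a weight on the law of \<open>Y\<close>. A null event would have mean 0 and is
    treated apart.\<close>
  have main: "prob (X -` A \<inter> space M \<inter> (Y -` B \<inter> space M)) = prob (X -` A \<inter> space M) * prob (Y -` B \<inter> space M)"
    if A[measurable]: "A \<in> sets borel" and B[measurable]: "B \<in> sets borel" for A B
  proof (cases "prob (X -` A \<inter> space M) = 0")
    case True
    have "prob (X -` A \<inter> space M \<inter> (Y -` B \<inter> space M)) \<le> prob (X -` A \<inter> space M)"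
      by (intro finite_measure_mono) auto
    then show ?thesis using True by (simp add: antisym measure_nonneg)
  next
    case False
    let ?f = "\<lambda>\<omega>. indicator A (X \<omega>) :: real"
    have f_int: "integrable M ?f" by (intro integrable_const_bound[of _ 1]) (auto simp: indicator_def)
    have Ef: "expectation ?f = prob (X -` A \<inter> space M)"
    proof -
      have "expectation ?f = expectation (indicator (X -` A \<inter> space M))"
        by (intro Bochner_Integration.integral_cong) (auto simp: indicator_def)
      then show ?thesis by simp
    qed
    have c: "expectation (\<lambda>\<omega>. cos (t * Y \<omega>) * ?f \<omega>) = Re (?\<psi> t) * expectation ?f" for t
    proof -
      have "expectation (\<lambda>\<omega>. (2 + cos (t * Y \<omega>)) * ?f \<omega>) = (2 + Re (?\<psi> t)) * prob (X -` A \<inter> space M)"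
        by (rule char_weighted_unique) (auto simp: wc Epsi cosint prob_space ReIm pos simp del: of_real_mult)
      moreover have "expectation (\<lambda>\<omega>. (2 + cos (t * Y \<omega>)) * ?f \<omega>) = 2 * expectation ?f + expectation (\<lambda>\<omega>. cos (t * Y \<omega>) * ?f \<omega>)"
        unfolding distrib_right
        by (subst Bochner_Integration.integral_add)
          (auto intro!: f_int integrable_const_bound[of _ 1] simp: indicator_def)
      ultimately show ?thesis by (simp add: Ef algebra_simps)
    qed
    have s: "expectation (\<lambda>\<omega>. sin (t * Y \<omega>) * ?f \<omega>) = Im (?\<psi> t) * expectation ?f" for t
    proof -
      have "expectation (\<lambda>\<omega>. (2 + sin (t * Y \<omega>)) * ?f \<omega>) = (2 + Im (?\<psi> t)) * prob (X -` A \<inter> space M)"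
        by (rule char_weighted_unique) (auto simp: ws Epsi cosint prob_space ReIm pos simp del: of_real_mult)
      moreover have "expectation (\<lambda>\<omega>. (2 + sin (t * Y \<omega>)) * ?f \<omega>) = 2 * expectation ?f + expectation (\<lambda>\<omega>. sin (t * Y \<omega>) * ?f \<omega>)"
        unfolding distrib_right
        by (subst Bochner_Integration.integral_add)
          (auto intro!: f_int integrable_const_bound[of _ 1] simp: indicator_def)
      ultimately show ?thesis by (simp add: Ef algebra_simps)
    qed
    have i1: "integrable M (\<lambda>\<omega>. ?f \<omega> *\<^sub>R iexp (t * Y \<omega>))" for t
      by (intro integrable_const_bound[of _ 1]) (auto simp: indicator_def)
    have w: "(CLINT \<omega>|M. ?f \<omega> *\<^sub>R iexp (t * Y \<omega>)) = expectation ?f *\<^sub>R ?\<psi> t" for t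
    proof (rule complex_eqI)
      have "Re (CLINT \<omega>|M. ?f \<omega> *\<^sub>R iexp (t * Y \<omega>)) = expectation (\<lambda>\<omega>. Re (?f \<omega> *\<^sub>R iexp (t * Y \<omega>)))"
        by (rule integral_Re[symmetric]) (rule i1)
      also have "\<dots> = expectation (\<lambda>\<omega>. cos (t * Y \<omega>) * ?f \<omega>)"
        by (intro Bochner_Integration.integral_cong) (auto simp: Re_exp mult.commute)
      finally show "Re (CLINT \<omega>|M. ?f \<omega> *\<^sub>R iexp (t * Y \<omega>)) = Re (expectation ?f *\<^sub>R ?\<psi> t)"
        by (simp add: c)
      have "Im (CLINT \<omega>|M. ?f \<omega> *\<^sub>R iexp (t * Y \<omega>)) = expectation (\<lambda>\<omega>. Im (?f \<omega> *\<^sub>R iexp (t * Y \<omega>)))"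
        by (rule integral_Im[symmetric]) (rule i1)
      also have "\<dots> = expectation (\<lambda>\<omega>. sin (t * Y \<omega>) * ?f \<omega>)"
        by (intro Bochner_Integration.integral_cong) (auto simp: Im_exp mult.commute)
      finally show "Im (CLINT \<omega>|M. ?f \<omega> *\<^sub>R iexp (t * Y \<omega>)) = Im (expectation ?f *\<^sub>R ?\<psi> t)"
        by (simp add: s)
    qed
    have "expectation (\<lambda>\<omega>. ?f \<omega> * indicator B (Y \<omega>)) = expectation ?f * prob (Y -` B \<inter> space M)"
      using False by (intro char_weighted_unique) (auto simp: w f_int Ef measure_nonneg less_le simp del: of_real_mult)
    moreover have "expectation (\<lambda>\<omega>. ?f \<omega> * indicator B (Y \<omega>)) = expectation (indicator (X -` A \<inter> space M \<inter> (Y -` B \<inter> space M)))"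
      by (intro Bochner_Integration.integral_cong) (auto simp: indicator_def)
    ultimately show ?thesis by (simp add: Ef)
  qed
  have "distr M borel X \<Otimes>\<^sub>M distr M borel Y = distr M (borel \<Otimes>\<^sub>M borel) (\<lambda>x. (X x, Y x))"
  proof (rule pair_measure_eqI)
    interpret PX: prob_space "distr M borel X" by (rule prob_space_distr) simp
    interpret PY: prob_space "distr M borel Y" by (rule prob_space_distr) simp
    show "sigma_finite_measure (distr M borel X)" "sigma_finite_measure (distr M borel Y)" ..
    show "sets (distr M borel X \<Otimes>\<^sub>M distr M borel Y) = sets (distr M (borel \<Otimes>\<^sub>M borel) (\<lambda>x. (X x, Y x)))"
      by (simp cong: sets_pair_measure_cong)
    fix A B assume "A \<in> sets (distr M borel X)" "B \<in> sets (distr M borel Y)"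
    then have A[measurable]: "A \<in> sets borel" and B[measurable]: "B \<in> sets borel" by auto
    have "(\<lambda>x. (X x, Y x)) -` (A \<times> B) \<inter> space M = X -` A \<inter> space M \<inter> (Y -` B \<inter> space M)" by auto
    then show "emeasure (distr M borel X) A * emeasure (distr M borel Y) B = emeasure (distr M (borel \<Otimes>\<^sub>M borel) (\<lambda>x. (X x, Y x))) (A \<times> B)"
      by (simp add: emeasure_distr emeasure_eq_measure main[OF A B] ennreal_mult)
  qed
  then show ?thesis by (subst indep_var_distribution_eq) auto
qed

end

text \<open>Stated as an image of the standard normal law so that \<open>v = 0\<close>, a point
  mass, is included: empty sums have variance 0, and residual variances may vanish.\<close>

definition gaussian :: "'a measure \<Rightarrow> ('a \<Rightarrow> real) \<Rightarrow> real \<Rightarrow> bool" where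
  "gaussian M X v \<longleftrightarrow> X \<in> borel_measurable M \<and> 0 \<le> v \<and>
     distr M borel X = distr std_normal_distribution borel (\<lambda>x. sqrt v * x)"

lemma gaussian_measurable: "gaussian M X v \<Longrightarrow> X \<in> borel_measurable M"
  and gaussian_nonneg: "gaussian M X v \<Longrightarrow> 0 \<le> v"
  by (auto simp: gaussian_def)

lemma char_scaled_std_normal:
  "char (distr std_normal_distribution borel (\<lambda>x. c * x)) t = exp (- (c\<^sup>2 * t\<^sup>2) / 2)"
proof -
  have "char (distr std_normal_distribution borel (\<lambda>x. c * x)) t = char std_normal_distribution (t * c)"
    unfolding char_def by (subst integral_distr) (auto simp: mult.assoc)
  then show ?thesis by (simp add: char_std_normal_distribution power_mult_distrib mult.commute)
qed

lemma std_normal_second_moment: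
  "integrable std_normal_distribution (\<lambda>x. x\<^sup>2)" "(LINT x|std_normal_distribution. x\<^sup>2) = 1"
  using std_normal_distribution_even_moments[of 1] integrable_std_normal_distribution_moment[of 2] by auto

lemma std_normal_first_moment:
  "integrable std_normal_distribution (\<lambda>x. x)" "(LINT x|std_normal_distribution. x) = 0"
  using integral_std_normal_distribution_moment_odd[of 1] integrable_std_normal_distribution_moment[of 1] by auto

context prob_space
begin

lemma gaussianI:
  assumes X[measurable]: "X \<in> borel_measurable M" and v: "0 \<le> v"
    and char: "\<And>t. char (distr M borel X) t = exp (- (v * t\<^sup>2) / 2)"
  shows "gaussian M X v"
proof -
  interpret N: real_distribution std_normal_distribution by (rule real_dist_normal_dist)
  have "distr M borel X = distr std_normal_distribution borel (\<lambda>x. sqrt v * x)"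
    using v by (intro Levy_uniqueness real_distribution_distr N.real_distribution_distr)
      (auto simp: fun_eq_iff char char_scaled_std_normal)
  then show ?thesis using v by (simp add: gaussian_def)
qed

context
  fixes X v assumes g: "gaussian M X v"
begin

lemma gaussian_char: "char (distr M borel X) t = exp (- (v * t\<^sup>2) / 2)"
  using g by (simp add: gaussian_def char_scaled_std_normal)

lemma gaussian_char': "(CLINT \<omega>|M. iexp (t * X \<omega>)) = exp (- (v * t\<^sup>2) / 2)"
  unfolding gaussian_char[symmetric] char_def
  using gaussian_measurable[OF g] by (subst integral_distr) auto

lemma gaussian_integrable_iff:
  fixes f :: "real \<Rightarrow> real"
  assumes [measurable]: "f \<in> borel_measurable borel"
  shows "integrable M (\<lambda>\<omega>. f (X \<omega>)) \<longleftrightarrow> integrable std_normal_distribution (\<lambda>x. f (sqrt v * x))"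
proof -
  have [measurable]: "X \<in> borel_measurable M" using g by (rule gaussian_measurable)
  have "integrable M (\<lambda>\<omega>. f (X \<omega>)) \<longleftrightarrow> integrable (distr M borel X) f"
    by (subst integrable_distr_eq) auto
  also have "\<dots> \<longleftrightarrow> integrable std_normal_distribution (\<lambda>x. f (sqrt v * x))"
    using g unfolding gaussian_def by (subst integrable_distr_eq[symmetric]) auto
  finally show ?thesis .
qed

lemma gaussian_expectation:
  fixes f :: "real \<Rightarrow> real"
  assumes [measurable]: "f \<in> borel_measurable borel"
  shows "expectation (\<lambda>\<omega>. f (X \<omega>)) = (LINT x|std_normal_distribution. f (sqrt v * x))"
proof -
  have [measurable]: "X \<in> borel_measurable M" using g by (rule gaussian_measurable)
  have "expectation (\<lambda>\<omega>. f (X \<omega>)) = integral\<^sup>L (distr M borel X) f"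
    by (subst integral_distr) auto
  also have "\<dots> = (LINT x|std_normal_distribution. f (sqrt v * x))"
    using g unfolding gaussian_def by (subst integral_distr[symmetric]) auto
  finally show ?thesis .
qed

lemma gaussian_second_moment: "integrable M (\<lambda>\<omega>. (X \<omega>)\<^sup>2)" "expectation (\<lambda>\<omega>. (X \<omega>)\<^sup>2) = v"
  using gaussian_integrable_iff[of "\<lambda>x. x\<^sup>2"] gaussian_expectation[of "\<lambda>x. x\<^sup>2"] gaussian_nonneg[OF g]
  by (auto simp: power_mult_distrib std_normal_second_moment)

lemma gaussian_prob_le:
  assumes v: "v > 0"
  shows "prob {\<omega>\<in>space M. X \<omega> \<le> c} = cdf std_normal_distribution (c / sqrt v)"
proof -
  have [measurable]: "X \<in> borel_measurable M" using g by (rule gaussian_measurable)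
  have "prob {\<omega>\<in>space M. X \<omega> \<le> c} = measure (distr M borel X) {..c}"
    by (subst measure_distr) (auto intro!: arg_cong[where f=prob])
  also have "\<dots> = measure std_normal_distribution {x. sqrt v * x \<le> c}"
    using g unfolding gaussian_def by (simp add: measure_distr vimage_def)
  also have "{x. sqrt v * x \<le> c} = {..c / sqrt v}" using v by (auto simp: field_simps)
  finally show ?thesis by (simp add: cdf_def)
qed

end

lemma gaussian_cmult:
  assumes "gaussian M X v" shows "gaussian M (\<lambda>\<omega>. c * X \<omega>) (c\<^sup>2 * v)"
proof -
  have [measurable]: "X \<in> borel_measurable M" using assms by (rule gaussian_measurable)
  show ?thesis
  proof (rule gaussianI)
    fix t
    have "char (distr M borel (\<lambda>\<omega>. c * X \<omega>)) t = (CLINT \<omega>|M. iexp ((c * t) * X \<omega>))"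
      unfolding char_def by (subst integral_distr) (auto simp: mult_ac)
    then show "char (distr M borel (\<lambda>\<omega>. c * X \<omega>)) t = exp (- (c\<^sup>2 * v * t\<^sup>2) / 2)"
      by (simp only: gaussian_char'[OF assms]) (simp add: power_mult_distrib mult_ac)
  qed (use gaussian_nonneg[OF assms] in auto)
qed

text \<open>The absence of a cross term in \<open>s\<close> and \<open>t\<close> makes the joint
  characteristic function factorise.\<close>

lemma gaussian_indep_var:
  assumes lin: "\<And>s t. gaussian M (\<lambda>\<omega>. s * X \<omega> + t * Y \<omega>) (s\<^sup>2 * v + t\<^sup>2 * w)"
  shows "indep_var borel X borel Y"
proof (rule indep_var_char)
  have X: "gaussian M X v" using lin[of 1 0] by simp
  have Y: "gaussian M Y w" using lin[of 0 1] by simp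
  show "X \<in> borel_measurable M" "Y \<in> borel_measurable M" using X Y by (auto dest: gaussian_measurable)
  fix s t
  have "(CLINT \<omega>|M. iexp (s * X \<omega> + t * Y \<omega>)) = (CLINT \<omega>|M. iexp (1 * (s * X \<omega> + t * Y \<omega>)))" by simp
  also have "\<dots> = exp (- ((s\<^sup>2 * v + t\<^sup>2 * w) * 1\<^sup>2) / 2)" by (rule gaussian_char'[OF lin])
  also have "\<dots> = char (distr M borel X) s * char (distr M borel Y) t"
    unfolding gaussian_char[OF X] gaussian_char[OF Y] of_real_mult[symmetric] exp_add[symmetric]
    by (simp add: field_simps)
  finally show "(CLINT \<omega>|M. iexp (s * X \<omega> + t * Y \<omega>)) = char (distr M borel X) s * char (distr M borel Y) t" .
qed

end

text \<open>Mehler's kernel: the density of a bivariate standard normal law with correlation \<open>\<rho>\<close> with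
  respect to the product of its marginals.\<close>

definition mehler :: "real \<Rightarrow> real \<Rightarrow> real \<Rightarrow> real" where
  "mehler \<rho> x y = exp (- (\<rho>\<^sup>2 * x\<^sup>2 - 2 * \<rho> * x * y + \<rho>\<^sup>2 * y\<^sup>2) / (2 * (1 - \<rho>\<^sup>2))) / sqrt (1 - \<rho>\<^sup>2)"

lemma mehler_pos: "\<rho>\<^sup>2 < 1 \<Longrightarrow> mehler \<rho> x y > 0"
  by (simp add: mehler_def)

lemma borel_measurable_mehler[measurable]:
  assumes [measurable]: "f \<in> borel_measurable M" "g \<in> borel_measurable M"
  shows "(\<lambda>x. mehler \<rho> (f x) (g x)) \<in> borel_measurable M"
  unfolding mehler_def by measurable

text \<open>Completing the square in \<open>y\<close>: given the first coordinate \<open>x\<close>,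
  the second one is normal with mean \<open>\<rho> * x\<close> and variance
  \<open>1 - \<rho>^2\<close>.\<close>

lemma mehler_std_normal_density:
  assumes "\<rho>\<^sup>2 < 1"
  shows "mehler \<rho> x y * std_normal_density y = normal_density (\<rho> * x) (sqrt (1 - \<rho>\<^sup>2)) y"
proof -
  have d: "1 - \<rho>\<^sup>2 > 0" using assms by simp
  have "- (\<rho>\<^sup>2 * x\<^sup>2 - 2 * \<rho> * x * y + \<rho>\<^sup>2 * y\<^sup>2) / (2 * (1 - \<rho>\<^sup>2)) + - y\<^sup>2 / 2
      = - (y - \<rho> * x)\<^sup>2 / (2 * (1 - \<rho>\<^sup>2))"
    using d by (simp add: divide_simps) (simp add: power2_eq_square algebra_simps)
  then have "exp (- (y - \<rho> * x)\<^sup>2 / (2 * (1 - \<rho>\<^sup>2))) = exp (- (\<rho>\<^sup>2 * x\<^sup>2 - 2 * \<rho> * x * y + \<rho>\<^sup>2 * y\<^sup>2) / (2 * (1 - \<rho>\<^sup>2))) * exp (- y\<^sup>2 / 2)"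
    by (simp only: exp_add[symmetric])
  then show ?thesis using d
    by (simp add: normal_density_def mehler_def real_sqrt_mult)
qed

text \<open>Two completions of squares, in \<open>y\<close> and then in \<open>x\<close>, leave two
  probability densities and the factor \<open>1 / (1 - \<rho>^2)\<close>, which is therefore the
  squared norm of the kernel.\<close>

lemma mehler_square_density:
  assumes "\<rho>\<^sup>2 < 1"
  shows "(mehler \<rho> x y)\<^sup>2 * std_normal_density y * std_normal_density x =
    1 / (1 - \<rho>\<^sup>2) * (normal_density (2 * \<rho> * x / (1 + \<rho>\<^sup>2)) (sqrt ((1 - \<rho>\<^sup>2) / (1 + \<rho>\<^sup>2))) y
      * normal_density 0 (sqrt ((1 + \<rho>\<^sup>2) / (1 - \<rho>\<^sup>2))) x)"
proof -
  define d where "d = 1 - \<rho>\<^sup>2"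
  define e where "e = 1 + \<rho>\<^sup>2"
  have d: "d > 0" using assms by (simp add: d_def)
  have e: "e > 0" unfolding e_def by (intro add_pos_nonneg) auto
  have "2 * (- (\<rho>\<^sup>2 * x\<^sup>2 - 2 * \<rho> * x * y + \<rho>\<^sup>2 * y\<^sup>2) / (2 * d)) + - y\<^sup>2 / 2 + - x\<^sup>2 / 2
     = - (y - 2 * \<rho> * x / e)\<^sup>2 / (2 * (d / e)) + - x\<^sup>2 / (2 * (e / d))"
  proof -
    have "2 * d * e * (2 * (- (\<rho>\<^sup>2 * x\<^sup>2 - 2 * \<rho> * x * y + \<rho>\<^sup>2 * y\<^sup>2) / (2 * d)) + - y\<^sup>2 / 2 + - x\<^sup>2 / 2)
      = - 2 * e * (\<rho>\<^sup>2 * x\<^sup>2 - 2 * \<rho> * x * y + \<rho>\<^sup>2 * y\<^sup>2) - d * e * y\<^sup>2 - d * e * x\<^sup>2"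
      using d by (simp add: field_simps)
    also have "\<dots> = - (e * y - 2 * \<rho> * x)\<^sup>2 - d\<^sup>2 * x\<^sup>2"
      unfolding d_def e_def by (simp add: power2_eq_square algebra_simps)
    also have "\<dots> = 2 * d * e * (- (y - 2 * \<rho> * x / e)\<^sup>2 / (2 * (d / e)) + - x\<^sup>2 / (2 * (e / d)))"
    proof -
      have "(y - 2 * \<rho> * x / e) = (e * y - 2 * \<rho> * x) / e" using e by (simp add: field_simps)
      then have "(y - 2 * \<rho> * x / e)\<^sup>2 = (e * y - 2 * \<rho> * x)\<^sup>2 / e\<^sup>2" by (simp add: power_divide)
      then show ?thesis using d e by (simp add: field_simps power2_eq_square)
    qed
    finally show ?thesis using d e by simp
  qed
  then have "(exp (- (\<rho>\<^sup>2 * x\<^sup>2 - 2 * \<rho> * x * y + \<rho>\<^sup>2 * y\<^sup>2) / (2 * d)))\<^sup>2 * exp (- y\<^sup>2 / 2) * exp (- x\<^sup>2 / 2)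
     = exp (- (y - 2 * \<rho> * x / e)\<^sup>2 / (2 * (d / e))) * exp (- x\<^sup>2 / (2 * (e / d)))"
    by (simp only: exp_add[symmetric] exp_double[symmetric])
  moreover have "(sqrt d)\<^sup>2 = d" "(sqrt (2 * pi))\<^sup>2 = 2 * pi" using d by auto
  moreover have "sqrt (2 * pi * (d / e)) * sqrt (2 * pi * (e / d)) = 2 * pi"
  proof -
    have "sqrt (2 * pi * (d / e)) * sqrt (2 * pi * (e / d)) = sqrt ((2 * pi)\<^sup>2)"
      using d e unfolding real_sqrt_mult[symmetric] by (simp add: power2_eq_square)
    then show ?thesis by (simp only: real_sqrt_abs) simp
  qed
  ultimately show ?thesis
    using d e unfolding normal_density_def mehler_def d_def[symmetric] e_def[symmetric]
    by (simp add: power_divide power2_eq_square[of "sqrt (2 * pi)"] field_simps del: real_sqrt_mult)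
qed

lemma nn_integral_mehler:
  assumes \<rho>: "\<rho>\<^sup>2 < 1" and [measurable]: "f \<in> borel_measurable borel"
  shows "(\<integral>\<^sup>+w. f (\<rho> * x + sqrt (1 - \<rho>\<^sup>2) * w) \<partial>std_normal_distribution)
    = (\<integral>\<^sup>+y. ennreal (mehler \<rho> x y) * f y \<partial>std_normal_distribution)"
proof -
  define s where "s = sqrt (1 - \<rho>\<^sup>2)"
  have s: "s > 0" using \<rho> by (simp add: s_def)
  have "(\<integral>\<^sup>+y. ennreal (mehler \<rho> x y) * f y \<partial>std_normal_distribution)
      = (\<integral>\<^sup>+y. ennreal (normal_density (\<rho> * x) s y) * f y \<partial>lborel)"
    unfolding s_def mehler_std_normal_density[OF \<rho>, symmetric]
    using mehler_pos[OF \<rho>]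
    by (subst nn_integral_density) (auto simp: ennreal_mult less_imp_le mult_ac intro!: nn_integral_cong)
  also have "\<dots> = ennreal \<bar>s\<bar> * (\<integral>\<^sup>+w. ennreal (normal_density (\<rho> * x) s (\<rho> * x + s * w)) * f (\<rho> * x + s * w) \<partial>lborel)"
    using s by (subst nn_integral_real_affine[of _ s "\<rho> * x"]) auto
  also have "\<dots> = (\<integral>\<^sup>+w. ennreal \<bar>s\<bar> * (ennreal (normal_density (\<rho> * x) s (\<rho> * x + s * w)) * f (\<rho> * x + s * w)) \<partial>lborel)"
    by (rule nn_integral_cmult[symmetric]) measurable
  also have "\<dots> = (\<integral>\<^sup>+w. ennreal (std_normal_density w) * f (\<rho> * x + s * w) \<partial>lborel)"
  proof (intro nn_integral_cong)
    fix w
    have "s * normal_density (\<rho> * x) s (\<rho> * x + s * w) = std_normal_density w"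
      using s by (simp add: normal_density_def real_sqrt_mult power_mult_distrib)
    then have "ennreal \<bar>s\<bar> * ennreal (normal_density (\<rho> * x) s (\<rho> * x + s * w)) = ennreal (std_normal_density w)"
      using s by (simp add: ennreal_mult[symmetric])
    then show "ennreal \<bar>s\<bar> * (ennreal (normal_density (\<rho> * x) s (\<rho> * x + s * w)) * f (\<rho> * x + s * w)) = ennreal (std_normal_density w) * f (\<rho> * x + s * w)"
      by (simp add: mult.assoc[symmetric])
  qed
  also have "\<dots> = (\<integral>\<^sup>+w. f (\<rho> * x + s * w) \<partial>std_normal_distribution)"
    by (subst nn_integral_density) auto
  finally show ?thesis by (simp add: s_def)
qed

text \<open>In terms of the Hermite expansion the value is the sum of all
  \<open>\<rho> ^ (2 * k)\<close>; removing \<open>k = 0\<close> and \<open>k = 1\<close> leaves a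
  quantity of order \<open>\<rho> ^ 4\<close>.\<close>

lemma nn_integral_mehler_square:
  assumes \<rho>: "\<rho>\<^sup>2 < 1"
  shows "(\<integral>\<^sup>+x. \<integral>\<^sup>+y. ennreal ((mehler \<rho> x y)\<^sup>2) \<partial>std_normal_distribution \<partial>std_normal_distribution) = ennreal (1 / (1 - \<rho>\<^sup>2))"
proof -
  let ?n1 = "\<lambda>x. normal_density (2 * \<rho> * x / (1 + \<rho>\<^sup>2)) (sqrt ((1 - \<rho>\<^sup>2) / (1 + \<rho>\<^sup>2)))"
  let ?n2 = "normal_density 0 (sqrt ((1 + \<rho>\<^sup>2) / (1 - \<rho>\<^sup>2)))"
  have d: "1 - \<rho>\<^sup>2 > 0" "1 + \<rho>\<^sup>2 > 0" using \<rho> by (auto intro: add_pos_nonneg)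
  have one: "(\<integral>\<^sup>+x. ennreal (normal_density m s x) \<partial>lborel) = 1" if "s > 0" for m s
    using that by (subst nn_integral_eq_integral) auto
  have "(\<integral>\<^sup>+x. \<integral>\<^sup>+y. ennreal ((mehler \<rho> x y)\<^sup>2) \<partial>std_normal_distribution \<partial>std_normal_distribution)
     = (\<integral>\<^sup>+x. ennreal (std_normal_density x) * (\<integral>\<^sup>+y. ennreal (std_normal_density y) * ennreal ((mehler \<rho> x y)\<^sup>2) \<partial>lborel) \<partial>lborel)"
    by (subst nn_integral_density) (auto simp: nn_integral_density intro!: lborel.borel_measurable_nn_integral)
  also have "\<dots> = (\<integral>\<^sup>+x. (\<integral>\<^sup>+y. ennreal (1 / (1 - \<rho>\<^sup>2)) * (ennreal (?n2 x) * ennreal (?n1 x y)) \<partial>lborel) \<partial>lborel)"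
  proof (intro nn_integral_cong)
    fix x
    have "ennreal (std_normal_density x) * (\<integral>\<^sup>+y. ennreal (std_normal_density y) * ennreal ((mehler \<rho> x y)\<^sup>2) \<partial>lborel)
      = (\<integral>\<^sup>+y. ennreal (std_normal_density x) * (ennreal (std_normal_density y) * ennreal ((mehler \<rho> x y)\<^sup>2)) \<partial>lborel)"
      by (rule nn_integral_cmult[symmetric]) measurable
    also have "\<dots> = (\<integral>\<^sup>+y. ennreal (1 / (1 - \<rho>\<^sup>2)) * (ennreal (?n2 x) * ennreal (?n1 x y)) \<partial>lborel)"
      using mehler_square_density[OF \<rho>, of x] d
      by (intro nn_integral_cong) (simp add: ennreal_mult[symmetric] mult_ac)
    finally show "ennreal (std_normal_density x) * (\<integral>\<^sup>+y. ennreal (std_normal_density y) * ennreal ((mehler \<rho> x y)\<^sup>2) \<partial>lborel)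
       = (\<integral>\<^sup>+y. ennreal (1 / (1 - \<rho>\<^sup>2)) * (ennreal (?n2 x) * ennreal (?n1 x y)) \<partial>lborel)" .
  qed
  also have "\<dots> = (\<integral>\<^sup>+x. ennreal (1 / (1 - \<rho>\<^sup>2)) * ennreal (?n2 x) \<partial>lborel)"
    using d by (simp add: nn_integral_cmult one)
  also have "\<dots> = ennreal (1 / (1 - \<rho>\<^sup>2))"
    using d by (simp add: nn_integral_cmult one)
  finally show ?thesis .
qed

lemma weighted_young: "\<bar>a * b\<bar> \<le> (l * a\<^sup>2 + b\<^sup>2 / l) / 2" if "l > 0" for a b l :: real
proof -
  have "0 \<le> (l * \<bar>a\<bar> - \<bar>b\<bar>)\<^sup>2 / l" using that by simp
  also have "\<dots> = l * a\<^sup>2 + b\<^sup>2 / l - 2 * \<bar>a * b\<bar>"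
    using that by (simp add: power2_diff power_mult_distrib field_simps power2_eq_square abs_mult)
  finally show ?thesis by simp
qed

context prob_space
begin

text \<open>By Fubini it is enough to substitute
  \<open>y = \<rho> * x + sqrt (1 - \<rho>^2) * w\<close> for each fixed \<open>x\<close>. The law
  of a correlated pair becomes a reweighting of that of an independent pair.\<close>

lemma gaussian_joint_law_mehler:
  assumes indep: "indep_var borel U borel W" and U: "gaussian M U 1" and W: "gaussian M W 1"
    and \<rho>: "\<rho>\<^sup>2 < 1"
  shows "distr M (borel \<Otimes>\<^sub>M borel) (\<lambda>\<omega>. (U \<omega>, W \<omega>)) = std_normal_distribution \<Otimes>\<^sub>M std_normal_distribution"
    and "distr M (borel \<Otimes>\<^sub>M borel) (\<lambda>\<omega>. (U \<omega>, \<rho> * U \<omega> + sqrt (1 - \<rho>\<^sup>2) * W \<omega>)) =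
      density (distr M (borel \<Otimes>\<^sub>M borel) (\<lambda>\<omega>. (U \<omega>, W \<omega>))) (\<lambda>(x, y). ennreal (mehler \<rho> x y))" (is "?L = ?R")
proof -
  let ?N = std_normal_distribution
  interpret N: real_distribution ?N by (rule real_dist_normal_dist)
  interpret NN: pair_prob_space ?N ?N ..
  have [measurable]: "U \<in> borel_measurable M" "W \<in> borel_measurable M"
    using U W by (auto dest: gaussian_measurable)
  have id: "distr ?N borel (\<lambda>x. x) = ?N" by (rule distr_id2) simp
  have id': "(*) (1::real) = (\<lambda>x. x)" by auto
  have P: "distr M (borel \<Otimes>\<^sub>M borel) (\<lambda>\<omega>. (U \<omega>, W \<omega>)) = ?N \<Otimes>\<^sub>M ?N"
    using indep U W unfolding indep_var_distribution_eq gaussian_def by (simp add: id id')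
  then show "distr M (borel \<Otimes>\<^sub>M borel) (\<lambda>\<omega>. (U \<omega>, W \<omega>)) = ?N \<Otimes>\<^sub>M ?N" .
  show "?L = ?R"
  proof (rule measure_eqI)
    fix A assume "A \<in> sets ?L"
    then have A[measurable]: "A \<in> sets (borel \<Otimes>\<^sub>M borel)" by simp
    have A'[measurable]: "A \<in> sets (?N \<Otimes>\<^sub>M ?N)" using A by (simp cong: sets_pair_measure_cong)
    have "emeasure ?L A = (\<integral>\<^sup>+\<omega>. indicator A (U \<omega>, \<rho> * U \<omega> + sqrt (1 - \<rho>\<^sup>2) * W \<omega>) \<partial>M)"
    proof -
      have "emeasure ?L A = (\<integral>\<^sup>+p. indicator A p \<partial>?L)" by simp
      also have "\<dots> = (\<integral>\<^sup>+\<omega>. indicator A (U \<omega>, \<rho> * U \<omega> + sqrt (1 - \<rho>\<^sup>2) * W \<omega>) \<partial>M)"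
        by (subst nn_integral_distr) auto
      finally show ?thesis .
    qed
    also have "\<dots> = (\<integral>\<^sup>+p. indicator A (fst p, \<rho> * fst p + sqrt (1 - \<rho>\<^sup>2) * snd p) \<partial>distr M (borel \<Otimes>\<^sub>M borel) (\<lambda>\<omega>. (U \<omega>, W \<omega>)))"
      by (subst nn_integral_distr) auto
    also have "\<dots> = (\<integral>\<^sup>+x. \<integral>\<^sup>+w. indicator A (x, \<rho> * x + sqrt (1 - \<rho>\<^sup>2) * w) \<partial>?N \<partial>?N)"
      unfolding P by (subst N.nn_integral_fst[symmetric]) auto
    also have "\<dots> = (\<integral>\<^sup>+x. \<integral>\<^sup>+y. ennreal (mehler \<rho> x y) * indicator A (x, y) \<partial>?N \<partial>?N)"
      by (intro nn_integral_cong nn_integral_mehler[OF \<rho>]) measurable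
    also have "\<dots> = (\<integral>\<^sup>+p. (case p of (x, y) \<Rightarrow> ennreal (mehler \<rho> x y)) * indicator A p \<partial>(?N \<Otimes>\<^sub>M ?N))"
      by (subst N.nn_integral_fst[symmetric]) (auto simp: split_beta')
    also have "\<dots> = emeasure ?R A"
      unfolding P by (subst emeasure_density) (auto simp: split_beta')
    finally show "emeasure ?L A = emeasure ?R A" .
  qed simp
qed

end

lemma integrable_mult_of_squares:
  fixes f g :: "'a \<Rightarrow> real"
  assumes [measurable]: "f \<in> borel_measurable M" "g \<in> borel_measurable M"
    and "integrable M (\<lambda>x. (f x)\<^sup>2)" "integrable M (\<lambda>x. (g x)\<^sup>2)"
  shows "integrable M (\<lambda>x. f x * g x)"
proof (rule Bochner_Integration.integrable_bound)
  show "integrable M (\<lambda>x. (1 * (f x)\<^sup>2 + (g x)\<^sup>2 / 1) / 2)" using assms by simp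
  show "AE x in M. norm (f x * g x) \<le> norm ((1 * (f x)\<^sup>2 + (g x)\<^sup>2 / 1) / 2)"
  proof (rule AE_I2)
    fix x show "norm (f x * g x) \<le> norm ((1 * (f x)\<^sup>2 + (g x)\<^sup>2 / 1) / 2)"
      using weighted_young[of 1 "f x" "g x"] by simp
  qed
qed simp

context prob_space
begin

text \<open>As \<open>h\<close> is orthogonal to \<open>1\<close> and \<open>x\<close>, only the part \<open>K - 1 - \<rho> x y\<close> of Mehler's kernel
  contributes, and its squared norm is \<open>\<rho>^4 / (1 - \<rho>^2)\<close>. This replaces the Hermite expansion.\<close>

lemma gaussian_pair_covariance_bound:
  assumes law: "\<And>s t. gaussian M (\<lambda>\<omega>. s * U \<omega> + t * V \<omega>) (s\<^sup>2 + t\<^sup>2 + 2 * s * t * \<rho>)"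
    and h[measurable]: "h \<in> borel_measurable borel"
    and h2: "integrable std_normal_distribution (\<lambda>x. (h x)\<^sup>2)"
    and Eh: "(LINT x|std_normal_distribution. h x) = 0"
    and Exh: "(LINT x|std_normal_distribution. x * h x) = 0"
    and A: "A = (LINT x|std_normal_distribution. (h x)\<^sup>2)"
  shows "\<bar>expectation (\<lambda>\<omega>. h (U \<omega>) * h (V \<omega>))\<bar> \<le> (A\<^sup>2 + 2 * A + 1) * \<rho>\<^sup>2"
proof -
  let ?N = std_normal_distribution
  interpret N: real_distribution ?N by (rule real_dist_normal_dist)
  interpret NN: pair_prob_space ?N ?N ..
  have U: "gaussian M U 1" using law[of 1 0] by simp
  have V: "gaussian M V 1" using law[of 0 1] by simp
  have [measurable]: "U \<in> borel_measurable M" "V \<in> borel_measurable M"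
    using U V by (auto dest: gaussian_measurable)
  have A0: "A \<ge> 0" unfolding A by simp
  have hint: "integrable ?N h"
    using integrable_mult_of_squares[of h ?N "\<lambda>_. 1"] h2 by simp
  have xh_int: "integrable ?N (\<lambda>x. x * h x)"
    by (rule integrable_mult_of_squares) (use h2 std_normal_second_moment in auto)
  have sq: "integrable M (\<lambda>\<omega>. (h (X \<omega>))\<^sup>2)" "expectation (\<lambda>\<omega>. (h (X \<omega>))\<^sup>2) = A"
      "integrable M (\<lambda>\<omega>. h (X \<omega>))" "expectation (\<lambda>\<omega>. h (X \<omega>)) = 0"
      "integrable M (\<lambda>\<omega>. X \<omega> * h (X \<omega>))" "expectation (\<lambda>\<omega>. X \<omega> * h (X \<omega>)) = 0"
      "integrable M X" "expectation X = 0"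
    if X: "gaussian M X 1" for X
  proof -
    have I: "integrable M (\<lambda>\<omega>. f (X \<omega>)) \<longleftrightarrow> integrable ?N f"
      and E: "expectation (\<lambda>\<omega>. f (X \<omega>)) = (LINT x|?N. f x)"
      if "f \<in> borel_measurable borel" for f :: "real \<Rightarrow> real"
      using gaussian_integrable_iff[OF X that] gaussian_expectation[OF X that] by simp_all
    show "integrable M (\<lambda>\<omega>. (h (X \<omega>))\<^sup>2)" "expectation (\<lambda>\<omega>. (h (X \<omega>))\<^sup>2) = A"
      using I[of "\<lambda>x. (h x)\<^sup>2"] E[of "\<lambda>x. (h x)\<^sup>2"] h2 A by auto
    show "integrable M (\<lambda>\<omega>. h (X \<omega>))" "expectation (\<lambda>\<omega>. h (X \<omega>)) = 0"
      using I[of h] E[of h] hint Eh by auto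
    show "integrable M (\<lambda>\<omega>. X \<omega> * h (X \<omega>))" "expectation (\<lambda>\<omega>. X \<omega> * h (X \<omega>)) = 0"
      using I[of "\<lambda>x. x * h x"] E[of "\<lambda>x. x * h x"] xh_int Exh by auto
    show "integrable M X" "expectation X = 0"
      using I[OF measurable_ident] E[OF measurable_ident] std_normal_first_moment
      unfolding id_def by (simp_all only:)
  qed
  have hUV: "integrable M (\<lambda>\<omega>. h (U \<omega>) * h (V \<omega>))"
    by (rule integrable_mult_of_squares) (auto simp: sq U V)
  show ?thesis
  proof (cases "\<rho>\<^sup>2 \<le> 1/2")
    \<comment> \<open>For correlations away from 0 the crude bound \<open>A\<close> is enough, and
      it covers \<open>\<rho>^2 = 1\<close>, where there is no kernel.\<close>
    case False
    have "\<bar>expectation (\<lambda>\<omega>. h (U \<omega>) * h (V \<omega>))\<bar> \<le> expectation (\<lambda>\<omega>. \<bar>h (U \<omega>) * h (V \<omega>)\<bar>)"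
      by (rule integral_abs_bound)
    also have "\<dots> \<le> expectation (\<lambda>\<omega>. (1 * (h (U \<omega>))\<^sup>2 + (h (V \<omega>))\<^sup>2 / 1) / 2)"
      using weighted_young[of 1] hUV sq[OF U] sq[OF V] by (intro integral_mono) auto
    also have "\<dots> = A" using sq[OF U] sq[OF V] by simp
    also have "\<dots> \<le> 2 * A * \<rho>\<^sup>2" using False A0 mult_left_mono[of "1/2" "\<rho>\<^sup>2" "2 * A"] by simp
    also have "\<dots> \<le> (A\<^sup>2 + 2 * A + 1) * \<rho>\<^sup>2" by (intro mult_right_mono) auto
    finally show ?thesis .
  next
    case True
    then have \<rho>: "\<rho>\<^sup>2 < 1" by simp
    define s where "s = sqrt (1 - \<rho>\<^sup>2)"
    have s: "s > 0" "s\<^sup>2 = 1 - \<rho>\<^sup>2" using \<rho> by (auto simp: s_def)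
    \<comment> \<open>The normalised residual of \<open>V\<close> after regression on
      \<open>U\<close>; it is independent of \<open>U\<close> and standard normal.\<close>
    define W where "W \<omega> = (V \<omega> - \<rho> * U \<omega>) / s" for \<omega>
    have [measurable]: "W \<in> borel_measurable M" unfolding W_def by measurable
    have UWlaw: "gaussian M (\<lambda>\<omega>. a * U \<omega> + b * W \<omega>) (a\<^sup>2 * 1 + b\<^sup>2 * 1)" for a b
    proof -
      have "(\<lambda>\<omega>. a * U \<omega> + b * W \<omega>) = (\<lambda>\<omega>. (a - b * \<rho> / s) * U \<omega> + (b / s) * V \<omega>)"
        using s by (auto simp: W_def field_simps)
      moreover have "(a - b * \<rho> / s)\<^sup>2 + (b / s)\<^sup>2 + 2 * (a - b * \<rho> / s) * (b / s) * \<rho> = a\<^sup>2 + b\<^sup>2"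
      proof -
        have "(a - b * \<rho> / s)\<^sup>2 + (b / s)\<^sup>2 + 2 * (a - b * \<rho> / s) * (b / s) * \<rho> = a\<^sup>2 + b\<^sup>2 * ((1 - \<rho>\<^sup>2) / s\<^sup>2)"
          using s(1) by (simp add: power2_eq_square field_simps)
        then show ?thesis using s \<rho> by simp
      qed
      ultimately show ?thesis using law[of "a - b * \<rho> / s" "b / s"] by simp
    qed
    have indep: "indep_var borel U borel W" by (rule gaussian_indep_var[OF UWlaw])
    have W: "gaussian M W 1" using UWlaw[of 0 1] by simp
    have Veq: "V \<omega> = \<rho> * U \<omega> + sqrt (1 - \<rho>\<^sup>2) * W \<omega>" for \<omega>
      using s unfolding W_def s_def[symmetric] by simp
    note law2 = gaussian_joint_law_mehler[OF indep U W \<rho>]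
    define K where "K \<omega> = mehler \<rho> (U \<omega>) (W \<omega>)" for \<omega>
    have [measurable]: "K \<in> borel_measurable M" unfolding K_def by measurable
    \<comment> \<open>Change of measure: expectations over the pair \<open>(U, V)\<close> become
      expectations over the independent pair \<open>(U, W)\<close> with weight \<open>K\<close>, so
      that orthogonality can be checked factor by factor.\<close>
    have transfer: "integrable M (\<lambda>\<omega>. F (U \<omega>) (V \<omega>)) \<longleftrightarrow> integrable M (\<lambda>\<omega>. K \<omega> * F (U \<omega>) (W \<omega>))"
        "expectation (\<lambda>\<omega>. F (U \<omega>) (V \<omega>)) = expectation (\<lambda>\<omega>. K \<omega> * F (U \<omega>) (W \<omega>))"
      if F[measurable]: "(\<lambda>p. F (fst p) (snd p)) \<in> borel_measurable (borel \<Otimes>\<^sub>M borel)" for F :: "real \<Rightarrow> real \<Rightarrow> real"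
    proof -
      let ?f = "\<lambda>p. F (fst p) (snd p)"
      let ?D = "density (distr M (borel \<Otimes>\<^sub>M borel) (\<lambda>\<omega>. (U \<omega>, W \<omega>))) (\<lambda>p. ennreal (mehler \<rho> (fst p) (snd p)))"
      have D: "distr M (borel \<Otimes>\<^sub>M borel) (\<lambda>\<omega>. (U \<omega>, V \<omega>)) = ?D"
        using law2(2) unfolding Veq[abs_def] by (simp add: split_beta')
      have "integrable M (\<lambda>\<omega>. F (U \<omega>) (V \<omega>)) \<longleftrightarrow> integrable ?D ?f"
        unfolding D[symmetric] by (subst integrable_distr_eq) auto
      also have "\<dots> \<longleftrightarrow> integrable M (\<lambda>\<omega>. K \<omega> * F (U \<omega>) (W \<omega>))"
        using mehler_pos[OF \<rho>] by (subst integrable_density) (auto simp: integrable_distr_eq K_def less_imp_le)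
      finally show "integrable M (\<lambda>\<omega>. F (U \<omega>) (V \<omega>)) \<longleftrightarrow> integrable M (\<lambda>\<omega>. K \<omega> * F (U \<omega>) (W \<omega>))" .
      have "expectation (\<lambda>\<omega>. F (U \<omega>) (V \<omega>)) = integral\<^sup>L ?D ?f"
        unfolding D[symmetric] by (subst integral_distr) auto
      also have "\<dots> = expectation (\<lambda>\<omega>. K \<omega> * F (U \<omega>) (W \<omega>))"
        using mehler_pos[OF \<rho>] by (subst integral_density) (auto simp: integral_distr K_def less_imp_le)
      finally show "expectation (\<lambda>\<omega>. F (U \<omega>) (V \<omega>)) = expectation (\<lambda>\<omega>. K \<omega> * F (U \<omega>) (W \<omega>))" .
    qed
    have prod: "integrable M (\<lambda>\<omega>. f (U \<omega>) * g (W \<omega>))"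
        "expectation (\<lambda>\<omega>. f (U \<omega>) * g (W \<omega>)) = expectation (\<lambda>\<omega>. f (U \<omega>)) * expectation (\<lambda>\<omega>. g (W \<omega>))"
      if [measurable]: "f \<in> borel_measurable borel" "g \<in> borel_measurable borel"
        and "integrable M (\<lambda>\<omega>. f (U \<omega>))" "integrable M (\<lambda>\<omega>. g (W \<omega>))" for f g :: "real \<Rightarrow> real"
    proof -
      have "indep_var borel (f \<circ> U) borel (g \<circ> W)" by (rule indep_var_compose[OF indep]) auto
      then show "integrable M (\<lambda>\<omega>. f (U \<omega>) * g (W \<omega>))"
        "expectation (\<lambda>\<omega>. f (U \<omega>) * g (W \<omega>)) = expectation (\<lambda>\<omega>. f (U \<omega>)) * expectation (\<lambda>\<omega>. g (W \<omega>))"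
        using that indep_var_integrable[of "f \<circ> U" "g \<circ> W"] indep_var_lebesgue_integral[of "f \<circ> U" "g \<circ> W"]
        by (auto simp: comp_def)
    qed
    note mU = gaussian_second_moment[OF U] and mW = gaussian_second_moment[OF W]
    define H where "H \<omega> = h (U \<omega>) * h (W \<omega>)" for \<omega>
    define P where "P \<omega> = U \<omega> * W \<omega>" for \<omega>
    have [measurable]: "H \<in> borel_measurable M" "P \<in> borel_measurable M" unfolding H_def P_def by measurable
    have H: "integrable M H" "expectation H = 0"
      using prod[of h h] sq[OF U] sq[OF W] by (auto simp: H_def[abs_def])
    have H2: "integrable M (\<lambda>\<omega>. (H \<omega>)\<^sup>2)" "expectation (\<lambda>\<omega>. (H \<omega>)\<^sup>2) = A\<^sup>2"
      using prod[of "\<lambda>x. (h x)\<^sup>2" "\<lambda>x. (h x)\<^sup>2"] sq[OF U] sq[OF W] by (auto simp: H_def power_mult_distrib power2_eq_square[of A])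
    have P: "integrable M P" "expectation P = 0"
      using prod[of "\<lambda>x. x" "\<lambda>x. x"] sq[OF U] sq[OF W] by (auto simp: P_def[abs_def])
    have P2: "integrable M (\<lambda>\<omega>. (P \<omega>)\<^sup>2)" "expectation (\<lambda>\<omega>. (P \<omega>)\<^sup>2) = 1"
      using prod[of "\<lambda>x. x\<^sup>2" "\<lambda>x. x\<^sup>2"] mU mW by (auto simp: P_def power_mult_distrib)
    have PH: "integrable M (\<lambda>\<omega>. P \<omega> * H \<omega>)" "expectation (\<lambda>\<omega>. P \<omega> * H \<omega>) = 0"
    proof -
      have "(\<lambda>\<omega>. P \<omega> * H \<omega>) = (\<lambda>\<omega>. (U \<omega> * h (U \<omega>)) * (W \<omega> * h (W \<omega>)))" by (auto simp: P_def H_def)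
      then show "integrable M (\<lambda>\<omega>. P \<omega> * H \<omega>)" "expectation (\<lambda>\<omega>. P \<omega> * H \<omega>) = 0"
        using prod[of "\<lambda>x. x * h x" "\<lambda>x. x * h x"] sq[OF U] sq[OF W] by auto
    qed
    have K2: "integrable M (\<lambda>\<omega>. (K \<omega>)\<^sup>2)" "expectation (\<lambda>\<omega>. (K \<omega>)\<^sup>2) = 1 / (1 - \<rho>\<^sup>2)"
    proof -
      have "(\<integral>\<^sup>+\<omega>. ennreal ((K \<omega>)\<^sup>2) \<partial>M) = (\<integral>\<^sup>+p. ennreal ((mehler \<rho> (fst p) (snd p))\<^sup>2) \<partial>distr M (borel \<Otimes>\<^sub>M borel) (\<lambda>\<omega>. (U \<omega>, W \<omega>)))"
        unfolding K_def by (subst nn_integral_distr) auto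
      also have "\<dots> = (\<integral>\<^sup>+x. \<integral>\<^sup>+y. ennreal ((mehler \<rho> x y)\<^sup>2) \<partial>?N \<partial>?N)"
        unfolding law2(1) by (subst N.nn_integral_fst[symmetric]) auto
      also have "\<dots> = ennreal (1 / (1 - \<rho>\<^sup>2))" by (rule nn_integral_mehler_square[OF \<rho>])
      finally have nn: "(\<integral>\<^sup>+\<omega>. ennreal ((K \<omega>)\<^sup>2) \<partial>M) = ennreal (1 / (1 - \<rho>\<^sup>2))" .
      then show "integrable M (\<lambda>\<omega>. (K \<omega>)\<^sup>2)" by (intro integrableI_nonneg) auto
      show "expectation (\<lambda>\<omega>. (K \<omega>)\<^sup>2) = 1 / (1 - \<rho>\<^sup>2)"
        using nn \<rho> by (subst integral_eq_nn_integral) auto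
    qed
    have K: "integrable M K" "expectation K = 1"
      using transfer[of "\<lambda>_ _. 1"] prob_space by auto
    have KH: "integrable M (\<lambda>\<omega>. K \<omega> * H \<omega>)" "expectation (\<lambda>\<omega>. K \<omega> * H \<omega>) = expectation (\<lambda>\<omega>. h (U \<omega>) * h (V \<omega>))"
      using transfer[of "\<lambda>x y. h x * h y"] hUV by (auto simp: H_def)
    have KP: "integrable M (\<lambda>\<omega>. K \<omega> * P \<omega>)" "expectation (\<lambda>\<omega>. K \<omega> * P \<omega>) = \<rho>"
    proof -
      have "integrable M (\<lambda>\<omega>. U \<omega> * V \<omega>)"
        by (rule integrable_mult_of_squares) (auto simp: mU gaussian_second_moment[OF V])
      then show "integrable M (\<lambda>\<omega>. K \<omega> * P \<omega>)" using transfer(1)[of "\<lambda>x y. x * y"] by (simp add: P_def)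
      have "expectation (\<lambda>\<omega>. U \<omega> * V \<omega>) = expectation (\<lambda>\<omega>. \<rho> * (U \<omega>)\<^sup>2 + s * P \<omega>)"
        by (intro Bochner_Integration.integral_cong) (auto simp: P_def Veq s_def power2_eq_square algebra_simps)
      also have "\<dots> = \<rho>" using mU P by simp
      finally show "expectation (\<lambda>\<omega>. K \<omega> * P \<omega>) = \<rho>" using transfer(2)[of "\<lambda>x y. x * y"] by (simp add: P_def)
    qed
    \<comment> \<open>The kernel minus its components along 1 and \<open>P\<close>. Since
      \<open>H\<close> is orthogonal to both, \<open>K\<close> may be replaced by \<open>D\<close>
      in the pairing with \<open>H\<close>.\<close>
    define D where "D \<omega> = K \<omega> - 1 - \<rho> * P \<omega>" for \<omega>
    have D2eq: "(\<lambda>\<omega>. (D \<omega>)\<^sup>2) = (\<lambda>\<omega>. (K \<omega>)\<^sup>2 + 1 + \<rho>\<^sup>2 * (P \<omega>)\<^sup>2 - 2 * K \<omega> - (2 * \<rho>) * (K \<omega> * P \<omega>) + (2 * \<rho>) * P \<omega>)"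
      by (auto simp: D_def power2_eq_square algebra_simps)
    have D2: "integrable M (\<lambda>\<omega>. (D \<omega>)\<^sup>2)"
      unfolding D2eq using K2 P2 K KP P by auto
    have "expectation (\<lambda>\<omega>. (D \<omega>)\<^sup>2) = 1 / (1 - \<rho>\<^sup>2) + 1 + \<rho>\<^sup>2 - 2 - 2 * \<rho> * \<rho>"
      unfolding D2eq using K2 P2 K KP P prob_space by simp
    also have "\<dots> = \<rho>\<^sup>2 * \<rho>\<^sup>2 / (1 - \<rho>\<^sup>2)"
      using \<rho> by (simp add: field_simps power2_eq_square)
    also have "\<dots> \<le> \<rho>\<^sup>2 * \<rho>\<^sup>2 / (1/2)"
      using True by (intro divide_left_mono) auto
    finally have ED2: "expectation (\<lambda>\<omega>. (D \<omega>)\<^sup>2) \<le> 2 * (\<rho>\<^sup>2 * \<rho>\<^sup>2)" by simp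
    have DH: "integrable M (\<lambda>\<omega>. D \<omega> * H \<omega>)" "expectation (\<lambda>\<omega>. D \<omega> * H \<omega>) = expectation (\<lambda>\<omega>. h (U \<omega>) * h (V \<omega>))"
    proof -
      have eq: "(\<lambda>\<omega>. D \<omega> * H \<omega>) = (\<lambda>\<omega>. K \<omega> * H \<omega> - H \<omega> - \<rho> * (P \<omega> * H \<omega>))"
        by (auto simp: D_def algebra_simps)
      show "integrable M (\<lambda>\<omega>. D \<omega> * H \<omega>)" unfolding eq using KH H PH by auto
      show "expectation (\<lambda>\<omega>. D \<omega> * H \<omega>) = expectation (\<lambda>\<omega>. h (U \<omega>) * h (V \<omega>))"
        unfolding eq using KH H PH by simp
    qed
    show ?thesis
    proof (cases "\<rho> = 0")
      case True
      then have "K = (\<lambda>_. 1)" by (auto simp: K_def mehler_def)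
      then show ?thesis using KH H True by simp
    next
      case False
      then have \<rho>0: "\<rho>\<^sup>2 > 0" by simp
      have "\<bar>expectation (\<lambda>\<omega>. H \<omega> * D \<omega>)\<bar> \<le> expectation (\<lambda>\<omega>. \<bar>H \<omega> * D \<omega>\<bar>)"
        by (rule integral_abs_bound)
      \<comment> \<open>The weight \<open>\<rho>^2\<close> balances the two terms: the second moment
        of \<open>D\<close> is of order \<open>\<rho> ^ 4\<close>, so after division by
        \<open>\<rho>^2\<close> both terms are of order \<open>\<rho>^2\<close>. Hence the separate
        case \<open>\<rho> = 0\<close>.\<close>
      also have "\<dots> \<le> expectation (\<lambda>\<omega>. (\<rho>\<^sup>2 * (H \<omega>)\<^sup>2 + (D \<omega>)\<^sup>2 / \<rho>\<^sup>2) / 2)"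
      proof (intro integral_mono)
        show "integrable M (\<lambda>\<omega>. \<bar>H \<omega> * D \<omega>\<bar>)" using DH(1) by (simp add: mult.commute)
      qed (use weighted_young[OF \<rho>0] H2 D2 in auto)
      also have "\<dots> = (\<rho>\<^sup>2 * A\<^sup>2 + expectation (\<lambda>\<omega>. (D \<omega>)\<^sup>2) / \<rho>\<^sup>2) / 2"
        using H2 D2 by simp
      also have "\<dots> \<le> (\<rho>\<^sup>2 * A\<^sup>2 + 2 * (\<rho>\<^sup>2 * \<rho>\<^sup>2) / \<rho>\<^sup>2) / 2"
        using ED2 \<rho>0 by (intro divide_right_mono add_left_mono) auto
      also have "\<dots> = (A\<^sup>2 / 2 + 1) * \<rho>\<^sup>2" using \<rho>0 by (simp add: field_simps)
      also have "\<dots> \<le> (A\<^sup>2 + 2 * A + 1) * \<rho>\<^sup>2" using A0 by (intro mult_right_mono) auto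
      finally show ?thesis using DH by (simp add: mult.commute)
    qed
  qed
qed

end

section \<open>The linear process\<close>

text \<open>Summability of \<open>q ^ p\<close> gives a limit along the powers of 2, and the same
  bound controls the oscillation between consecutive powers.\<close>

lemma convergent_dyadic_blocks:
  fixes S :: "nat \<Rightarrow> real"
  assumes q: "0 < q" "q < 1"
    and bd: "\<And>p j. p0 \<le> p \<Longrightarrow> j \<le> 2 ^ p \<Longrightarrow> \<bar>S (2 ^ p + j) - S (2 ^ p)\<bar> \<le> q ^ p"
  shows "convergent S"
proof -
  define d where "d p = S (2 ^ Suc p) - S (2 ^ p)" for p
  have "summable d"
  proof (rule summable_comparison_test)
    have "\<bar>d p\<bar> \<le> q ^ p" if "p \<ge> p0" for p
      using bd[OF that, of "2 ^ p"] by (simp add: d_def mult_2)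
    then show "\<exists>N. \<forall>n\<ge>N. norm (d n) \<le> q ^ n" by auto
    show "summable (\<lambda>n. q ^ n)" using q by (intro summable_geometric) auto
  qed
  then have "(\<lambda>m. \<Sum>p<m. d p) \<longlonglongrightarrow> suminf d" by (rule summable_LIMSEQ)
  moreover have "(\<Sum>p<m. d p) = S (2 ^ m) - S 1" for m
    by (induction m) (auto simp: d_def)
  ultimately have "(\<lambda>m. S (2 ^ m) - S 1) \<longlonglongrightarrow> suminf d" by simp
  then have "(\<lambda>m. S (2 ^ m) - S 1 + S 1) \<longlonglongrightarrow> suminf d + S 1" by (intro tendsto_intros)
  then have L: "(\<lambda>m. S (2 ^ m)) \<longlonglongrightarrow> suminf d + S 1" by simp
  define l where "l = suminf d + S 1"
  have q0: "(\<lambda>p. q ^ p) \<longlonglongrightarrow> 0" using q by (intro LIMSEQ_realpow_zero) auto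
  have "S \<longlonglongrightarrow> l"
  proof (rule LIMSEQ_I)
    fix e :: real assume e: "0 < e"
    obtain p1 where p1: "\<And>p. p \<ge> p1 \<Longrightarrow> \<bar>S (2 ^ p) - l\<bar> < e / 2"
      using LIMSEQ_D[OF L, of "e / 2"] e by (auto simp: l_def)
    obtain p2 where p2: "\<And>p. p \<ge> p2 \<Longrightarrow> q ^ p < e / 2"
      using LIMSEQ_D[OF q0, of "e / 2"] e q by auto
    define P where "P = max p0 (max p1 p2)"
    show "\<exists>no. \<forall>n\<ge>no. norm (S n - l) < e"
    proof (intro exI[of _ "2 ^ P"] allI impI)
      fix n :: nat assume n: "2 ^ P \<le> n"
      then have n0: "n \<ge> 1" by (metis le_trans one_le_numeral one_le_power)
      obtain p where p: "2 ^ p \<le> n" "n < 2 ^ Suc p"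
        using ex_power_ivl1[of 2 n] n0 by auto
      have "P \<le> p"
      proof (rule ccontr)
        assume "\<not> P \<le> p"
        then have "(2::nat) ^ Suc p \<le> 2 ^ P" by (intro power_increasing) auto
        then show False using n p by linarith
      qed
      then have P: "p0 \<le> p" "p1 \<le> p" "p2 \<le> p" by (auto simp: P_def)
      have "\<bar>S (2 ^ p + (n - 2 ^ p)) - S (2 ^ p)\<bar> \<le> q ^ p"
        using p by (intro bd P) auto
      then have "\<bar>S n - S (2 ^ p)\<bar> \<le> q ^ p" using p by simp
      then show "norm (S n - l) < e" using p1[OF P(2)] p2[OF P(3)] unfolding real_norm_def by linarith
    qed
  qed
  then show ?thesis by (auto simp: convergent_def)
qed

context prob_space
begin

text \<open>The functions \<open>iexp (t * X n \<omega>)\<close> are bounded, so almost sure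
  convergence of the variables already gives convergence of the characteristic functions.\<close>

lemma gaussian_limit:
  assumes g: "\<And>n. gaussian M (X n) (v n)" and X[measurable]: "Y \<in> borel_measurable M"
    and lim: "AE \<omega> in M. (\<lambda>n. X n \<omega>) \<longlonglongrightarrow> Y \<omega>" and v: "v \<longlonglongrightarrow> w"
  shows "gaussian M Y w"
proof (rule gaussianI)
  have [measurable]: "X n \<in> borel_measurable M" for n using g by (rule gaussian_measurable)
  show "0 \<le> w" using v gaussian_nonneg[OF g] by (intro LIMSEQ_le_const[OF v]) auto
  fix t
  have "(\<lambda>n. CLINT \<omega>|M. iexp (t * X n \<omega>)) \<longlonglongrightarrow> (CLINT \<omega>|M. iexp (t * Y \<omega>))"
  proof (rule integral_dominated_convergence[where w="\<lambda>_. 1"])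
    show "AE \<omega> in M. (\<lambda>n. iexp (t * X n \<omega>)) \<longlonglongrightarrow> iexp (t * Y \<omega>)"
      using lim by eventually_elim (intro tendsto_intros)
  qed auto
  moreover have "(\<lambda>n. complex_of_real (exp (- (v n * t\<^sup>2) / 2))) \<longlonglongrightarrow> exp (- (w * t\<^sup>2) / 2)"
    unfolding exp_of_real[symmetric] by (intro tendsto_intros v) auto
  then have "(\<lambda>n. CLINT \<omega>|M. iexp (t * X n \<omega>)) \<longlonglongrightarrow> exp (- (w * t\<^sup>2) / 2)"
    by (simp only: gaussian_char'[OF g])
  ultimately have "(CLINT \<omega>|M. iexp (t * Y \<omega>)) = exp (- (w * t\<^sup>2) / 2)"
    by (rule LIMSEQ_unique)
  then show "char (distr M borel Y) t = exp (- (w * t\<^sup>2) / 2)"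
    unfolding char_def by (subst integral_distr) auto
qed simp

lemma gaussian_independent_sum:
  assumes I: "finite I" and indep: "indep_vars (\<lambda>_. borel) X I"
    and g: "\<And>i. i \<in> I \<Longrightarrow> gaussian M (X i) 1"
  shows "gaussian M (\<lambda>\<omega>. \<Sum>i\<in>I. c i * X i \<omega>) (\<Sum>i\<in>I. (c i)\<^sup>2)"
proof (rule gaussianI)
  show "(\<lambda>\<omega>. \<Sum>i\<in>I. c i * X i \<omega>) \<in> borel_measurable M"
    using g by (intro borel_measurable_sum borel_measurable_times) (auto dest: gaussian_measurable)
  show "0 \<le> (\<Sum>i\<in>I. (c i)\<^sup>2)" by (intro sum_nonneg) auto
  fix t
  have "indep_vars (\<lambda>_. borel) (\<lambda>i \<omega>. c i * X i \<omega>) I"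
    using indep by (rule indep_vars_compose2) auto
  then have "char (distr M borel (\<lambda>\<omega>. \<Sum>i\<in>I. c i * X i \<omega>)) t = (\<Prod>i\<in>I. char (distr M borel (\<lambda>\<omega>. c i * X i \<omega>)) t)"
    by (rule char_distr_sum)
  also have "\<dots> = (\<Prod>i\<in>I. complex_of_real (exp (- ((c i)\<^sup>2 * t\<^sup>2) / 2)))"
    using gaussian_char[OF gaussian_cmult[OF g]] by (intro prod.cong) auto
  also have "\<dots> = complex_of_real (exp (\<Sum>i\<in>I. - ((c i)\<^sup>2 * t\<^sup>2) / 2))"
    by (simp add: exp_sum[OF I])
  also have "(\<Sum>i\<in>I. - ((c i)\<^sup>2 * t\<^sup>2) / 2) = - ((\<Sum>i\<in>I. (c i)\<^sup>2) * t\<^sup>2) / 2"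
    by (simp add: sum_distrib_right sum_negf sum_divide_distrib)
  finally show "char (distr M borel (\<lambda>\<omega>. \<Sum>i\<in>I. c i * X i \<omega>)) t = exp (- ((\<Sum>i\<in>I. (c i)\<^sup>2) * t\<^sup>2) / 2)" .
qed

end

locale gaussian_linear_process = prob_space M for M :: "'a measure" +
  fixes \<xi> :: "int \<Rightarrow> 'a \<Rightarrow> real" and \<psi> :: "nat \<Rightarrow> real" and \<alpha> :: real
  assumes \<alpha>: "0 < \<alpha>" "\<alpha> < 1"
    and indep: "indep_vars (\<lambda>_. borel) \<xi> UNIV"
    and normal: "\<And>k. gaussian M (\<xi> k) 1"
    and weights: "(\<lambda>k. \<psi> k / real k powr (- (1 + \<alpha>) / 2)) \<longlonglongrightarrow> 1"
begin

definition \<eta> :: "nat \<Rightarrow> 'a \<Rightarrow> real" where "\<eta> = linear_process \<psi> \<xi>"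

definition autocov :: "nat \<Rightarrow> real" where "autocov n = (\<Sum>k. \<psi> k * \<psi> (k + n))"

text \<open>Subtraction of naturals truncates at 0, so the lag is selected by cases.\<close>

definition cov :: "nat \<Rightarrow> nat \<Rightarrow> real" where "cov i j = autocov (if i \<le> j then j - i else i - j)"

lemma xi_measurable[measurable]: "\<xi> k \<in> borel_measurable M"
  using normal by (rule gaussian_measurable)

lemma eta_measurable[measurable]: "\<eta> j \<in> borel_measurable M"
  unfolding \<eta>_def linear_process_def[abs_def] by measurable

lemma gaussian_weighted_innovations:
  "finite I \<Longrightarrow> gaussian M (\<lambda>\<omega>. \<Sum>i\<in>I. c i * \<xi> i \<omega>) (\<Sum>i\<in>I. (c i)\<^sup>2)"
  by (rule gaussian_independent_sum) (auto intro: indep_vars_subset[OF indep] normal)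

lemma weights_decay:
  obtains C where "C > 0" "\<And>k. \<bar>\<psi> k\<bar> \<le> C * (real k + 1) powr (-(1 + \<alpha>) / 2)"
proof -
  have e: "-(1 + \<alpha>) / 2 = - ((1 + \<alpha>) / 2)" by (simp only: minus_divide_left)
  show ?thesis using powr_decay_bound[OF weights[unfolded e]] that unfolding e by blast
qed

lemma gaussian_reversed_block:
  "gaussian M (\<lambda>\<omega>. \<Sum>i<n. \<psi> (a + i) * \<xi> (int j - int (a + i)) \<omega>) (\<Sum>i<n. (\<psi> (a + i))\<^sup>2)"
proof -
  let ?f = "\<lambda>i. int j - int (a + i)"
  have inj: "inj_on ?f {..<n}" by (auto simp: inj_on_def)
  let ?c = "\<lambda>k. \<psi> (nat (int j - k))"
  have "gaussian M (\<lambda>\<omega>. \<Sum>k\<in>?f ` {..<n}. ?c k * \<xi> k \<omega>) (\<Sum>k\<in>?f ` {..<n}. (?c k)\<^sup>2)"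
    by (rule gaussian_weighted_innovations) simp
  then show ?thesis
    unfolding sum.reindex[OF inj] by (simp add: nat_int_add)
qed

text \<open>The block of indices from \<open>2 ^ p\<close> to \<open>2 ^ (p + 1)\<close> has
  variance of order \<open>2 powr (- \<alpha> * p)\<close>. The maximal inequality and
  Borel-Cantelli then give geometrically small oscillation on all late blocks.\<close>

lemma AE_summable_linear_process: "AE \<omega> in M. summable (\<lambda>k. \<psi> k * \<xi> (int j - int k) \<omega>)"
proof -
  obtain C where C: "C > 0" "\<And>k. \<bar>\<psi> k\<bar> \<le> C * (real k + 1) powr (-(1 + \<alpha>) / 2)"
    using weights_decay by blast
  define X where "X k \<omega> = \<psi> k * \<xi> (int j - int k) \<omega>" for k \<omega>
  have [measurable]: "X k \<in> borel_measurable M" for k unfolding X_def by measurable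
  \<comment> \<open>The exponents budget as follows: the maximal bound below is of order
    \<open>2 powr (- \<alpha> * p / 2)\<close>, and dividing by \<open>(q ^ p)^2\<close>, that is by
    \<open>2 powr (- \<alpha> * p / 4)\<close>, leaves a summable probability.\<close>
  define q where "q = 2 powr (- \<alpha> / 8)"
  have q: "0 < q" "q < 1" using \<alpha> powr_less_mono[of "-\<alpha>/8" 0 "2::real"] by (auto simp: q_def)
  define E where "E p = {\<omega>\<in>space M. \<exists>i\<le>2^p. q ^ p \<le> \<bar>\<Sum>k<i. X (2 ^ p + (0 + k)) \<omega>\<bar>}" for p
  have E_meas[measurable]: "E p \<in> sets M" for p unfolding E_def by measurable
  have gb: "gaussian M (\<lambda>\<omega>. \<Sum>i<n. X (2^p + (a + i)) \<omega>) (\<Sum>i<n. (\<psi> (2^p + a + i))\<^sup>2)" for p a n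
    using gaussian_reversed_block[where a="2^p + a"] by (simp add: X_def add.assoc)
  have PE: "prob (E p) \<le> maximal_const (1 + \<alpha> / 2) * C\<^sup>2 * (2 powr (- \<alpha> / 4)) ^ p" for p
  proof -
    \<comment> \<open>The sharp bound is linear in \<open>n\<close>, but the maximal inequality asks
      for an exponent above 1. Weakening \<open>n\<close> to
      \<open>n powr (1 + \<alpha> / 2)\<close> costs only half of the available decay on a block of
      length \<open>2 ^ p\<close>.\<close>
    have var: "(\<Sum>i<n. (\<psi> (2^p + a + i))\<^sup>2) \<le> (C\<^sup>2 * (2 ^ p) powr (- (1 + \<alpha>))) * real n powr (1 + \<alpha> / 2)" for a n
    proof (cases "n = 0")
      case False
      have "(\<psi> (2^p + a + i))\<^sup>2 \<le> C\<^sup>2 * (2 ^ p) powr (- (1 + \<alpha>))" for i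
      proof -
        have "(real (2^p + a + i) + 1) powr (-(1 + \<alpha>) / 2) \<le> (2 ^ p) powr (-(1 + \<alpha>) / 2)"
          using \<alpha> by (intro powr_mono2') auto
        then have "\<bar>\<psi> (2^p + a + i)\<bar> \<le> C * (2 ^ p) powr (-(1 + \<alpha>) / 2)"
          using C(2)[of "2^p + a + i"] mult_left_mono[OF _ less_imp_le[OF C(1)]] order_trans by blast
        then have "\<bar>\<psi> (2^p + a + i)\<bar>\<^sup>2 \<le> (C * (2 ^ p) powr (-(1 + \<alpha>) / 2))\<^sup>2"
          by (intro power_mono) auto
        also have "\<dots> = C\<^sup>2 * ((2 ^ p) powr (-(1 + \<alpha>) / 2) * (2 ^ p) powr (-(1 + \<alpha>) / 2))"
          by (simp add: power2_eq_square)
        also have "\<dots> = C\<^sup>2 * (2 ^ p) powr (- (1 + \<alpha>))" by (simp only: powr_add[symmetric]) simp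
        finally show ?thesis by simp
      qed
      then have "(\<Sum>i<n. (\<psi> (2^p + a + i))\<^sup>2) \<le> (\<Sum>i<n. C\<^sup>2 * (2 ^ p) powr (- (1 + \<alpha>)))"
        by (intro sum_mono)
      also have "\<dots> = C\<^sup>2 * (2 ^ p) powr (- (1 + \<alpha>)) * real n" by simp
      also have "\<dots> \<le> C\<^sup>2 * (2 ^ p) powr (- (1 + \<alpha>)) * real n powr (1 + \<alpha> / 2)"
        using False \<alpha> powr_mono[of 1 "1 + \<alpha>/2" "real n"] by (intro mult_left_mono) auto
      finally show ?thesis .
    qed simp
    have "prob (E p) \<le> maximal_const (1 + \<alpha> / 2) * (C\<^sup>2 * (2 ^ p) powr (- (1 + \<alpha>))) * real (2 ^ p) powr (1 + \<alpha> / 2) / (q ^ p)\<^sup>2"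
      unfolding E_def
    proof (rule prob_max_sum_ge[where X="\<lambda>i. X (2 ^ p + i)"])
      fix a n
      show "integrable M (\<lambda>\<omega>. (\<Sum>i<n. X (2 ^ p + (a + i)) \<omega>)\<^sup>2)"
        by (rule gaussian_second_moment(1)[OF gb])
      show "expectation (\<lambda>\<omega>. (\<Sum>i<n. X (2 ^ p + (a + i)) \<omega>)\<^sup>2) \<le> (C\<^sup>2 * (2 ^ p) powr (- (1 + \<alpha>))) * real n powr (1 + \<alpha> / 2)"
        unfolding gaussian_second_moment(2)[OF gb] by (rule var)
    qed (use \<alpha> q in auto)
    also have "\<dots> = maximal_const (1 + \<alpha> / 2) * C\<^sup>2 * ((2 ^ p) powr (- (1 + \<alpha>)) * (2 ^ p) powr (1 + \<alpha> / 2) * (2 ^ p) powr (\<alpha> / 4))"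
    proof -
      have "(q ^ p)\<^sup>2 = (2 ^ p) powr (- \<alpha> / 4)"
        unfolding q_def by (simp add: powr_realpow[symmetric] powr_powr power2_eq_square powr_add[symmetric] mult_ac)
      then have "1 / (q ^ p)\<^sup>2 = (2 ^ p) powr (\<alpha> / 4)" by (simp add: powr_minus_divide)
      then have d: "z / (q ^ p)\<^sup>2 = z * (2 ^ p) powr (\<alpha> / 4)" for z
        by (metis mult.right_neutral times_divide_eq_right)
      show ?thesis unfolding d by (simp add: mult_ac)
    qed
    also have "(2 ^ p) powr (- (1 + \<alpha>)) * (2 ^ p) powr (1 + \<alpha> / 2) * (2 ^ p) powr (\<alpha> / 4) = (2 ^ p) powr (- \<alpha> / 4)"
      unfolding powr_add[symmetric] by (simp add: field_simps)
    also have "\<dots> = (2 powr (- \<alpha> / 4)) ^ p"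
      by (simp add: powr_realpow[symmetric] powr_powr mult.commute)
    finally show ?thesis .
  qed
  have "summable (\<lambda>p. prob (E p))"
  proof (rule summable_comparison_test')
    show "summable (\<lambda>p. maximal_const (1 + \<alpha> / 2) * C\<^sup>2 * (2 powr (- \<alpha> / 4)) ^ p)"
      using \<alpha> powr_less_mono[of "-\<alpha>/4" 0 "2::real"] by (intro summable_mult summable_geometric) auto
    show "norm (prob (E p)) \<le> maximal_const (1 + \<alpha> / 2) * C\<^sup>2 * (2 powr (- \<alpha> / 4)) ^ p" for p
      using PE[of p] by simp
  qed
  then have "AE \<omega> in M. eventually (\<lambda>p. \<omega> \<in> space M - E p) sequentially"
    by (intro borel_cantelli_AE1) (auto simp: emeasure_eq_measure)
  then show ?thesis
  proof eventually_elim
    fix \<omega> assume "eventually (\<lambda>p. \<omega> \<in> space M - E p) sequentially"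
    then obtain p0 where p0: "\<And>p. p \<ge> p0 \<Longrightarrow> \<omega> \<in> space M - E p"
      by (auto simp: eventually_sequentially)
    define S where "S n = (\<Sum>k<n. X k \<omega>)" for n
    have "convergent S"
    proof (rule convergent_dyadic_blocks[OF q])
      fix p i :: nat assume "p0 \<le> p" "i \<le> 2 ^ p"
      then have "\<not> q ^ p \<le> \<bar>\<Sum>k<i. X (2 ^ p + (0 + k)) \<omega>\<bar>" using p0[of p] by (auto simp: E_def)
      then have "\<bar>\<Sum>k<i. X (2 ^ p + k) \<omega>\<bar> \<le> q ^ p" by simp
      moreover have "S (2 ^ p + i) - S (2 ^ p) = (\<Sum>k<i. X (2 ^ p + k) \<omega>)"
        unfolding S_def by (induction i) auto
      ultimately show "\<bar>S (2 ^ p + i) - S (2 ^ p)\<bar> \<le> q ^ p" by simp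
    qed
    then show "summable (\<lambda>k. \<psi> k * \<xi> (int j - int k) \<omega>)"
      by (simp add: summable_iff_convergent S_def[abs_def] X_def)
  qed
qed

end

section \<open>Covariances and joint normality of the moving average\<close>

context gaussian_linear_process
begin

text \<open>The extension by zero lets several \<open>\<eta> j\<close> be expanded over one common
  range of innovations, so that their coefficients can be added.\<close>

definition \<psi>' :: "int \<Rightarrow> real" where "\<psi>' d = (if d \<ge> 0 then \<psi> (nat d) else 0)"

lemma sum_extended_weights:
  assumes "j \<le> m"
  shows "(\<Sum>i\<in>{- int K<..int m}. \<psi>' (int j - i) * f i) = (\<Sum>k<K + j. \<psi> k * f (int j - int k))"
proof -
  have "(\<Sum>i\<in>{- int K<..int m}. \<psi>' (int j - i) * f i) = (\<Sum>i\<in>{- int K<..int j}. \<psi>' (int j - i) * f i)"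
    using assms by (intro sum.mono_neutral_right) (auto simp: \<psi>'_def)
  also have "\<dots> = (\<Sum>k<K + j. \<psi> k * f (int j - int k))"
    by (rule sum.reindex_bij_witness[where i="\<lambda>k. int j - int k" and j="\<lambda>i. nat (int j - i)"])
      (auto simp: \<psi>'_def)
  finally show ?thesis .
qed

lemma weights': "(\<lambda>k. \<psi> k / real k powr (-((1 + \<alpha>) / 2))) \<longlonglongrightarrow> 1"
proof -
  have *: "-(1 + \<alpha>) / 2 = - ((1 + \<alpha>) / 2)" by (simp only: minus_divide_left)
  show ?thesis using weights unfolding * .
qed

lemma summable_autocov: "summable (\<lambda>k. \<psi> k * \<psi> (k + n))"
proof -
  have "summable (\<lambda>k. \<bar>\<psi> k * \<psi> (k + n)\<bar>)"
    by (rule autocovariance_asymptotics(1)[OF _ _ weights']) (use \<alpha> in auto)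
  then show ?thesis by (rule summable_rabs_cancel)
qed

lemma cov_sym: "cov i j = cov j i"
  by (auto simp: cov_def)

lemma cov_shift: "cov (a + i) (a + j) = cov i j"
  by (simp add: cov_def)

lemma cov_limit:
  assumes "j \<le> m" "j' \<le> m"
  shows "(\<lambda>K. \<Sum>i\<in>{- int K<..int m}. \<psi>' (int j - i) * \<psi>' (int j' - i)) \<longlonglongrightarrow> cov j j'"
proof -
  have *: "(\<lambda>K. \<Sum>i\<in>{- int K<..int m}. \<psi>' (int j - i) * \<psi>' (int j' - i)) \<longlonglongrightarrow> cov j j'"
    if j: "j \<le> j'" "j' \<le> m" for j j'
  proof -
    have "(\<lambda>n. \<Sum>k<n. \<psi> k * \<psi> (k + (j' - j))) \<longlonglongrightarrow> autocov (j' - j)"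
      unfolding autocov_def using summable_autocov by (rule summable_LIMSEQ)
    then have "(\<lambda>K. \<Sum>k<K + j. \<psi> k * \<psi> (k + (j' - j))) \<longlonglongrightarrow> autocov (j' - j)"
      by (rule LIMSEQ_ignore_initial_segment)
    moreover have "(\<Sum>i\<in>{- int K<..int m}. \<psi>' (int j - i) * \<psi>' (int j' - i)) = (\<Sum>k<K + j. \<psi> k * \<psi> (k + (j' - j)))" for K
    proof -
      have "(\<Sum>i\<in>{- int K<..int m}. \<psi>' (int j - i) * \<psi>' (int j' - i)) = (\<Sum>k<K + j. \<psi> k * \<psi>' (int j' - (int j - int k)))"
        using j by (intro sum_extended_weights) auto
      also have "\<dots> = (\<Sum>k<K + j. \<psi> k * \<psi> (k + (j' - j)))"
      proof (intro sum.cong refl)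
        fix k
        have "int j' - (int j - int k) = int (k + (j' - j))" using j by simp
        then have "\<psi>' (int j' - (int j - int k)) = \<psi>' (int (k + (j' - j)))" by (rule arg_cong)
        then show "\<psi> k * \<psi>' (int j' - (int j - int k)) = \<psi> k * \<psi> (k + (j' - j))" unfolding \<psi>'_def nat_int by simp
      qed
      finally show ?thesis .
    qed
    ultimately show ?thesis using j by (simp add: cov_def)
  qed
  show ?thesis
  proof (cases "j \<le> j'")
    case True
    then show ?thesis using *[of j j'] assms by simp
  next
    case False
    then show ?thesis using *[of j' j] assms by (simp add: cov_sym[of j] mult.commute)
  qed
qed

text \<open>Discarding the innovations up to \<open>- K\<close> leaves a finite independent sum,
  which is normal. As \<open>K\<close> grows it converges almost surely, and its variance tends to
  the covariance form. This joint normality underlies all later Gaussian computations.\<close>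

lemma gaussian_eta_combination:
  assumes J: "finite J"
  shows "gaussian M (\<lambda>\<omega>. \<Sum>j\<in>J. a j * \<eta> j \<omega>) (\<Sum>j\<in>J. \<Sum>j'\<in>J. a j * a j' * cov j j')"
proof -
  define m where "m = Max (insert 0 J)"
  have m: "j \<le> m" if "j \<in> J" for j
    unfolding m_def using that J by (intro Max_ge) auto
  define I where "I K = {- int K<..int m}" for K
  define c where "c i = (\<Sum>j\<in>J. a j * \<psi>' (int j - i))" for i
  show ?thesis
  proof (rule gaussian_limit[where X="\<lambda>K \<omega>. \<Sum>i\<in>I K. c i * \<xi> i \<omega>" and v="\<lambda>K. \<Sum>i\<in>I K. (c i)\<^sup>2"])
    show "gaussian M (\<lambda>\<omega>. \<Sum>i\<in>I K. c i * \<xi> i \<omega>) (\<Sum>i\<in>I K. (c i)\<^sup>2)" for K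
      by (rule gaussian_weighted_innovations) (simp add: I_def)
    have "AE \<omega> in M. \<forall>j. summable (\<lambda>k. \<psi> k * \<xi> (int j - int k) \<omega>)"
      unfolding AE_all_countable using AE_summable_linear_process by blast
    then show "AE \<omega> in M. (\<lambda>K. \<Sum>i\<in>I K. c i * \<xi> i \<omega>) \<longlonglongrightarrow> (\<Sum>j\<in>J. a j * \<eta> j \<omega>)"
    proof eventually_elim
      fix \<omega> assume s: "\<forall>j. summable (\<lambda>k. \<psi> k * \<xi> (int j - int k) \<omega>)"
      have "(\<lambda>K. \<Sum>j\<in>J. a j * (\<Sum>k<K + j. \<psi> k * \<xi> (int j - int k) \<omega>)) \<longlonglongrightarrow> (\<Sum>j\<in>J. a j * \<eta> j \<omega>)"
        unfolding \<eta>_def linear_process_def using s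
        by (intro tendsto_sum tendsto_mult tendsto_const LIMSEQ_ignore_initial_segment[OF summable_LIMSEQ]) auto
      also have "(\<lambda>K. \<Sum>j\<in>J. a j * (\<Sum>k<K + j. \<psi> k * \<xi> (int j - int k) \<omega>)) = (\<lambda>K. \<Sum>i\<in>I K. c i * \<xi> i \<omega>)"
      proof
        fix K
        have "(\<Sum>i\<in>I K. c i * \<xi> i \<omega>) = (\<Sum>j\<in>J. \<Sum>i\<in>I K. a j * (\<psi>' (int j - i) * \<xi> i \<omega>))"
          unfolding c_def sum_distrib_right by (subst sum.swap) (simp add: mult.assoc)
        also have "\<dots> = (\<Sum>j\<in>J. a j * (\<Sum>k<K + j. \<psi> k * \<xi> (int j - int k) \<omega>))"
          unfolding sum_distrib_left[symmetric] I_def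
          by (intro sum.cong refl) (simp only: sum_extended_weights[OF m])
        finally show "(\<Sum>j\<in>J. a j * (\<Sum>k<K + j. \<psi> k * \<xi> (int j - int k) \<omega>)) = (\<Sum>i\<in>I K. c i * \<xi> i \<omega>)" by simp
      qed
      finally show "(\<lambda>K. \<Sum>i\<in>I K. c i * \<xi> i \<omega>) \<longlonglongrightarrow> (\<Sum>j\<in>J. a j * \<eta> j \<omega>)" .
    qed
    have "(\<lambda>K. \<Sum>j\<in>J. \<Sum>j'\<in>J. a j * a j' * (\<Sum>i\<in>I K. \<psi>' (int j - i) * \<psi>' (int j' - i))) \<longlonglongrightarrow>
       (\<Sum>j\<in>J. \<Sum>j'\<in>J. a j * a j' * cov j j')"
      unfolding I_def by (intro tendsto_sum tendsto_mult tendsto_const cov_limit m)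
    also have "(\<lambda>K. \<Sum>j\<in>J. \<Sum>j'\<in>J. a j * a j' * (\<Sum>i\<in>I K. \<psi>' (int j - i) * \<psi>' (int j' - i))) = (\<lambda>K. \<Sum>i\<in>I K. (c i)\<^sup>2)"
    proof
      fix K
      have "(\<Sum>i\<in>I K. (c i)\<^sup>2) = (\<Sum>i\<in>I K. \<Sum>j\<in>J. \<Sum>j'\<in>J. (a j * a j') * (\<psi>' (int j - i) * \<psi>' (int j' - i)))"
        unfolding c_def power2_eq_square sum_product by (simp add: mult_ac)
      also have "\<dots> = (\<Sum>j\<in>J. \<Sum>i\<in>I K. \<Sum>j'\<in>J. (a j * a j') * (\<psi>' (int j - i) * \<psi>' (int j' - i)))"
        by (rule sum.swap)
      also have "\<dots> = (\<Sum>j\<in>J. \<Sum>j'\<in>J. \<Sum>i\<in>I K. (a j * a j') * (\<psi>' (int j - i) * \<psi>' (int j' - i)))"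
        by (intro sum.cong refl sum.swap)
      finally show "(\<Sum>j\<in>J. \<Sum>j'\<in>J. a j * a j' * (\<Sum>i\<in>I K. \<psi>' (int j - i) * \<psi>' (int j' - i))) = (\<Sum>i\<in>I K. (c i)\<^sup>2)"
        by (simp add: sum_distrib_left)
    qed
    finally show "(\<lambda>K. \<Sum>i\<in>I K. (c i)\<^sup>2) \<longlonglongrightarrow> (\<Sum>j\<in>J. \<Sum>j'\<in>J. a j * a j' * cov j j')" .
  qed simp
qed

definition beta_integral :: real where
  "beta_integral = (LINT x:{0<..}|lborel. x powr (- (\<alpha> + 1) / 2) * (1 + x) powr (- (\<alpha> + 1) / 2))"

lemma autocov_limit: "(\<lambda>n. autocov n / real n powr (-\<alpha>)) \<longlonglongrightarrow> beta_integral"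
proof -
  have e: "- ((1 + \<alpha>) / 2) = - (\<alpha> + 1) / 2" by (simp add: field_simps)
  have e2: "1 - 2 * ((1 + \<alpha>) / 2) = - \<alpha>" by (simp add: field_simps)
  have "1/2 < (1 + \<alpha>) / 2" "(1 + \<alpha>) / 2 < 1" using \<alpha> by auto
  from autocovariance_asymptotics(2)[OF this weights'] show ?thesis
    unfolding e e2 autocov_def[abs_def] beta_integral_def .
qed

lemma beta_integral_pos: "beta_integral > 0"
proof -
  let ?f = "\<lambda>x::real. indicator {0<..} x *\<^sub>R (x powr (- (\<alpha> + 1) / 2) * (1 + x) powr (- (\<alpha> + 1) / 2))"
  have e: "- ((1 + \<alpha>) / 2) = - (\<alpha> + 1) / 2" by (simp add: field_simps)
  have int: "integrable lborel ?f"
    using integrable_powr_convolution[of "(1 + \<alpha>) / 2"] \<alpha> unfolding set_integrable_def e by auto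
  have "integral\<^sup>L lborel ?f \<noteq> 0"
  proof
    assume "integral\<^sup>L lborel ?f = 0"
    then have "AE x in lborel. ?f x = 0"
      using integral_nonneg_eq_0_iff_AE[OF int] by auto
    then have "AE x in lborel. x \<notin> {0<..<1::real}"
      by eventually_elim (auto simp: indicator_def split: if_splits)
    then have "emeasure lborel {0<..<1::real} = 0"
      by (intro AE_iff_measurable[THEN iffD1]) (auto simp: emeasure_notin_sets)
    then show False by simp
  qed
  moreover have "integral\<^sup>L lborel ?f \<ge> 0" by (intro integral_nonneg_AE) auto
  ultimately have "integral\<^sup>L lborel ?f > 0" by linarith
  then show ?thesis unfolding beta_integral_def set_lebesgue_integral_def .
qed

lemma autocov_decay:
  obtains C where "C > 0" "\<And>n. \<bar>autocov n\<bar> \<le> C * (real n + 1) powr (-\<alpha>)"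
  using powr_decay_bound[OF autocov_limit] by auto

section \<open>Growth of the variance of the sums\<close>

definition var_sum :: "nat \<Rightarrow> real" where "var_sum n = (\<Sum>i<n. \<Sum>j<n. cov i j)"

lemma sum_cov_diagonal: "(\<Sum>i<n. cov i n) = (\<Sum>k<Suc n. autocov k) - autocov 0"
proof -
  have "(\<Sum>i<n. cov i n) = (\<Sum>i<n. autocov (Suc i))"
    by (rule sum.reindex_bij_witness[where i="\<lambda>i. n - Suc i" and j="\<lambda>i. n - Suc i"]) (auto simp: cov_def Suc_diff_Suc)
  then show ?thesis by (simp add: sum.lessThan_Suc_shift del: sum.lessThan_Suc)
qed

lemma var_sum_Suc: "var_sum (Suc n) - var_sum n = 2 * (\<Sum>k<Suc n. autocov k) - autocov 0"
proof -
  have "var_sum (Suc n) = var_sum n + 2 * (\<Sum>i<n. cov i n) + cov n n"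
    unfolding var_sum_def using cov_sym by (simp add: sum.distrib)
  then show ?thesis unfolding sum_cov_diagonal by (simp add: cov_def)
qed

text \<open>The second difference of \<open>var_sum\<close> is twice the autocovariance, so the
  Karamata lemma is applied twice. The two summations produce the denominators
  \<open>1 - \<alpha>\<close> and \<open>2 - \<alpha>\<close> of \<open>kappa\<close>.\<close>

lemma var_sum_limit: "(\<lambda>n. var_sum n / real n powr (2 - \<alpha>)) \<longlonglongrightarrow> (kappa \<alpha>)\<^sup>2"
proof -
  have "(\<lambda>n. (\<Sum>k<n. autocov k) / real n powr (-\<alpha> + 1)) \<longlonglongrightarrow> beta_integral / (-\<alpha> + 1)"
    using \<alpha> by (intro sum_regularly_varying autocov_limit) auto
  then have "(\<lambda>n. (\<Sum>k<Suc n. autocov k) / real (Suc n) powr (1 - \<alpha>)) \<longlonglongrightarrow> beta_integral / (1 - \<alpha>)"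
    by (drule_tac LIMSEQ_Suc) (simp only: add.commute diff_conv_add_uminus)
  moreover have "(\<lambda>n. real (Suc n) powr (1 - \<alpha>) / real n powr (1 - \<alpha>)) \<longlonglongrightarrow> 1"
    by real_asymp
  ultimately have "(\<lambda>n. (\<Sum>k<Suc n. autocov k) / real (Suc n) powr (1 - \<alpha>) * (real (Suc n) powr (1 - \<alpha>) / real n powr (1 - \<alpha>)))
      \<longlonglongrightarrow> beta_integral / (1 - \<alpha>) * 1"
    by (rule tendsto_mult)
  then have 1: "(\<lambda>n. (\<Sum>k<Suc n. autocov k) / real n powr (1 - \<alpha>)) \<longlonglongrightarrow> beta_integral / (1 - \<alpha>)" by simp
  have "(\<lambda>n. autocov 0 / real n powr (1 - \<alpha>)) \<longlonglongrightarrow> 0"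
  proof -
    have "(\<lambda>n. 1 / real n powr (1 - \<alpha>)) \<longlonglongrightarrow> 0" using \<alpha> by real_asymp
    from tendsto_mult_right_zero[OF this, of "autocov 0"] show ?thesis by simp
  qed
  from tendsto_diff[OF tendsto_mult[OF tendsto_const[of 2] 1] this]
  have "(\<lambda>n. (var_sum (Suc n) - var_sum n) / real n powr (1 - \<alpha>)) \<longlonglongrightarrow> 2 * (beta_integral / (1 - \<alpha>)) - 0"
    unfolding var_sum_Suc by (simp add: diff_divide_distrib)
  then have "(\<lambda>n. (\<Sum>k<n. var_sum (Suc k) - var_sum k) / real n powr (1 - \<alpha> + 1)) \<longlonglongrightarrow> (2 * (beta_integral / (1 - \<alpha>)) - 0) / (1 - \<alpha> + 1)"
    using \<alpha> by (intro sum_regularly_varying) auto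
  also have "(\<lambda>n. (\<Sum>k<n. var_sum (Suc k) - var_sum k)) = var_sum"
  proof
    fix n
    have "(\<Sum>k<n. var_sum (Suc k) - var_sum k) = var_sum n - var_sum 0" by (rule sum_lessThan_telescope)
    then show "(\<Sum>k<n. var_sum (Suc k) - var_sum k) = var_sum n" by (simp add: var_sum_def[of 0])
  qed
  also have "(2 * (beta_integral / (1 - \<alpha>)) - 0) / (1 - \<alpha> + 1) = (kappa \<alpha>)\<^sup>2"
    using \<alpha> beta_integral_pos unfolding kappa_def beta_integral_def by (subst real_sqrt_pow2) auto
  finally show ?thesis by (simp add: add.commute)
qed

lemma kappa_pos: "kappa \<alpha> > 0"
  using \<alpha> beta_integral_pos unfolding kappa_def beta_integral_def by simp

lemma autocov_0_pos: "autocov 0 > 0"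
proof -
  have "eventually (\<lambda>k. \<psi> k / real k powr (-((1 + \<alpha>) / 2)) > 0) sequentially"
    using weights' by (rule order_tendstoD) simp
  then obtain k where k: "\<psi> k \<noteq> 0" by (auto simp: eventually_sequentially) (metis divide_eq_0_iff less_irrefl order_refl)
  have "0 < (\<psi> k)\<^sup>2" using k by simp
  also have "\<dots> \<le> autocov 0"
    unfolding autocov_def using summable_autocov[of 0] sum_le_suminf[of "\<lambda>k. \<psi> k * \<psi> (k + 0)" "{k}"]
    by (simp add: power2_eq_square)
  finally show ?thesis .
qed

lemma gaussian_eta: "gaussian M (\<eta> j) (autocov 0)"
  using gaussian_eta_combination[of "{j}" "\<lambda>_. 1"] by (simp add: cov_def)

end

text \<open>The indices on either side of \<open>j\<close> contribute at most
  \<open>\<Sum>k<m. (real k + 1) powr (-\<beta>)\<close> each, whence the factor 2.\<close>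

lemma sum_powr_dist_le:
  assumes \<beta>: "0 < \<beta>" "\<beta> < 1" and I: "I \<subseteq> {..<m}" and j: "j < m"
  shows "(\<Sum>i\<in>I. (real (if i \<le> j then j - i else i - j) + 1) powr (-\<beta>)) \<le> 2 / (1 - \<beta>) * real m powr (1 - \<beta>)"
proof -
  let ?g = "\<lambda>k. (real k + 1) powr (-\<beta>)"
  let ?f = "\<lambda>i. (real (if i \<le> j then j - i else i - j) + 1) powr (-\<beta>)"
  have "(\<Sum>i\<in>I. ?f i) \<le> (\<Sum>i<m. ?f i)" using I by (intro sum_mono2) auto
  also have "{..<m} = {..<Suc j} \<union> {j<..<m}" using j by auto
  also have "(\<Sum>i\<in>\<dots>. ?f i) = (\<Sum>i<Suc j. ?f i) + (\<Sum>i\<in>{j<..<m}. ?f i)"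
    by (rule sum.union_disjoint) auto
  also have "(\<Sum>i<Suc j. ?f i) = (\<Sum>k<Suc j. ?g k)"
    by (rule sum.reindex_bij_witness[where i="\<lambda>k. j - k" and j="\<lambda>i. j - i"]) auto
  also have "\<dots> \<le> (\<Sum>k<m. ?g k)" using j by (intro sum_mono2) auto
  also have "(\<Sum>i\<in>{j<..<m}. ?f i) = (\<Sum>k\<in>{0<..<m - j}. ?g k)"
    by (rule sum.reindex_bij_witness[where i="\<lambda>k. j + k" and j="\<lambda>i. i - j"]) auto
  also have "\<dots> \<le> (\<Sum>k<m. ?g k)" by (intro sum_mono2) auto
  finally have "(\<Sum>i\<in>I. ?f i) \<le> 2 * (\<Sum>k<m. ?g k)" by simp
  also have "\<dots> \<le> 2 * (real m powr (1 - \<beta>) / (1 - \<beta>))"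
    by (intro mult_left_mono sum_powr_neg_le \<beta>) auto
  finally show ?thesis by simp
qed

context gaussian_linear_process
begin

lemma gaussian_shifted_combination:
  assumes J: "finite J"
  shows "gaussian M (\<lambda>\<omega>. \<Sum>j\<in>J. a j * \<eta> (c + j) \<omega>) (\<Sum>j\<in>J. \<Sum>j'\<in>J. a j * a j' * cov j j')"
proof -
  have inj: "inj_on ((+) c) J" by (auto simp: inj_on_def)
  show ?thesis
    using gaussian_eta_combination[of "(+) c ` J" "\<lambda>k. a (k - c)"] J
    unfolding sum.reindex[OF inj] comp_def cov_shift by simp
qed

definition cov_form :: "nat set \<Rightarrow> (nat \<Rightarrow> real) \<Rightarrow> (nat \<Rightarrow> real) \<Rightarrow> real" where
  "cov_form J a b = (\<Sum>j\<in>J. \<Sum>j'\<in>J. a j * b j' * cov j j')"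

lemma gaussian_combination_pair:
  assumes J: "finite J"
  shows "gaussian M (\<lambda>\<omega>. s * (\<Sum>j\<in>J. a j * \<eta> (c + j) \<omega>) + t * (\<Sum>j\<in>J. b j * \<eta> (c + j) \<omega>))
    (s\<^sup>2 * cov_form J a a + t\<^sup>2 * cov_form J b b + 2 * s * t * cov_form J a b)"
proof -
  have sym: "cov_form J b a = cov_form J a b"
    unfolding cov_form_def by (subst sum.swap) (simp add: cov_sym mult_ac)
  have eq: "(\<Sum>j\<in>J. \<Sum>j'\<in>J. (s * a j + t * b j) * (s * a j' + t * b j') * cov j j')
     = s\<^sup>2 * cov_form J a a + t\<^sup>2 * cov_form J b b + s * t * cov_form J a b + s * t * cov_form J b a"
    unfolding cov_form_def sum_distrib_left sum.distrib[symmetric]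
    by (intro sum.cong refl) (simp add: power2_eq_square algebra_simps)
  have "(\<lambda>\<omega>. s * (\<Sum>j\<in>J. a j * \<eta> (c + j) \<omega>) + t * (\<Sum>j\<in>J. b j * \<eta> (c + j) \<omega>))
      = (\<lambda>\<omega>. \<Sum>j\<in>J. (s * a j + t * b j) * \<eta> (c + j) \<omega>)"
    by (auto simp: sum_distrib_left sum.distrib algebra_simps)
  then show ?thesis
    using gaussian_shifted_combination[OF J, of "\<lambda>j. s * a j + t * b j" c]
    unfolding eq sym by (simp add: algebra_simps)
qed

lemma gaussian_block: "gaussian M (\<lambda>\<omega>. \<Sum>i<n. \<eta> (c + i) \<omega>) (var_sum n)"
  using gaussian_shifted_combination[of "{..<n}" "\<lambda>_. 1" c] by (simp add: var_sum_def)

lemma var_sum_bound: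
  obtains C where "C > 0" "\<And>n. var_sum n \<le> C * real n powr (2 - \<alpha>)"
proof -
  have "Bseq (\<lambda>n. var_sum n / real n powr (2 - \<alpha>))"
    using var_sum_limit by (intro convergent_imp_Bseq) (auto simp: convergent_def)
  then obtain C where C: "C > 0" "\<And>n. \<bar>var_sum n / real n powr (2 - \<alpha>)\<bar> \<le> C"
    by (auto simp: Bseq_def)
  have "var_sum n \<le> C * real n powr (2 - \<alpha>)" for n
  proof (cases "n = 0")
    case False
    then show ?thesis using C(2)[of n] by (simp add: divide_simps abs_le_iff split: if_splits)
  qed (simp add: var_sum_def)
  then show ?thesis using C(1) that by blast
qed

lemma cov_decay:
  assumes C: "\<And>n. \<bar>autocov n\<bar> \<le> C * (real n + 1) powr (-\<alpha>)"
  shows "\<bar>cov i j\<bar> \<le> C * (real (if i \<le> j then j - i else i - j) + 1) powr (-\<alpha>)"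
  using C[of "j - i"] C[of "i - j"] by (auto simp: cov_def)

text \<open>Controls the covariance of one \<open>\<eta> j\<close> with a whole stretch of length
  \<open>m\<close>, at the order to which the autocovariances sum up.\<close>

lemma sum_cov_bound:
  obtains C where "C > 0" "\<And>I m j. I \<subseteq> {..<m} \<Longrightarrow> j < m \<Longrightarrow> (\<Sum>i\<in>I. \<bar>cov i j\<bar>) \<le> C * real m powr (1 - \<alpha>)"
proof -
  obtain C where C: "C > 0" "\<And>n. \<bar>autocov n\<bar> \<le> C * (real n + 1) powr (-\<alpha>)"
    using autocov_decay by blast
  have "(\<Sum>i\<in>I. \<bar>cov i j\<bar>) \<le> (C * (2 / (1 - \<alpha>))) * real m powr (1 - \<alpha>)"
    if I: "I \<subseteq> {..<m}" "j < m" for I m j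
  proof -
    have "(\<Sum>i\<in>I. \<bar>cov i j\<bar>) \<le> (\<Sum>i\<in>I. C * (real (if i \<le> j then j - i else i - j) + 1) powr (-\<alpha>))"
      by (intro sum_mono cov_decay C)
    also have "\<dots> \<le> C * (2 / (1 - \<alpha>) * real m powr (1 - \<alpha>))"
      unfolding sum_distrib_left[symmetric] using C(1)
      by (intro mult_left_mono sum_powr_dist_le \<alpha> that) auto
    finally show ?thesis by (simp add: mult.assoc)
  qed
  moreover have "C * (2 / (1 - \<alpha>)) > 0" using C \<alpha> by simp
  ultimately show ?thesis using that by blast
qed

end

section \<open>The subordinated sequence: linear part and remainder\<close>

locale subordinated_process = gaussian_linear_process M \<xi> \<psi> \<alpha>
  for M :: "'a measure" and \<xi> \<psi> \<alpha> +
  fixes G :: "real \<Rightarrow> real"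
  assumes G_measurable[measurable]: "G \<in> borel_measurable borel"
    and G_square: "integrable std_normal_distribution (\<lambda>x. (G x)\<^sup>2)"
begin

definition \<sigma> :: real where "\<sigma> = sqrt (autocov 0)"
definition \<eta>' :: "nat \<Rightarrow> 'a \<Rightarrow> real" where "\<eta>' j \<omega> = \<eta> j \<omega> / \<sigma>"
definition \<mu> :: real where "\<mu> = (LINT x|std_normal_distribution. G x)"
definition J1 :: real where "J1 = (LINT x|std_normal_distribution. x * G x)"
text \<open>The part of \<open>G\<close> orthogonal to 1 and \<open>x\<close> in the square
  integrable functions of the standard normal law, that is, of Hermite rank at least 2.\<close>

definition h :: "real \<Rightarrow> real" where "h x = G x - \<mu> - J1 * x"

lemma sigma_pos: "\<sigma> > 0" "\<sigma>\<^sup>2 = autocov 0"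
  using autocov_0_pos by (auto simp: \<sigma>_def)

lemma eta'_measurable[measurable]: "\<eta>' j \<in> borel_measurable M"
  unfolding \<eta>'_def[abs_def] by measurable

lemma h_measurable[measurable]: "h \<in> borel_measurable borel"
  unfolding h_def[abs_def] by measurable

lemma h_moments:
  shows "integrable std_normal_distribution (\<lambda>x. (h x)\<^sup>2)"
    and "(LINT x|std_normal_distribution. h x) = 0"
    and "(LINT x|std_normal_distribution. x * h x) = 0"
proof -
  interpret N: real_distribution std_normal_distribution by (rule real_dist_normal_dist)
  note m1 = std_normal_first_moment and m2 = std_normal_second_moment
  have G1: "integrable std_normal_distribution G"
    using integrable_mult_of_squares[of G std_normal_distribution "\<lambda>_. 1"] G_square by simp
  have xG: "integrable std_normal_distribution (\<lambda>x. x * G x)"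
    by (rule integrable_mult_of_squares) (use G_square m2 in auto)
  have sq: "(\<lambda>x. (h x)\<^sup>2) = (\<lambda>x. (G x)\<^sup>2 + \<mu>\<^sup>2 + J1\<^sup>2 * x\<^sup>2 - 2 * \<mu> * G x - 2 * J1 * (x * G x) + 2 * \<mu> * J1 * x)"
    by (auto simp: h_def power2_eq_square algebra_simps)
  show "integrable std_normal_distribution (\<lambda>x. (h x)\<^sup>2)"
    unfolding sq
    by (intro Bochner_Integration.integrable_add Bochner_Integration.integrable_diff integrable_mult_right
        G_square G1 xG m1 m2 N.integrable_const)
  have i: "integrable std_normal_distribution (\<lambda>x. J1 * x)" "integrable std_normal_distribution (\<lambda>x. G x - \<mu>)"
    by (intro Bochner_Integration.integrable_diff integrable_mult_right m1 G1 N.integrable_const)+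
  have "(LINT x|std_normal_distribution. h x) = (LINT x|std_normal_distribution. G x) - \<mu> - J1 * (LINT x|std_normal_distribution. x)"
    unfolding h_def Bochner_Integration.integral_diff[OF i(2,1)] Bochner_Integration.integral_diff[OF G1 N.integrable_const]
      integral_mult_right_zero
    by (simp only: Bochner_Integration.lebesgue_integral_const N.prob_space) simp
  then show "(LINT x|std_normal_distribution. h x) = 0" by (simp only: m1 \<mu>_def)
  have xh: "(\<lambda>x. x * h x) = (\<lambda>x. x * G x - \<mu> * x - J1 * x\<^sup>2)"
    by (auto simp: h_def power2_eq_square algebra_simps)
  have "(LINT x|std_normal_distribution. x * h x) = (LINT x|std_normal_distribution. x * G x) - \<mu> * (LINT x|std_normal_distribution. x) - J1 * (LINT x|std_normal_distribution. x\<^sup>2)"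
    unfolding xh
    by (subst Bochner_Integration.integral_diff, (intro Bochner_Integration.integrable_diff integrable_mult_right m1 m2 xG)+,
        subst Bochner_Integration.integral_diff, (intro integrable_mult_right m1 xG)+)
      (simp only: integral_mult_right_zero)
  then show "(LINT x|std_normal_distribution. x * h x) = 0" by (simp only: m1 m2 J1_def)
qed

lemma gaussian_eta'_pair:
  "gaussian M (\<lambda>\<omega>. s * \<eta>' i \<omega> + t * \<eta>' j \<omega>) (s\<^sup>2 + t\<^sup>2 + 2 * s * t * (cov i j / \<sigma>\<^sup>2))"
proof -
  let ?J = "{i, j}"
  have S: "(\<Sum>k\<in>?J. (if k = l then 1 else 0) * f k) = f l" if "l \<in> ?J" for l and f :: "nat \<Rightarrow> real"
  proof -
    have "(\<Sum>k\<in>?J. (if k = l then 1 else 0) * f k) = (\<Sum>k\<in>?J. if k = l then f k else 0)"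
      by (intro sum.cong) auto
    then show ?thesis using that by (simp add: sum.delta)
  qed
  have Q: "cov_form ?J (\<lambda>k. if k = l then 1 else 0) (\<lambda>k. if k = l' then 1 else 0) = cov l l'"
    if "l \<in> ?J" "l' \<in> ?J" for l l'
    unfolding cov_form_def mult.assoc sum_distrib_left[symmetric] using S[OF that(2)] S[OF that(1)] by simp
  have S': "(\<Sum>k\<in>?J. (if k = i then 1 else 0) * f k) = f i" "(\<Sum>k\<in>?J. (if k = j then 1 else 0) * f k) = f j" for f :: "nat \<Rightarrow> real"
    by (rule S, simp)+
  have Q': "cov_form ?J (\<lambda>k. if k = i then 1 else 0) (\<lambda>k. if k = i then 1 else 0) = cov i i"
    "cov_form ?J (\<lambda>k. if k = j then 1 else 0) (\<lambda>k. if k = j then 1 else 0) = cov j j"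
    "cov_form ?J (\<lambda>k. if k = i then 1 else 0) (\<lambda>k. if k = j then 1 else 0) = cov i j"
    by (rule Q, simp, simp)+
  have "gaussian M (\<lambda>\<omega>. (s / \<sigma>) * \<eta> i \<omega> + (t / \<sigma>) * \<eta> j \<omega>)
     ((s / \<sigma>)\<^sup>2 * cov i i + (t / \<sigma>)\<^sup>2 * cov j j + 2 * (s / \<sigma>) * (t / \<sigma>) * cov i j)"
    using gaussian_combination_pair[of ?J "s / \<sigma>" "\<lambda>k. if k = i then 1 else 0" 0 "t / \<sigma>" "\<lambda>k. if k = j then 1 else 0"]
    by (simp only: add_0 S' Q' finite.intros simp_thms)
  moreover have "(s / \<sigma>)\<^sup>2 * cov i i + (t / \<sigma>)\<^sup>2 * cov j j + 2 * (s / \<sigma>) * (t / \<sigma>) * cov i j = s\<^sup>2 + t\<^sup>2 + 2 * s * t * (cov i j / \<sigma>\<^sup>2)"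
    using sigma_pos autocov_0_pos by (simp add: cov_def power_divide) (simp add: power2_eq_square)
  ultimately show ?thesis by (simp add: \<eta>'_def)
qed

lemma gaussian_eta': "gaussian M (\<eta>' j) 1"
  using gaussian_eta'_pair[of 1 j 0 j] by simp

lemma h_square_integrable: "integrable M (\<lambda>\<omega>. (h (\<eta>' j \<omega>))\<^sup>2)"
  using gaussian_integrable_iff[OF gaussian_eta', of "\<lambda>x. (h x)\<^sup>2"] h_moments(1) by simp

lemma h_prod_integrable: "integrable M (\<lambda>\<omega>. h (\<eta>' i \<omega>) * h (\<eta>' j \<omega>))"
  by (rule integrable_mult_of_squares) (auto simp: h_square_integrable)

lemma h_block_square:
  "(\<lambda>\<omega>. (\<Sum>i<n. h (\<eta>' (c + i) \<omega>))\<^sup>2) = (\<lambda>\<omega>. \<Sum>i<n. \<Sum>j<n. h (\<eta>' (c + i) \<omega>) * h (\<eta>' (c + j) \<omega>))"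
  by (simp add: power2_eq_square sum_product)

lemma h_block_integrable: "integrable M (\<lambda>\<omega>. (\<Sum>i<n. h (\<eta>' (c + i) \<omega>))\<^sup>2)"
  unfolding h_block_square by (intro Bochner_Integration.integrable_sum h_prod_integrable)

text \<open>Covariances of the remainder are bounded by squared correlations, which decay like the
  lag to the power \<open>-2 * \<alpha>\<close>. The exponent is relaxed to some \<beta> < 1 because
  the maximal inequality needs \<open>2 - \<beta> > 1\<close>; if
  \<open>2 * \<alpha> \<ge> 1\<close>, the order \<open>n\<close> itself is approached but not
  reached.\<close>

lemma h_block_bound:
  assumes \<beta>: "0 < \<beta>" "\<beta> < 1" "\<beta> \<le> 2 * \<alpha>"
  obtains C where "C > 0"
    "\<And>c n. expectation (\<lambda>\<omega>. (\<Sum>i<n. h (\<eta>' (c + i) \<omega>))\<^sup>2) \<le> C * real n powr (2 - \<beta>)"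
proof -
  obtain C where C: "C > 0" "\<And>n. \<bar>autocov n\<bar> \<le> C * (real n + 1) powr (-\<alpha>)"
    using autocov_decay by blast
  define A where "A = (LINT x|std_normal_distribution. (h x)\<^sup>2)"
  have A: "A \<ge> 0" unfolding A_def by simp
  define B where "B = (A\<^sup>2 + 2 * A + 1) * (C / \<sigma>\<^sup>2)\<^sup>2"
  have B: "B > 0" unfolding B_def using A C sigma_pos by (intro mult_pos_pos add_nonneg_pos) auto
  let ?d = "\<lambda>i j. (real (if i \<le> j then j - i else i - j) + 1)"
  have hh: "\<bar>expectation (\<lambda>\<omega>. h (\<eta>' (c + i) \<omega>) * h (\<eta>' (c + j) \<omega>))\<bar> \<le> B * ?d i j powr (-\<beta>)" for c i j :: nat
  proof -
    have "\<bar>expectation (\<lambda>\<omega>. h (\<eta>' (c + i) \<omega>) * h (\<eta>' (c + j) \<omega>))\<bar> \<le> (A\<^sup>2 + 2 * A + 1) * (cov (c + i) (c + j) / \<sigma>\<^sup>2)\<^sup>2"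
      using h_moments by (intro gaussian_pair_covariance_bound gaussian_eta'_pair) (auto simp: A_def)
    also have "\<dots> \<le> (A\<^sup>2 + 2 * A + 1) * ((C / \<sigma>\<^sup>2) * ?d i j powr (-\<alpha>))\<^sup>2"
    proof (intro mult_left_mono)
      have "\<bar>cov i j / \<sigma>\<^sup>2\<bar> \<le> \<bar>(C / \<sigma>\<^sup>2) * ?d i j powr (-\<alpha>)\<bar>"
        using cov_decay[OF C(2), of i j] C(1) sigma_pos by (simp add: abs_divide abs_mult divide_right_mono)
      then show "(cov (c + i) (c + j) / \<sigma>\<^sup>2)\<^sup>2 \<le> ((C / \<sigma>\<^sup>2) * ?d i j powr (-\<alpha>))\<^sup>2"
        unfolding cov_shift abs_le_square_iff .
    qed (use A in auto)
    also have "\<dots> = B * (?d i j powr (-\<alpha>) * ?d i j powr (-\<alpha>))"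
      unfolding B_def power_mult_distrib by (simp only: power2_eq_square mult.assoc)
    also have "\<dots> = B * ?d i j powr (-\<alpha> + -\<alpha>)" by (simp only: powr_add)
    also have "\<dots> \<le> B * ?d i j powr (-\<beta>)"
      using B \<beta> by (intro mult_left_mono powr_mono) auto
    finally show ?thesis .
  qed
  have "expectation (\<lambda>\<omega>. (\<Sum>i<n. h (\<eta>' (c + i) \<omega>))\<^sup>2) \<le> (B * (2 / (1 - \<beta>))) * real n powr (2 - \<beta>)" for c n
  proof (cases "n = 0")
    case False
    have "expectation (\<lambda>\<omega>. (\<Sum>i<n. h (\<eta>' (c + i) \<omega>))\<^sup>2) = (\<Sum>j<n. \<Sum>i<n. expectation (\<lambda>\<omega>. h (\<eta>' (c + i) \<omega>) * h (\<eta>' (c + j) \<omega>)))"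
      unfolding h_block_square
      by (subst sum.swap) (simp add: Bochner_Integration.integral_sum h_prod_integrable Bochner_Integration.integrable_sum)
    also have "\<dots> \<le> (\<Sum>j<n. \<Sum>i<n. B * ?d i j powr (-\<beta>))"
      by (intro sum_mono order_trans[OF abs_ge_self hh])
    also have "\<dots> \<le> (\<Sum>j<n. B * (2 / (1 - \<beta>) * real n powr (1 - \<beta>)))"
    proof (intro sum_mono)
      fix j assume "j \<in> {..<n}"
      then show "(\<Sum>i<n. B * ?d i j powr (-\<beta>)) \<le> B * (2 / (1 - \<beta>) * real n powr (1 - \<beta>))"
        unfolding sum_distrib_left[symmetric] using B
        by (intro mult_left_mono sum_powr_dist_le \<beta>) auto
    qed
    also have "\<dots> = (B * (2 / (1 - \<beta>))) * (real n * real n powr (1 - \<beta>))" by simp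
    also have "real n * real n powr (1 - \<beta>) = real n powr (2 - \<beta>)"
      using False powr_add[of "real n" 1 "1 - \<beta>"] by simp
    finally show ?thesis .
  qed simp
  moreover have "B * (2 / (1 - \<beta>)) > 0" using B \<beta> by simp
  ultimately show ?thesis using that by blast
qed

definition X :: "nat \<Rightarrow> 'a \<Rightarrow> real" where "X i \<omega> = G (\<eta>' i \<omega>) - \<mu>"

lemma X_measurable[measurable]: "X i \<in> borel_measurable M"
  unfolding X_def[abs_def] by measurable

lemma sum_X_decomposition:
  "(\<Sum>i\<in>I. X (f i) \<omega>) = J1 / \<sigma> * (\<Sum>i\<in>I. \<eta> (f i) \<omega>) + (\<Sum>i\<in>I. h (\<eta>' (f i) \<omega>))"
  unfolding sum_distrib_left sum.distrib[symmetric]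
  by (intro sum.cong refl) (simp add: X_def h_def \<eta>'_def)

text \<open>Linear part and remainder are bounded separately; the choice \<beta> = \<alpha> for the
  remainder already gives the order of the linear part.\<close>

lemma X_block_bound:
  shows "integrable M (\<lambda>\<omega>. (\<Sum>i<n. X (c + i) \<omega>)\<^sup>2)"
    and "\<exists>C>0. \<forall>c n. expectation (\<lambda>\<omega>. (\<Sum>i<n. X (c + i) \<omega>)\<^sup>2) \<le> C * real n powr (2 - \<alpha>)"
proof -
  let ?Z = "\<lambda>c n \<omega>. \<Sum>i<n. \<eta> (c + i) \<omega>" and ?R = "\<lambda>c n \<omega>. \<Sum>i<n. h (\<eta>' (c + i) \<omega>)"
  have le: "(\<Sum>i<n. X (c + i) \<omega>)\<^sup>2 \<le> 2 * (J1 / \<sigma>)\<^sup>2 * (?Z c n \<omega>)\<^sup>2 + 2 * (?R c n \<omega>)\<^sup>2" for c n \<omega>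
  proof -
    have "(a + b)\<^sup>2 \<le> 2 * a\<^sup>2 + 2 * b\<^sup>2" for a b :: real
      using sum_squares_bound[of a b] by (simp add: power2_sum)
    from this[of "J1 / \<sigma> * ?Z c n \<omega>" "?R c n \<omega>"] show ?thesis
      by (simp only: sum_X_decomposition power_mult_distrib mult.assoc)
  qed
  have int: "integrable M (\<lambda>\<omega>. 2 * (J1 / \<sigma>)\<^sup>2 * (?Z c n \<omega>)\<^sup>2 + 2 * (?R c n \<omega>)\<^sup>2)" for c n
    using gaussian_second_moment(1)[OF gaussian_block] h_block_integrable
    by (intro Bochner_Integration.integrable_add integrable_mult_right) auto
  show Xint: "integrable M (\<lambda>\<omega>. (\<Sum>i<n. X (c + i) \<omega>)\<^sup>2)" for c n
    by (rule Bochner_Integration.integrable_bound[OF int[of c n]]) (auto intro!: AE_I2 le)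
  obtain C1 where C1: "C1 > 0" "\<And>n. var_sum n \<le> C1 * real n powr (2 - \<alpha>)"
    using var_sum_bound by blast
  obtain C2 where C2: "C2 > 0" "\<And>c n. expectation (\<lambda>\<omega>. (?R c n \<omega>)\<^sup>2) \<le> C2 * real n powr (2 - \<alpha>)"
    using h_block_bound[of \<alpha>] \<alpha> by auto
  show "\<exists>C>0. \<forall>c n. expectation (\<lambda>\<omega>. (\<Sum>i<n. X (c + i) \<omega>)\<^sup>2) \<le> C * real n powr (2 - \<alpha>)"
  proof (intro exI[of _ "2 * (J1 / \<sigma>)\<^sup>2 * C1 + 2 * C2"] conjI allI)
    show "0 < 2 * (J1 / \<sigma>)\<^sup>2 * C1 + 2 * C2" using C1(1) C2(1) by (intro add_nonneg_pos) auto
    fix c n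
    have "expectation (\<lambda>\<omega>. (\<Sum>i<n. X (c + i) \<omega>)\<^sup>2) \<le> expectation (\<lambda>\<omega>. 2 * (J1 / \<sigma>)\<^sup>2 * (?Z c n \<omega>)\<^sup>2 + 2 * (?R c n \<omega>)\<^sup>2)"
      by (intro integral_mono Xint int le)
    also have "\<dots> = 2 * (J1 / \<sigma>)\<^sup>2 * var_sum n + 2 * expectation (\<lambda>\<omega>. (?R c n \<omega>)\<^sup>2)"
      using gaussian_second_moment[OF gaussian_block] h_block_integrable by simp
    also have "\<dots> \<le> 2 * (J1 / \<sigma>)\<^sup>2 * (C1 * real n powr (2 - \<alpha>)) + 2 * (C2 * real n powr (2 - \<alpha>))"
      by (intro add_mono mult_left_mono C1 C2) auto
    finally show "expectation (\<lambda>\<omega>. (\<Sum>i<n. X (c + i) \<omega>)\<^sup>2) \<le> (2 * (J1 / \<sigma>)\<^sup>2 * C1 + 2 * C2) * real n powr (2 - \<alpha>)"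
      by (simp add: algebra_simps)
  qed
qed

end

section \<open>Inverting the partial sums\<close>

lemma partial_sum_eq: "partial_sum Y t \<omega> = (\<Sum>i<nat \<lfloor>t\<rfloor>. Y (Suc i) \<omega>)"
  unfolding partial_sum_def
  by (rule sum.reindex_bij_witness[where i=Suc and j="\<lambda>i. i - 1"]) auto

text \<open>Partial sums change only at integers, so the infimum over reals is attained at the least
  integer past the level. As the empty sum is 0 and \<open>0 \<le> t\<close>, that integer is at
  least 1.\<close>

lemma renewal_time_eq:
  assumes S: "S = (\<lambda>k. \<Sum>i<k. Y (Suc i) \<omega>)" and t: "0 \<le> t" and k: "t < S k"
  obtains N where "1 \<le> N" "N \<le> k" "S (N - 1) \<le> t" "t < S N" "renewal_time Y t \<omega> = ereal (real N)"
proof -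
  define N where "N = (LEAST k. t < S k)"
  have N: "t < S N" "N \<le> k" unfolding N_def using k by (auto intro: LeastI Least_le)
  have least: "N \<le> j" if "t < S j" for j unfolding N_def using that by (rule Least_le)
  have N1: "N \<ge> 1" using N t by (cases N) (auto simp: S)
  have prev: "S (N - 1) \<le> t" using least[of "N - 1"] N1 by fastforce
  have "renewal_time Y t \<omega> = ereal (real N)"
    unfolding renewal_time_def
  proof (rule antisym)
    show "Inf (ereal ` {s. 1 \<le> s \<and> t < partial_sum Y s \<omega>}) \<le> ereal (real N)"
      using N N1 by (intro Inf_lower imageI) (auto simp: partial_sum_eq S)
    show "ereal (real N) \<le> Inf (ereal ` {s. 1 \<le> s \<and> t < partial_sum Y s \<omega>})"
    proof (rule Inf_greatest)
      fix x assume "x \<in> ereal ` {s. 1 \<le> s \<and> t < partial_sum Y s \<omega>}"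
      then obtain s where s: "x = ereal s" "1 \<le> s" "t < S (nat \<lfloor>s\<rfloor>)" by (auto simp: partial_sum_eq S)
      have "real N \<le> real (nat \<lfloor>s\<rfloor>)" using least[OF s(3)] by simp
      also have "\<dots> \<le> s" using s(2) by simp
      finally show "ereal (real N) \<le> x" using s(1) by simp
    qed
  qed
  then show ?thesis using that N N1 prev by blast
qed

text \<open>If the centred walk crosses the level between \<open>N - 1\<close> and \<open>N\<close>, the Vervaat process is
  minus the increment of the centred walk over \<open>[T, N]\<close> up to the overshoot. Locating \<open>N\<close> near
  \<open>p = n - a Z n / \<mu>\<close> up to \<open>lag\<close> replaces \<open>N\<close> by \<open>p\<close> at the cost of the modulus of continuity.\<close>

lemma vervaat_process_approximation:
  fixes Y :: "nat \<Rightarrow> 'a \<Rightarrow> real" and Z R Sb :: "nat \<Rightarrow> real" and n w lag K :: nat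
  assumes \<mu>: "0 < \<mu>" and Sb: "\<And>k. Sb k = (\<Sum>i<k. Y (Suc i) \<omega> - \<mu>)"
    and dec: "\<And>k. Sb k = a * Z k + R k"
    and T: "0 \<le> T" "n = nat \<lfloor>T\<rfloor>"
    and B: "\<And>k. k \<le> K \<Longrightarrow> \<bar>Sb k\<bar> \<le> B"
    and B3: "\<And>k. k \<le> K \<Longrightarrow> \<bar>R k\<bar> \<le> B3"
    and win: "(B + B3) / \<mu> + 2 \<le> real w" "w \<le> n" "n + w \<le> K"
    and B2: "\<And>k. n - w \<le> k \<Longrightarrow> k \<le> n + w \<Longrightarrow> \<bar>Sb k - Sb n\<bar> \<le> B2"
    and B4: "\<And>k k'. n - w \<le> k \<Longrightarrow> k \<le> k' \<Longrightarrow> k' \<le> k + lag \<Longrightarrow> k' \<le> n + w \<Longrightarrow> \<bar>Sb k' - Sb k\<bar> \<le> B4"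
    and l: "(B2 + B3) / \<mu> + 4 \<le> real lag"
    and p: "p = nat \<lfloor>real n - a * Z n / \<mu>\<rfloor>"
  obtains q where "vervaat_process \<mu> Y T \<omega> = ereal q"
    "\<bar>q + a * (Z p - Z n)\<bar> \<le> \<mu> + B4 + 2 * B3"
    "n - w \<le> p" "p \<le> n + w" "\<bar>a * Z n\<bar> \<le> B + B3"
proof -
  define S where "S = (\<lambda>k. \<Sum>i<k. Y (Suc i) \<omega>)"
  have S: "S k = \<mu> * real k + Sb k" for k
    unfolding S_def Sb by (simp add: sum_subtractf)
  have nT: "real n \<le> T" "T < real n + 1" unfolding T(2) using T(1) by linarith+
  have B0: "0 \<le> B" "0 \<le> B3" using B[of 0] B3[of 0] by linarith+
  have Bw: "B / \<mu> + 2 \<le> real w" "B3 / \<mu> \<ge> 0" "B / \<mu> \<ge> 0"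
  proof -
    show "B3 / \<mu> \<ge> 0" "B / \<mu> \<ge> 0" using B0 \<mu> by simp_all
    then show "B / \<mu> + 2 \<le> real w" using win(1) unfolding add_divide_distrib by linarith
  qed
  have muw: "B + B3 + 2 * \<mu> \<le> \<mu> * real w" using win(1) \<mu> by (simp add: field_simps)
  define k0 where "k0 = n + w"
  have k0: "k0 \<le> K" using win by (simp add: k0_def)
  \<comment> \<open>At the right end of the window the drift has overcome every fluctuation, so
    passage occurs no later than \<open>n + w\<close>.\<close>
  have level: "\<mu> * T < S k0"
  proof -
    have "\<mu> * T < \<mu> * (real n + 1)" using nT \<mu> by simp
    also have "\<dots> \<le> \<mu> * (real n + real w) - B" using muw B0 \<mu> by (simp add: algebra_simps)
    also have "\<dots> \<le> S k0" using B[OF k0] by (simp add: S k0_def algebra_simps)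
    finally show ?thesis .
  qed
  have "0 \<le> \<mu> * T" using \<mu> T by simp
  from renewal_time_eq[where S=S and Y=Y and \<omega>=\<omega>, OF S_def this level]
  obtain N where N: "1 \<le> N" "N \<le> k0" "S (N - 1) \<le> \<mu> * T" "\<mu> * T < S N"
      "renewal_time Y (\<mu> * T) \<omega> = ereal (real N)"
    by blast
  have NK: "N \<le> K" "N - 1 \<le> K" using N k0 by auto
  have N1: "real (N - 1) = real N - 1" using N(1) by simp
  have lowN: "real n - B / \<mu> \<le> real N"
  proof -
    have "\<mu> * T \<le> \<mu> * real N + B" using N(4) B[OF NK(1)] by (simp add: S)
    then have "\<mu> * real n \<le> \<mu> * real N + B" using nT(1) \<mu> mult_left_mono[of "real n" T \<mu>] by linarith
    then show ?thesis using \<mu> by (simp add: field_simps)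
  qed
  have winN: "n - w \<le> N" "N \<le> n + w" "n - w \<le> N - 1" "N - 1 \<le> n + w"
  proof -
    have "real n - real w + 2 \<le> real N" using lowN Bw by linarith
    then show "n - w \<le> N" "n - w \<le> N - 1" by linarith+
    show "N \<le> n + w" "N - 1 \<le> n + w" using N(2) by (auto simp: k0_def)
  qed
  have aZ: "\<bar>a * Z n\<bar> \<le> B + B3" using B[of n] B3[of n] win dec[of n] by linarith
  have aZmu: "\<bar>a * Z n / \<mu>\<bar> \<le> (B + B3) / \<mu>" using aZ \<mu> by (simp add: abs_divide divide_right_mono)
  have nw: "real w \<le> real n" using win by simp
  have pos: "0 \<le> real n - a * Z n / \<mu>" using aZmu win nw by linarith
  have pr: "real p \<le> real n - a * Z n / \<mu>" "real n - a * Z n / \<mu> < real p + 1"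
    unfolding p using pos by linarith+
  have winp: "n - w \<le> p" "p \<le> n + w"
  proof -
    have "real n - real w \<le> real p" "real p \<le> real n + real w" using pr aZmu win by linarith+
    then show "n - w \<le> p" "p \<le> n + w" by linarith+
  qed
  \<comment> \<open>The jump at \<open>N\<close> has no bound of its own. The two sides of the
    passage therefore give one inequality with \<open>Sb N\<close> and one with
    \<open>Sb (N - 1)\<close>, and the modulus of continuity is applied to both indices.\<close>
  have muN: "\<mu> * real N > \<mu> * T - Sb N" using N(4) by (simp add: S)
  have muN1: "\<mu> * real N \<le> \<mu> * T + \<mu> - Sb (N - 1)" 
  proof -
    have "S (N - 1) = \<mu> * real N - \<mu> + Sb (N - 1)"
      using S[of "N - 1"] unfolding N1 by (simp only: right_diff_distrib mult_1_right)
    then show ?thesis using N(3) by linarith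
  qed
  have mup: "\<mu> * real p \<le> \<mu> * real n - a * Z n" "\<mu> * real n - a * Z n < \<mu> * real p + \<mu>"
    using pr \<mu> by (simp_all add: field_simps)
  have munT: "\<mu> * real n \<le> \<mu> * T" "\<mu> * T \<le> \<mu> * real n + \<mu>"
    using nT \<mu> mult_left_mono[of T "real n + 1" \<mu>] by (auto simp: algebra_simps)
  have Rn: "\<bar>R n\<bar> \<le> B3" using B3[of n] win by simp
  have D1: "\<bar>Sb N - Sb n\<bar> \<le> B2" "\<bar>Sb (N - 1) - Sb n\<bar> \<le> B2" using B2 winN by auto
  have mul: "B2 + B3 + 4 * \<mu> \<le> \<mu> * real lag" using l \<mu> by (simp add: field_simps)
  \<comment> \<open>Replacing \<open>Sb\<close> at the passage by
    \<open>Sb n = a * Z n + R n\<close> turns the passage equation into the linear one solved by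
    \<open>p\<close>; the replacement costs \<open>B2 + B3\<close> and a few units of
    rounding.\<close>
  have "\<mu> * real N - \<mu> * real p \<le> B2 + B3 + 3 * \<mu>"
    using muN1 mup(2) munT D1(2) Rn dec[of n] by linarith
  then have "\<mu> * real N \<le> \<mu> * (real p + real lag)" using mul \<mu> by (simp add: algebra_simps)
  then have Np: "N \<le> p + lag" using \<mu> by (simp only: mult_le_cancel_left_pos)
  have "\<mu> * real p - \<mu> * real N \<le> B2 + B3"
    using muN mup(1) munT D1(1) Rn dec[of n] by linarith
  then have "\<mu> * (real p + 1) \<le> \<mu> * (real N + real lag)" using mul \<mu> by (simp add: algebra_simps)
  \<comment> \<open>The extra 1 is needed for \<open>N - 1\<close>, which must also lie within
    \<open>lag\<close> of \<open>p\<close>.\<close>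
  then have pN: "p + 1 \<le> N + lag" using \<mu> by (simp only: mult_le_cancel_left_pos)
  have mod: "\<bar>Sb k - Sb p\<bar> \<le> B4" if "n - w \<le> k" "k \<le> n + w" "k \<le> p + lag" "p \<le> k + lag" for k
  proof (cases "k \<le> p")
    case True
    then show ?thesis using B4[of k p] that winp by (simp add: abs_minus_commute)
  next
    case False
    then show ?thesis using B4[of p k] that winp by simp
  qed
  have m1: "\<bar>Sb N - Sb p\<bar> \<le> B4" using mod[of N] winN Np pN by auto
  have m2: "\<bar>Sb (N - 1) - Sb p\<bar> \<le> B4" using mod[of "N - 1"] winN Np pN by auto
  define q where "q = S n + \<mu> * real N - 2 * \<mu> * T"
  have "vervaat_process \<mu> Y T \<omega> = ereal q"
    unfolding vervaat_process_def N(5) q_def by (simp add: partial_sum_eq S_def T(2))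
  moreover have "\<bar>q + a * (Z p - Z n)\<bar> \<le> \<mu> + B4 + 2 * B3"
  proof -
    have Rp: "\<bar>R p\<bar> \<le> B3" using B3[of p] winp win by simp
    have Dp: "Sb p - Sb n = a * (Z p - Z n) + (R p - R n)" by (simp add: dec algebra_simps)
    have "q \<le> \<mu> - (Sb (N - 1) - Sb n)" using muN1 munT by (simp add: q_def S algebra_simps)
    moreover have "q \<ge> - \<mu> - (Sb N - Sb n)" using muN munT by (simp add: q_def S algebra_simps)
    ultimately show ?thesis using m1 m2 Dp Rp Rn by linarith
  qed
  ultimately show ?thesis using that winp aZ by blast
qed

lemma eventually_powr_less:
  assumes "s < t"
  shows "eventually (\<lambda>n. C * real n powr s \<le> real n powr t) sequentially"
proof -
  have "(\<lambda>n. real n powr (s - t)) \<longlonglongrightarrow> 0" using assms by real_asymp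
  then have "(\<lambda>n. C * real n powr (s - t)) \<longlonglongrightarrow> C * 0" by (intro tendsto_intros)
  then have "eventually (\<lambda>n. C * real n powr (s - t) < 1) sequentially"
    by (rule order_tendstoD) simp
  then show ?thesis
    using eventually_gt_at_top[of 0]
  proof eventually_elim
    case (elim n)
    then show ?case by (simp add: powr_diff field_simps)
  qed
qed

lemma powr_neg_tendsto_0: "s < 0 \<Longrightarrow> (\<lambda>n. C * real n powr s) \<longlonglongrightarrow> 0"
proof -
  assume "s < 0"
  then have "(\<lambda>n. real n powr s) \<longlonglongrightarrow> 0" by real_asymp
  then show "(\<lambda>n. C * real n powr s) \<longlonglongrightarrow> 0" by (rule tendsto_mult_right_zero)
qed

section \<open>The limit law\<close>

lemma sum_indicator_filter:
  fixes f :: "'b \<Rightarrow> real"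
  assumes "finite J"
  shows "(\<Sum>j\<in>J. (if P j then 1 else 0) * f j) = (\<Sum>j\<in>{j\<in>J. P j}. f j)"
proof -
  have "(\<Sum>j\<in>J. (if P j then 1 else 0) * f j) = (\<Sum>j\<in>J. if P j then f j else 0)"
    by (intro sum.cong) auto
  then show ?thesis using sum.inter_filter[OF assms, of f P] by simp
qed

section \<open>Regression of Gaussian increments on the present value\<close>

context gaussian_linear_process
begin

definition Z :: "nat \<Rightarrow> 'a \<Rightarrow> real" where "Z k \<omega> = (\<Sum>i<k. \<eta> (Suc i) \<omega>)"

text \<open>The covariance of \<open>Z n\<close> with \<open>Z p - Z n\<close>. The difference of
  two indicators treats \<open>p < n\<close> and \<open>p \<ge> n\<close> uniformly, with the right
  sign.\<close>

definition regr_cov :: "nat \<Rightarrow> nat \<Rightarrow> real" where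
  "regr_cov n p = cov_form {..<n + p} (\<lambda>i. if i < n then 1 else 0)
     (\<lambda>i. (if i < p then 1 else 0) - (if i < n then 1 else 0))"

definition regr :: "nat \<Rightarrow> nat \<Rightarrow> real" where "regr n p = regr_cov n p / var_sum n"

text \<open>The increment from \<open>n\<close> to \<open>p\<close> minus its best linear prediction
  from \<open>Z n\<close>.\<close>

definition W :: "nat \<Rightarrow> nat \<Rightarrow> 'a \<Rightarrow> real" where
  "W n p \<omega> = Z p \<omega> - Z n \<omega> - regr n p * Z n \<omega>"

definition gap :: "nat \<Rightarrow> nat \<Rightarrow> nat" where "gap n p = (if n \<le> p then p - n else n - p)"

definition res_var :: "nat \<Rightarrow> nat \<Rightarrow> real" where
  "res_var n p = var_sum (gap n p) - (regr n p)\<^sup>2 * var_sum n"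

lemma Z_measurable[measurable]: "Z k \<in> borel_measurable M"
  unfolding Z_def[abs_def] by measurable

lemma W_measurable[measurable]: "W n p \<in> borel_measurable M"
  unfolding W_def[abs_def] by measurable

lemma cov_form_interval:
  assumes J: "finite J" "{lo..<hi} \<subseteq> J"
  shows "cov_form J (\<lambda>i. if lo \<le> i \<and> i < hi then 1 else 0) (\<lambda>i. if lo \<le> i \<and> i < hi then 1 else 0) = var_sum (hi - lo)"
proof -
  have f: "{j \<in> J. lo \<le> j \<and> j < hi} = {lo..<hi}" using J by auto
  have s: "(\<Sum>j\<in>{lo..<hi}. f j) = (\<Sum>i<hi - lo. f (lo + i))" for f :: "nat \<Rightarrow> real"
    by (rule sum.reindex_bij_witness[where i="\<lambda>i. lo + i" and j="\<lambda>i. i - lo"]) auto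
  show ?thesis
    unfolding cov_form_def mult.assoc sum_distrib_left[symmetric]
    unfolding sum_indicator_filter[OF J(1)] f s var_sum_def cov_shift ..
qed

lemma gaussian_Z_increment:
  "gaussian M (\<lambda>\<omega>. s * Z n \<omega> + t * (Z p \<omega> - Z n \<omega>))
     (s\<^sup>2 * var_sum n + t\<^sup>2 * var_sum (gap n p) + 2 * s * t * regr_cov n p)"
proof -
  let ?J = "{..<n + p}"
  let ?a = "\<lambda>i::nat. if i < n then 1 else 0 :: real"
  let ?b = "\<lambda>i::nat. (if i < p then 1 else 0) - (if i < n then 1 else 0) :: real"
  have f: "{j \<in> ?J. j < n} = {..<n}" "{j \<in> ?J. j < p} = {..<p}" by auto
  have Za: "(\<Sum>j\<in>?J. ?a j * \<eta> (1 + j) \<omega>) = Z n \<omega>" for \<omega>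
    unfolding sum_indicator_filter[OF finite_lessThan] f by (simp add: Z_def)
  have Zb: "(\<Sum>j\<in>?J. ?b j * \<eta> (1 + j) \<omega>) = Z p \<omega> - Z n \<omega>" for \<omega>
    unfolding left_diff_distrib sum_subtractf sum_indicator_filter[OF finite_lessThan] f by (simp add: Z_def)
  have Qa: "cov_form ?J ?a ?a = var_sum n"
  proof -
    have "{0..<n} \<subseteq> ?J" by auto
    from cov_form_interval[OF finite_lessThan this] show ?thesis by simp
  qed
  have Qb: "cov_form ?J ?b ?b = var_sum (gap n p)"
  proof (cases "n \<le> p")
    case True
    have "?b = (\<lambda>i. if n \<le> i \<and> i < p then 1 else 0)" using True by (auto simp: fun_eq_iff)
    moreover have "{n..<p} \<subseteq> ?J" by auto
    ultimately show ?thesis using cov_form_interval[OF finite_lessThan, of n p] True by (simp add: gap_def)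
  next
    case False
    have "?b = (\<lambda>i. - (if p \<le> i \<and> i < n then 1 else 0))" using False by (auto simp: fun_eq_iff)
    moreover have "cov_form J (\<lambda>i. - f i) (\<lambda>i. - f i) = cov_form J f f" for J f by (simp add: cov_form_def)
    moreover have "{p..<n} \<subseteq> ?J" by auto
    ultimately show ?thesis using cov_form_interval[OF finite_lessThan, of p n] False by (simp add: gap_def)
  qed
  show ?thesis
    using gaussian_combination_pair[of ?J s ?a 1 t ?b]
    unfolding Za Zb Qa Qb regr_cov_def by simp
qed

lemma gaussian_Z: "gaussian M (Z n) (var_sum n)"
  using gaussian_block[where c=1 and n=n] by (simp add: Z_def[abs_def])

context
  fixes n :: nat assumes v: "var_sum n > 0"
begin

text \<open>The coefficient \<open>regr\<close> is the one for which the cross term cancels; joint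
  normality then turns zero correlation into independence.\<close>

lemma gaussian_Z_W: "gaussian M (\<lambda>\<omega>. s * Z n \<omega> + t * W n p \<omega>) (s\<^sup>2 * var_sum n + t\<^sup>2 * res_var n p)"
proof -
  have "gaussian M (\<lambda>\<omega>. (s - t * regr n p) * Z n \<omega> + t * (Z p \<omega> - Z n \<omega>))
     ((s - t * regr n p)\<^sup>2 * var_sum n + t\<^sup>2 * var_sum (gap n p) + 2 * (s - t * regr n p) * t * regr_cov n p)"
    by (rule gaussian_Z_increment)
  moreover have "regr_cov n p = regr n p * var_sum n" using v by (simp add: regr_def)
  ultimately show ?thesis
    by (simp add: W_def res_var_def algebra_simps power2_eq_square)
qed

lemma indep_Z_W: "indep_var borel (Z n) borel (W n p)"
  by (rule gaussian_indep_var[OF gaussian_Z_W])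

lemma gaussian_W: "gaussian M (W n p) (res_var n p)"
  using gaussian_Z_W[of 0 1 p] by simp

text \<open>Only the pairwise independence of \<open>Z n\<close> and \<open>W n q\<close> is used: the random index is countably
  valued.\<close>

lemma prob_W_random_index:
  assumes r[measurable]: "r \<in> measurable borel (count_space UNIV)"
  shows "prob {\<omega>\<in>space M. a * W n (r (Z n \<omega>)) \<omega> \<le> c} =
    (LINT x|std_normal_distribution. prob {\<omega>\<in>space M. a * W n (r (sqrt (var_sum n) * x)) \<omega> \<le> c})"
proof -
  define F where "F q = prob {\<omega>\<in>space M. a * W n q \<omega> \<le> c}" for q
  define E where "E q = {\<omega>\<in>space M. r (Z n \<omega>) = q \<and> a * W n q \<omega> \<le> c}" for q
  have [measurable]: "E q \<in> sets M" for q unfolding E_def by measurable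
  have prob_E: "emeasure M (E q) = (\<integral>\<^sup>+\<omega>. ennreal (F q) * indicator {\<omega>\<in>space M. r (Z n \<omega>) = q} \<omega> \<partial>M)" for q
  proof -
    have "prob (E q) = prob (\<Inter>j\<in>UNIV. case_bool (Z n -` (r -` {q}) \<inter> space M) (W n q -` {x. a * x \<le> c} \<inter> space M) j)"
      by (intro arg_cong[where f=prob]) (auto simp: E_def UNIV_bool)
    also have "\<dots> = prob (Z n -` (r -` {q}) \<inter> space M) * prob (W n q -` {x. a * x \<le> c} \<inter> space M)"
    proof -
      have "r -` {q} \<in> sets borel" using measurable_sets[OF r, of "{q}"] by simp
      then have "prob ((Z n -` (r -` {q}) \<inter> space M) \<inter> (W n q -` {x. a * x \<le> c} \<inter> space M))
        = prob (Z n -` (r -` {q}) \<inter> space M) * prob (W n q -` {x. a * x \<le> c} \<inter> space M)"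
        using indep_varD[OF indep_Z_W, of "r -` {q}" "{x. a * x \<le> c}" q]
        by (simp add: vimage_def Int_def conj_ac)
      then show ?thesis by (simp add: UNIV_bool Int_commute)
    qed
    also have "W n q -` {x. a * x \<le> c} \<inter> space M = {\<omega>\<in>space M. a * W n q \<omega> \<le> c}" by auto
    also have "Z n -` (r -` {q}) \<inter> space M = {\<omega>\<in>space M. r (Z n \<omega>) = q}" by auto
    finally have "prob (E q) = prob {\<omega>\<in>space M. r (Z n \<omega>) = q} * F q" by (simp add: F_def)
    then show ?thesis
      by (subst nn_integral_cmult_indicator) (auto simp: emeasure_eq_measure ennreal_mult[symmetric] F_def mult.commute)
  qed
  have eq: "{\<omega>\<in>space M. a * W n (r (Z n \<omega>)) \<omega> \<le> c} = (\<Union>q. E q)" by (auto simp: E_def)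
  have "emeasure M (\<Union>q. E q) = (\<Sum>q. emeasure M (E q))"
    by (rule suminf_emeasure[symmetric]) (auto simp: disjoint_family_on_def E_def)
  also have "\<dots> = (\<integral>\<^sup>+\<omega>. (\<Sum>q. ennreal (F q) * indicator {\<omega>\<in>space M. r (Z n \<omega>) = q} \<omega>) \<partial>M)"
    unfolding prob_E by (rule nn_integral_suminf[symmetric]) measurable
  also have "\<dots> = (\<integral>\<^sup>+\<omega>. ennreal (F (r (Z n \<omega>))) \<partial>M)"
  proof (intro nn_integral_cong)
    fix \<omega> assume \<omega>: "\<omega> \<in> space M"
    have "(\<Sum>q. ennreal (F q) * indicator {\<omega>\<in>space M. r (Z n \<omega>) = q} \<omega>) = (\<Sum>q\<in>{r (Z n \<omega>)}. ennreal (F q) * indicator {\<omega>\<in>space M. r (Z n \<omega>) = q} \<omega>)"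
      by (rule suminf_finite) auto
    then show "(\<Sum>q. ennreal (F q) * indicator {\<omega>\<in>space M. r (Z n \<omega>) = q} \<omega>) = ennreal (F (r (Z n \<omega>)))"
      using \<omega> by simp
  qed
  also have "\<dots> = ennreal (expectation (\<lambda>\<omega>. F (r (Z n \<omega>))))"
    by (rule nn_integral_eq_integral)
      (auto intro!: integrable_const_bound[of _ 1] simp: F_def)
  finally have "prob {\<omega>\<in>space M. a * W n (r (Z n \<omega>)) \<omega> \<le> c} = expectation (\<lambda>\<omega>. F (r (Z n \<omega>)))"
    unfolding eq emeasure_eq_measure by (subst (asm) ennreal_inj) (auto intro!: integral_nonneg_AE simp: F_def)
  also have "\<dots> = (LINT x|std_normal_distribution. F (r (sqrt (var_sum n) * x)))"
    by (rule gaussian_expectation[OF gaussian_Z]) measurable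
  finally show ?thesis by (simp add: F_def)
qed

end

text \<open>Each of the \<open>gap n p\<close> summands of the increment has covariance of order at
  most \<open>n powr (1 - \<alpha>)\<close> with \<open>Z n\<close>; \<open>p \<le> 2 * n\<close>
  keeps all indices below \<open>3 * n\<close>. Divided by \<open>var_sum n\<close>, this makes the
  regression coefficient of order \<open>gap n p / n\<close>.\<close>

lemma regr_cov_bound:
  obtains C where "C > 0" "\<And>n p. p \<le> 2 * n \<Longrightarrow> \<bar>regr_cov n p\<bar> \<le> C * real (gap n p) * real n powr (1 - \<alpha>)"
proof -
  obtain C where C: "C > 0" "\<And>I m j. I \<subseteq> {..<m} \<Longrightarrow> j < m \<Longrightarrow> (\<Sum>i\<in>I. \<bar>cov i j\<bar>) \<le> C * real m powr (1 - \<alpha>)"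
    using sum_cov_bound by blast
  have "\<bar>regr_cov n p\<bar> \<le> (C * 3 powr (1 - \<alpha>)) * real (gap n p) * real n powr (1 - \<alpha>)" if p: "p \<le> 2 * n" for n p
  proof -
    let ?J = "{..<n + p}"
    let ?b = "\<lambda>i::nat. (if i < p then 1 else 0) - (if i < n then 1 else 0) :: real"
    have f: "{j \<in> ?J. j < n} = {..<n}" by auto
    have "regr_cov n p = (\<Sum>j'\<in>?J. ?b j' * (\<Sum>j\<in>?J. (if j < n then 1 else 0) * cov j j'))"
      unfolding regr_cov_def cov_form_def by (subst sum.swap) (simp only: sum_distrib_left mult_ac)
    also have "\<dots> = (\<Sum>j'\<in>?J. ?b j' * (\<Sum>j<n. cov j j'))"
      unfolding sum_indicator_filter[OF finite_lessThan] f ..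
    finally have "\<bar>regr_cov n p\<bar> \<le> (\<Sum>j'\<in>?J. \<bar>?b j' * (\<Sum>j<n. cov j j')\<bar>)"
      by (simp only: sum_abs)
    also have "\<dots> \<le> (\<Sum>j'\<in>?J. \<bar>?b j'\<bar> * (C * real (n + p) powr (1 - \<alpha>)))"
      unfolding abs_mult
      by (intro sum_mono mult_left_mono order_trans[OF sum_abs C(2)]) auto
    also have "\<dots> = (\<Sum>j'\<in>?J. \<bar>?b j'\<bar>) * (C * real (n + p) powr (1 - \<alpha>))"
      by (simp only: sum_distrib_right)
    also have "(\<Sum>j'\<in>?J. \<bar>?b j'\<bar>) = (\<Sum>j'\<in>?J. (if (n \<le> j' \<and> j' < p) \<or> (p \<le> j' \<and> j' < n) then 1 else 0) * 1)"
      by (intro sum.cong) auto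
    also have "\<dots> = real (gap n p)"
    proof -
      have "{j \<in> ?J. (n \<le> j \<and> j < p) \<or> (p \<le> j \<and> j < n)} = (if n \<le> p then {n..<p} else {p..<n})" by auto
      then show ?thesis unfolding sum_indicator_filter[OF finite_lessThan] by (simp add: gap_def)
    qed
    also have "real (gap n p) * (C * real (n + p) powr (1 - \<alpha>)) \<le> real (gap n p) * (C * (3 * real n) powr (1 - \<alpha>))"
      using p C(1) \<alpha> by (intro mult_left_mono powr_mono2) auto
    finally show ?thesis by (simp add: powr_mult mult_ac)
  qed
  moreover have "C * 3 powr (1 - \<alpha>) > 0" using C by simp
  ultimately show ?thesis using that by blast
qed

end

section \<open>Maximal bounds and modulus of continuity of the sums\<close>

context subordinated_process
begin

definition Sb :: "nat \<Rightarrow> 'a \<Rightarrow> real" where "Sb k \<omega> = (\<Sum>i<k. X (Suc i) \<omega>)"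
definition R :: "nat \<Rightarrow> 'a \<Rightarrow> real" where "R k \<omega> = (\<Sum>i<k. h (\<eta>' (Suc i) \<omega>))"

lemma Sb_measurable[measurable]: "Sb k \<in> borel_measurable M"
  unfolding Sb_def[abs_def] by measurable

lemma R_measurable[measurable]: "R k \<in> borel_measurable M"
  unfolding R_def[abs_def] by measurable

lemma Sb_decomposition: "Sb k \<omega> = J1 / \<sigma> * Z k \<omega> + R k \<omega>"
  unfolding Sb_def R_def Z_def by (rule sum_X_decomposition)

lemma Sb_add: "Sb (a + k) \<omega> - Sb a \<omega> = (\<Sum>i<k. X (Suc (a + i)) \<omega>)"
  unfolding Sb_def by (induction k) auto

lemma prob_Sb_increment:
  obtains C where "C > 0" "\<And>a m B. B > 0 \<Longrightarrow>
    prob {\<omega>\<in>space M. \<exists>j\<le>m. B \<le> \<bar>Sb (a + j) \<omega> - Sb a \<omega>\<bar>} \<le> C * real m powr (2 - \<alpha>) / B\<^sup>2"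
proof -
  obtain C where C: "C > 0" "\<And>c n. expectation (\<lambda>\<omega>. (\<Sum>i<n. X (c + i) \<omega>)\<^sup>2) \<le> C * real n powr (2 - \<alpha>)"
    using X_block_bound(2) by blast
  have "prob {\<omega>\<in>space M. \<exists>j\<le>m. B \<le> \<bar>Sb (a + j) \<omega> - Sb a \<omega>\<bar>} \<le> maximal_const (2 - \<alpha>) * C * real m powr (2 - \<alpha>) / B\<^sup>2"
    if "B > 0" for a m B
    unfolding Sb_add
  proof (rule prob_max_sum_ge[where X="\<lambda>i. X (Suc i)"])
    fix a n
    have e: "(\<lambda>\<omega>. (\<Sum>i<n. X (Suc (a + i)) \<omega>)\<^sup>2) = (\<lambda>\<omega>. (\<Sum>i<n. X (Suc a + i) \<omega>)\<^sup>2)" by simp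
    show "integrable M (\<lambda>\<omega>. (\<Sum>i<n. X (Suc (a + i)) \<omega>)\<^sup>2)"
      unfolding e by (rule X_block_bound(1))
    show "expectation (\<lambda>\<omega>. (\<Sum>i<n. X (Suc (a + i)) \<omega>)\<^sup>2) \<le> C * real n powr (2 - \<alpha>)"
      unfolding e by (rule C(2))
  qed (use C \<alpha> that in auto)
  moreover have "maximal_const (2 - \<alpha>) * C > 0" using C \<alpha> maximal_const_pos[of "2 - \<alpha>"] by simp
  ultimately show ?thesis using that by blast
qed

lemma prob_R_max:
  assumes \<beta>: "0 < \<beta>" "\<beta> < 1" "\<beta> \<le> 2 * \<alpha>"
  obtains C where "C > 0" "\<And>m B. B > 0 \<Longrightarrow>
    prob {\<omega>\<in>space M. \<exists>j\<le>m. B \<le> \<bar>R j \<omega>\<bar>} \<le> C * real m powr (2 - \<beta>) / B\<^sup>2"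
proof -
  obtain C where C: "C > 0" "\<And>c n. expectation (\<lambda>\<omega>. (\<Sum>i<n. h (\<eta>' (c + i) \<omega>))\<^sup>2) \<le> C * real n powr (2 - \<beta>)"
    using h_block_bound[OF \<beta>] by blast
  have "prob {\<omega>\<in>space M. \<exists>j\<le>m. B \<le> \<bar>\<Sum>i<j. h (\<eta>' (Suc (0 + i)) \<omega>)\<bar>} \<le> maximal_const (2 - \<beta>) * C * real m powr (2 - \<beta>) / B\<^sup>2"
    if "B > 0" for m B
  proof (rule prob_max_sum_ge[where X="\<lambda>i \<omega>. h (\<eta>' (Suc i) \<omega>)"])
    fix a n
    have e: "(\<lambda>\<omega>. (\<Sum>i<n. h (\<eta>' (Suc (a + i)) \<omega>))\<^sup>2) = (\<lambda>\<omega>. (\<Sum>i<n. h (\<eta>' (Suc a + i) \<omega>))\<^sup>2)" by simp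
    show "integrable M (\<lambda>\<omega>. (\<Sum>i<n. h (\<eta>' (Suc (a + i)) \<omega>))\<^sup>2)"
      unfolding e by (rule h_block_integrable)
    show "expectation (\<lambda>\<omega>. (\<Sum>i<n. h (\<eta>' (Suc (a + i)) \<omega>))\<^sup>2) \<le> C * real n powr (2 - \<beta>)"
      unfolding e by (rule C(2))
  qed (use C \<beta> that in auto)
  moreover have "maximal_const (2 - \<beta>) * C > 0" using C \<beta> maximal_const_pos[of "2 - \<beta>"] by simp
  ultimately show ?thesis using that unfolding R_def add_0 by blast
qed

text \<open>The window is cut into cells of length \<open>lag\<close>. Both indices of a close pair
  lie within \<open>2 * lag\<close> of the left end of the cell of \<open>k\<close>, so one of the
  two increments from that end reaches \<open>B / 2\<close>. A union bound over the cells
  finishes.\<close>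

lemma prob_Sb_modulus:
  obtains C where "C > 0" "\<And>s m lag B. B > 0 \<Longrightarrow> 0 < lag \<Longrightarrow>
    prob {\<omega>\<in>space M. \<exists>k k'. s \<le> k \<and> k \<le> k' \<and> k' \<le> k + lag \<and> k' \<le> s + m \<and> B < \<bar>Sb k' \<omega> - Sb k \<omega>\<bar>}
      \<le> C * (real m / real lag + 1) * real lag powr (2 - \<alpha>) / B\<^sup>2"
proof -
  obtain C where C: "C > 0" "\<And>a m B. B > 0 \<Longrightarrow>
    prob {\<omega>\<in>space M. \<exists>j\<le>m. B \<le> \<bar>Sb (a + j) \<omega> - Sb a \<omega>\<bar>} \<le> C * real m powr (2 - \<alpha>) / B\<^sup>2"
    using prob_Sb_increment by blast
  have "prob {\<omega>\<in>space M. \<exists>k k'. s \<le> k \<and> k \<le> k' \<and> k' \<le> k + lag \<and> k' \<le> s + m \<and> B < \<bar>Sb k' \<omega> - Sb k \<omega>\<bar>}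
      \<le> (C * 2 powr (2 - \<alpha>) * 4) * (real m / real lag + 1) * real lag powr (2 - \<alpha>) / B\<^sup>2"
    (is "prob ?E \<le> _") if B: "B > 0" and lag: "0 < lag" for s m lag :: nat and B :: real
  proof -
    define A where "A i = {\<omega>\<in>space M. \<exists>j\<le>2 * lag. B / 2 \<le> \<bar>Sb ((s + i * lag) + j) \<omega> - Sb (s + i * lag) \<omega>\<bar>}" for i
    have [measurable]: "A i \<in> sets M" for i unfolding A_def by measurable
    have "?E \<subseteq> (\<Union>i\<le>m div lag. A i)"
    proof
      fix \<omega> assume "\<omega> \<in> ?E"
      then obtain k k' where k: "\<omega> \<in> space M" "s \<le> k" "k \<le> k'" "k' \<le> k + lag" "k' \<le> s + m" "B < \<bar>Sb k' \<omega> - Sb k \<omega>\<bar>"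
        by auto
      define i where "i = (k - s) div lag"
      define j where "j = (k - s) mod lag"
      have kj: "k = (s + i * lag) + j" "j < lag" using k(2) lag by (auto simp: i_def j_def)
      define j' where "j' = j + (k' - k)"
      have kj': "k' = (s + i * lag) + j'" "j' \<le> 2 * lag" using kj k by (auto simp: j'_def)
      have "i \<le> m div lag" unfolding i_def using k by (intro div_le_mono) auto
      moreover have "\<omega> \<in> A i"
      proof (rule ccontr)
        assume "\<omega> \<notin> A i"
        then have *: "\<bar>Sb ((s + i * lag) + j) \<omega> - Sb (s + i * lag) \<omega>\<bar> < B / 2" if "j \<le> 2 * lag" for j
        proof -
          have "\<not> (\<exists>j\<le>2 * lag. B / 2 \<le> \<bar>Sb ((s + i * lag) + j) \<omega> - Sb (s + i * lag) \<omega>\<bar>)"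
            using \<open>\<omega> \<notin> A i\<close> k(1) by (simp add: A_def)
          then show ?thesis using that by (meson not_le)
        qed
        have "\<bar>Sb k \<omega> - Sb (s + i * lag) \<omega>\<bar> < B / 2" unfolding kj(1) by (rule *) (use kj(2) in simp)
        moreover have "\<bar>Sb k' \<omega> - Sb (s + i * lag) \<omega>\<bar> < B / 2" unfolding kj'(1) by (rule *) (use kj'(2) in simp)
        ultimately show False using k(6) by linarith
      qed
      ultimately show "\<omega> \<in> (\<Union>i\<le>m div lag. A i)" by auto
    qed
    then have "prob ?E \<le> prob (\<Union>i\<le>m div lag. A i)" by (intro finite_measure_mono) auto
    also have "\<dots> \<le> (\<Sum>i\<le>m div lag. prob (A i))" by (rule finite_measure_subadditive_finite) auto
    also have "\<dots> \<le> (\<Sum>i\<le>m div lag. C * real (2 * lag) powr (2 - \<alpha>) / (B / 2)\<^sup>2)"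
      unfolding A_def using B by (intro sum_mono C(2)) auto
    also have "\<dots> = real (m div lag + 1) * (C * real (2 * lag) powr (2 - \<alpha>) / (B / 2)\<^sup>2)" by simp
    also have "\<dots> \<le> (real m / real lag + 1) * (C * real (2 * lag) powr (2 - \<alpha>) / (B / 2)\<^sup>2)"
      using C(1) of_nat_div_le_of_nat[of m lag] by (intro mult_right_mono) auto
    also have "\<dots> = (C * 2 powr (2 - \<alpha>) * 4) * (real m / real lag + 1) * real lag powr (2 - \<alpha>) / B\<^sup>2"
      by (simp add: powr_mult power_divide)
    finally show ?thesis .
  qed
  moreover have "C * 2 powr (2 - \<alpha>) * 4 > 0" using C by simp
  ultimately show ?thesis using that by blast
qed

end

section \<open>Choice of scales and the exceptional event\<close>

locale vervaat_setting = subordinated_process M \<xi> \<psi> \<alpha> G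
  for M :: "'a measure" and \<xi> \<psi> \<alpha> G +
  assumes alpha_small: "\<alpha> < 2 - sqrt 2" and J1_nz: "J1 \<noteq> 0" and mu_pos: "\<mu> > 0"
begin

definition a :: real where "a = J1 / \<sigma>"
definition H :: real where "H = 1 - \<alpha> / 2"

lemma a_nz: "a \<noteq> 0" using J1_nz sigma_pos by (simp add: a_def)

lemma H_bounds: "1/2 < H" "H < 1" "1/2 < H\<^sup>2" "2 - \<alpha> = 2 * H" "1 - \<alpha> = 2 * H - 1"
proof -
  show "1/2 < H" "H < 1" "2 - \<alpha> = 2 * H" "1 - \<alpha> = 2 * H - 1" using \<alpha> by (auto simp: H_def)
  have "sqrt 2 / 2 < H" using alpha_small by (simp add: H_def field_simps)
  then have "(sqrt 2 / 2)\<^sup>2 < H\<^sup>2" by (intro power_strict_mono) auto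
  then show "1/2 < H\<^sup>2" by (simp add: power_divide)
qed

text \<open>The exponent \<open>H'\<close> governs the non-Gaussian remainder; \<open>H' < H\<^sup>2\<close> is possible exactly because
  \<open>\<alpha> < 2 - sqrt 2\<close>. The small \<open>\<theta>\<close> leaves room for Chebyshev bounds.\<close>

lemma exponents_exist:
  obtains H' \<theta> where "1/2 < H'" "H' < 1" "2 - 2 * H' \<le> 2 * \<alpha>" "0 < \<theta>" "H + 2 * \<theta> < 1"
    "8 * \<theta> < (1 - H) * (2 * H - 1)" "3 * \<theta> < (1 - H)\<^sup>2" "H' + \<theta> < H\<^sup>2"
proof -
  \<comment> \<open>The bound 1/2 keeps the variance exponent \<open>2 * H'\<close> of the remainder
    above 1, as the maximal inequality demands; \<open>2 * H - 1\<close> is the exponent that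
    squared correlations give for long memory. The midpoint to \<open>H^2\<close> leaves room on
    both sides.\<close>
  define H' where "H' = (max (1/2) (2 * H - 1) + H\<^sup>2) / 2"
  have sq: "(1 - H)\<^sup>2 > 0" using H_bounds by simp
  then have m: "2 * H - 1 < H\<^sup>2" by (simp add: power2_eq_square algebra_simps)
  have H2: "H\<^sup>2 < 1" using H_bounds by (simp add: power_strict_mono[of H 1 2, simplified])
  have "max (1/2) (2 * H - 1) < H\<^sup>2" "1/2 \<le> max (1/2) (2 * H - 1)" "2 * H - 1 \<le> max (1/2) (2 * H - 1)"
    using m H_bounds by auto
  moreover have "2 * H' = max (1/2) (2 * H - 1) + H\<^sup>2" by (simp add: H'_def)
  ultimately have H': "1/2 < H'" "2 * H - 1 < H'" "H' < H\<^sup>2" using H_bounds(3) by linarith+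
  define \<theta> where "\<theta> = min (min ((1 - H) / 4) ((1 - H) * (2 * H - 1) / 16)) (min ((1 - H)\<^sup>2 / 6) ((H\<^sup>2 - H') / 2))"
  have p: "0 < (1 - H) * (2 * H - 1)" using H_bounds by simp
  have \<theta>0: "0 < \<theta>" using H_bounds sq p H' by (auto simp: \<theta>_def)
  have "\<theta> \<le> (1 - H) / 4" "\<theta> \<le> (1 - H) * (2 * H - 1) / 16" "\<theta> \<le> (1 - H)\<^sup>2 / 6" "\<theta> \<le> (H\<^sup>2 - H') / 2"
    by (simp_all only: \<theta>_def min_le_iff_disj order_refl simp_thms)
  note th = this
  have "H + 2 * \<theta> < 1" using th(1) H_bounds(2) by (simp add: field_simps)
  moreover have "8 * \<theta> < (1 - H) * (2 * H - 1)" using th(2) p by (simp add: field_simps)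
  moreover have "6 * \<theta> \<le> (1 - H)\<^sup>2" using th(3) by (simp add: field_simps)
  then have "3 * \<theta> < (1 - H)\<^sup>2" using \<theta>0 by linarith
  moreover have "H' + \<theta> < H\<^sup>2" using th(4) H'(3) by (simp add: field_simps)
  moreover have "2 - 2 * H' \<le> 2 * \<alpha>" "H' < 1" using H' H2 H_bounds by linarith+
  ultimately show ?thesis using that H' \<theta>0 by blast
qed

text \<open>The first passage predicted from the Gaussian part alone: the integer part of the
  solution \<open>p\<close> of \<open>\<mu> * (n - p) = a * u\<close>.\<close>

definition crossing :: "nat \<Rightarrow> real \<Rightarrow> nat" where "crossing n u = nat \<lfloor>real n - a * u / \<mu>\<rfloor>"

definition Q :: "real \<Rightarrow> 'a \<Rightarrow> ereal" where
  "Q = vervaat_process \<mu> (\<lambda>j \<omega>. G (\<eta>' j \<omega>))"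

text \<open>Finiteness of \<open>Q\<close> at \<open>T\<close> is part of the assertion; the
  permitted error is small on the scale of the normalisation.\<close>

definition near_residual :: "real \<Rightarrow> nat \<Rightarrow> real \<Rightarrow> 'a \<Rightarrow> bool" where
  "near_residual \<epsilon> n T \<omega> \<longleftrightarrow>
     (\<exists>q. Q T \<omega> = ereal q \<and> \<bar>q + a * W n (crossing n (Z n \<omega>)) \<omega>\<bar> \<le> \<epsilon> * real n powr H\<^sup>2)"

text \<open>The coefficient is of order \<open>gap n p / n\<close>, so the product is of order
  \<open>n powr (s + t - 1)\<close>. The factor \<open>u\<close> is left general because it later
  stands both for \<open>a * Z n\<close> and for the standard deviation of
  \<open>Z n\<close>.\<close>

lemma regr_small:
  assumes st: "s + t < 1 + r"
  shows "eventually (\<lambda>n. \<forall>p u. p \<le> 2 * n \<longrightarrow> real (gap n p) \<le> real n powr s \<longrightarrow> \<bar>u\<bar> \<le> C * real n powr t \<longrightarrow>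
    \<bar>regr n p * u\<bar> \<le> real n powr r) sequentially"
proof -
  obtain D where D: "D > 0" "\<And>n p. p \<le> 2 * n \<Longrightarrow> \<bar>regr_cov n p\<bar> \<le> D * real (gap n p) * real n powr (1 - \<alpha>)"
    using regr_cov_bound by blast
  define k where "k = (kappa \<alpha>)\<^sup>2 / 2"
  have k: "k > 0" "k < (kappa \<alpha>)\<^sup>2" using kappa_pos by (auto simp: k_def)
  have "eventually (\<lambda>n. k < var_sum n / real n powr (2 - \<alpha>)) sequentially"
    using var_sum_limit k(2) by (rule order_tendstoD)
  moreover have "eventually (\<lambda>n. (D * \<bar>C\<bar> / k) * real n powr (s + t - 1) \<le> real n powr r) sequentially"
    using st by (intro eventually_powr_less) simp
  ultimately show ?thesis using eventually_gt_at_top[of 0]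
  proof eventually_elim
    fix n :: nat
    assume v: "k < var_sum n / real n powr (2 - \<alpha>)" and le: "(D * \<bar>C\<bar> / k) * real n powr (s + t - 1) \<le> real n powr r"
      and n: "0 < n"
    have v': "k * real n powr (2 - \<alpha>) < var_sum n" using v n by (simp add: field_simps)
    have vpos: "0 < k * real n powr (2 - \<alpha>)" using k n by simp
    show "\<forall>p u. p \<le> 2 * n \<longrightarrow> real (gap n p) \<le> real n powr s \<longrightarrow> \<bar>u\<bar> \<le> C * real n powr t \<longrightarrow>
      \<bar>regr n p * u\<bar> \<le> real n powr r"
    proof (intro allI impI)
      fix p u assume p: "p \<le> 2 * n" "real (gap n p) \<le> real n powr s" and u: "\<bar>u\<bar> \<le> C * real n powr t"
      have u': "\<bar>u\<bar> \<le> \<bar>C\<bar> * real n powr t" using u by (rule order_trans) (intro mult_right_mono, auto)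
      have "\<bar>regr_cov n p\<bar> \<le> D * real n powr s * real n powr (1 - \<alpha>)"
        by (rule order_trans[OF D(2)[OF p(1)]]) (use D(1) p(2) in \<open>intro mult_right_mono mult_left_mono, auto\<close>)
      then have "\<bar>regr n p\<bar> \<le> D * real n powr s * real n powr (1 - \<alpha>) / (k * real n powr (2 - \<alpha>))"
        unfolding regr_def abs_divide using v' vpos D(1) by (intro frac_le) auto
      then have "\<bar>regr n p * u\<bar> \<le> D * real n powr s * real n powr (1 - \<alpha>) / (k * real n powr (2 - \<alpha>)) * (\<bar>C\<bar> * real n powr t)"
        unfolding abs_mult using u' by (intro mult_mono) auto
      also have "\<dots> = (D * \<bar>C\<bar> / k) * (real n powr s * real n powr (1 - \<alpha>) * real n powr t / real n powr (2 - \<alpha>))"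
        by simp
      also have "real n powr s * real n powr (1 - \<alpha>) * real n powr t / real n powr (2 - \<alpha>) = real n powr (s + t - 1)"
        unfolding powr_add[symmetric] powr_diff[symmetric] by (simp add: algebra_simps)
      finally show "\<bar>regr n p * u\<bar> \<le> real n powr r" using le by linarith
    qed
  qed
qed

text \<open>Four things may go wrong: the centred sums are too large up to \<open>2 * n\<close>,
  they oscillate too much on the window around \<open>n\<close>, the remainder is too large, or the
  sums vary too much over the lag. Outside these events the deterministic approximation applies for
  every \<open>T\<close> with integer part \<open>n\<close> simultaneously.\<close>

lemma good_event:
  obtains bad :: "nat \<Rightarrow> 'a set" where "\<And>n. bad n \<in> sets M" "(\<lambda>n. prob (bad n)) \<longlonglongrightarrow> 0"
    "\<And>\<epsilon>. \<epsilon> > 0 \<Longrightarrow> eventually (\<lambda>n. \<forall>T \<omega>. 0 \<le> T \<longrightarrow> nat \<lfloor>T\<rfloor> = n \<longrightarrow> \<omega> \<in> space M - bad n \<longrightarrow>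
      near_residual \<epsilon> n T \<omega>) sequentially"
proof -
  obtain H' \<theta> where e: "1/2 < H'" "H' < 1" "2 - 2 * H' \<le> 2 * \<alpha>" "0 < \<theta>" "H + 2 * \<theta> < 1"
    "8 * \<theta> < (1 - H) * (2 * H - 1)" "3 * \<theta> < (1 - H)\<^sup>2" "H' + \<theta> < H\<^sup>2"
    by (rule exponents_exist)
  note Hb = H_bounds
  have HH: "H\<^sup>2 < H" using Hb by (simp add: power2_eq_square)
  have sq: "(1 - H)\<^sup>2 = 1 - 2 * H + H\<^sup>2" by (simp add: power2_eq_square algebra_simps)
  have Ht: "H * \<theta> < \<theta>" "0 < H * \<theta>" using Hb e by auto
  \<comment> \<open>Up to \<theta>, the negative of the exponent for the fourth event: about
    \<open>n powr (H - H^2)\<close> cells, variance \<open>n powr (2 * H * H^2)\<close> over a lag,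
    and squared threshold \<open>n powr (2 * H^2)\<close>. It is positive because
    \<open>1/2 < H\<close> and \<open>H < 1\<close>.\<close>
  have cube: "H * ((1 - H) * (2 * H - 1)) = 3 * H\<^sup>2 - H - 2 * H * H\<^sup>2" by (simp add: power2_eq_square algebra_simps)
  have pe: "H + 2 * \<theta> > H\<^sup>2 + 4 * \<theta>"
  proof -
    have "(1 - H) * (2 * H - 1) \<le> (1 - H) * H" using Hb by (intro mult_left_mono) auto
    then have "8 * \<theta> < H - H\<^sup>2" using e(6) by (simp add: power2_eq_square algebra_simps)
    then show ?thesis using e(4) by simp
  qed
  obtain C1 where C1: "C1 > 0" "\<And>a m B. B > 0 \<Longrightarrow>
    prob {\<omega>\<in>space M. \<exists>j\<le>m. B \<le> \<bar>Sb (a + j) \<omega> - Sb a \<omega>\<bar>} \<le> C1 * real m powr (2 * H) / B\<^sup>2"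
    using prob_Sb_increment unfolding Hb(4) by blast
  have \<beta>: "0 < 2 - 2 * H'" "2 - 2 * H' < 1" using e by auto
  have \<beta>': "2 - (2 - 2 * H') = 2 * H'" by simp
  obtain C3 where C3: "C3 > 0" "\<And>m B. B > 0 \<Longrightarrow>
    prob {\<omega>\<in>space M. \<exists>j\<le>m. B \<le> \<bar>R j \<omega>\<bar>} \<le> C3 * real m powr (2 * H') / B\<^sup>2"
    using prob_R_max[OF \<beta> e(3)] unfolding \<beta>' by blast
  obtain C4 where C4: "C4 > 0" "\<And>s m lag B. B > 0 \<Longrightarrow> 0 < lag \<Longrightarrow>
    prob {\<omega>\<in>space M. \<exists>k k'. s \<le> k \<and> k \<le> k' \<and> k' \<le> k + lag \<and> k' \<le> s + m \<and> B < \<bar>Sb k' \<omega> - Sb k \<omega>\<bar>}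
      \<le> C4 * (real m / real lag + 1) * real lag powr (2 * H) / B\<^sup>2"
    using prob_Sb_modulus unfolding Hb(4) by blast
  \<comment> \<open>Each scale dominates what the preceding ones require: \<open>B\<close> exceeds
    the size \<open>n powr H\<close> of the sums, \<open>w\<close> exceeds \<open>B / \<mu>\<close>,
    \<open>B2\<close> exceeds the natural oscillation \<open>w powr H\<close>, and
    \<open>lag\<close> exceeds \<open>B2 / \<mu>\<close>. \<open>B4\<close> must stay below
    \<open>n powr H^2\<close>, which is possible since \<open>lag powr H\<close> is of smaller
    order.\<close>
  define B where "B n = real n powr (H + \<theta>)" for n
  define w where "w n = nat \<lfloor>real n powr (H + 2 * \<theta>)\<rfloor>" for n
  define B2 where "B2 n = real n powr (H\<^sup>2 + 3 * \<theta>)" for n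
  define lag where "lag n = nat \<lfloor>real n powr (H\<^sup>2 + 4 * \<theta>)\<rfloor>" for n
  define B4 where "B4 n = real n powr (H\<^sup>2 - \<theta>)" for n
  define B3 where "B3 n = real n powr (H' + \<theta>)" for n
  define E1 where "E1 n = {\<omega>\<in>space M. \<exists>j\<le>2 * n. B n \<le> \<bar>Sb (0 + j) \<omega> - Sb 0 \<omega>\<bar>}" for n
  \<comment> \<open>Increments are measured from the left end of the window; the halved threshold
    pays for moving the reference point to \<open>n\<close>.\<close>
  define E2 where "E2 n = {\<omega>\<in>space M. \<exists>j\<le>2 * w n. B2 n / 2 \<le> \<bar>Sb ((n - w n) + j) \<omega> - Sb (n - w n) \<omega>\<bar>}" for n
  define E3 where "E3 n = {\<omega>\<in>space M. \<exists>j\<le>2 * n. B3 n \<le> \<bar>R j \<omega>\<bar>}" for n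
  define E4 where "E4 n = {\<omega>\<in>space M. \<exists>k k'. n - w n \<le> k \<and> k \<le> k' \<and> k' \<le> k + lag n \<and> k' \<le> (n - w n) + 2 * w n \<and> B4 n < \<bar>Sb k' \<omega> - Sb k \<omega>\<bar>}" for n
  \<comment> \<open>Midpoint between the exponent \<open>2 * H - 1 + 3 * \<theta>\<close> of the
    regression term and \<open>H^2\<close>.\<close>
  define r where "r = (2 * H - 1 + 3 * \<theta> + H\<^sup>2) / 2"
  have r: "H + 2 * \<theta> + (H + \<theta>) < 1 + r" "r < H\<^sup>2" 
  proof -
    have "2 * r = 2 * H - 1 + 3 * \<theta> + H\<^sup>2" by (simp add: r_def)
    then show "H + 2 * \<theta> + (H + \<theta>) < 1 + r" "r < H\<^sup>2" using e(7) sq by linarith+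
  qed
  define bad where "bad n = E1 n \<union> E2 n \<union> E3 n \<union> E4 n" for n
  have [measurable]: "E1 n \<in> sets M" "E2 n \<in> sets M" "E3 n \<in> sets M" "E4 n \<in> sets M" for n
    unfolding E1_def E2_def E3_def E4_def by measurable
  have floor_le: "real (w n) \<le> real n powr (H + 2 * \<theta>)" "real (lag n) \<le> real n powr (H\<^sup>2 + 4 * \<theta>)" for n
    unfolding w_def lag_def by (simp_all add: of_nat_nat)
  have floor_ge: "real n powr (H + 2 * \<theta>) - 1 \<le> real (w n)" "real n powr (H\<^sup>2 + 4 * \<theta>) - 1 \<le> real (lag n)" for n
    unfolding w_def lag_def by linarith+
  have sqp: "(real n powr x)\<^sup>2 = real n powr (2 * x)" for n x
    by (simp add: power2_eq_square powr_add[symmetric])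
  have P1: "prob (E1 n) \<le> (C1 * 2 powr (2 * H)) * real n powr (- (2 * \<theta>))" if n: "n > 0" for n
  proof -
    have "prob (E1 n) \<le> C1 * real (2 * n) powr (2 * H) / (B n)\<^sup>2"
      unfolding E1_def using n by (intro C1(2)) (simp add: B_def)
    also have "\<dots> = (C1 * 2 powr (2 * H)) * (real n powr (2 * H) / real n powr (2 * (H + \<theta>)))"
      unfolding B_def sqp by (simp add: powr_mult)
    also have "real n powr (2 * H) / real n powr (2 * (H + \<theta>)) = real n powr (- (2 * \<theta>))"
      unfolding powr_diff[symmetric] by (simp add: algebra_simps)
    finally show ?thesis .
  qed
  have P2: "prob (E2 n) \<le> (C1 * 2 powr (2 * H) * 4) * real n powr (4 * (H * \<theta>) - 6 * \<theta>)" if n: "n > 0" for n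
  proof -
    have "prob (E2 n) \<le> C1 * real (2 * w n) powr (2 * H) / (B2 n / 2)\<^sup>2"
      unfolding E2_def using n by (intro C1(2)) (simp add: B2_def)
    also have "\<dots> \<le> C1 * (2 * real n powr (H + 2 * \<theta>)) powr (2 * H) / (B2 n / 2)\<^sup>2"
      using C1(1) floor_le(1)[of n] Hb by (intro divide_right_mono mult_left_mono powr_mono2) auto
    also have "\<dots> = (C1 * 2 powr (2 * H) * 4) * (real n powr ((H + 2 * \<theta>) * (2 * H)) / real n powr (2 * (H\<^sup>2 + 3 * \<theta>)))"
      unfolding B2_def power_divide sqp by (simp add: powr_mult powr_powr)
    also have "real n powr ((H + 2 * \<theta>) * (2 * H)) / real n powr (2 * (H\<^sup>2 + 3 * \<theta>)) = real n powr (4 * (H * \<theta>) - 6 * \<theta>)"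
      unfolding powr_diff[symmetric] by (simp add: algebra_simps power2_eq_square)
    finally show ?thesis .
  qed
  have P3: "prob (E3 n) \<le> (C3 * 2 powr (2 * H')) * real n powr (- (2 * \<theta>))" if n: "n > 0" for n
  proof -
    have "prob (E3 n) \<le> C3 * real (2 * n) powr (2 * H') / (B3 n)\<^sup>2"
      unfolding E3_def using n by (intro C3(2)) (simp add: B3_def)
    also have "\<dots> = (C3 * 2 powr (2 * H')) * (real n powr (2 * H') / real n powr (2 * (H' + \<theta>)))"
      unfolding B3_def sqp by (simp add: powr_mult)
    also have "real n powr (2 * H') / real n powr (2 * (H' + \<theta>)) = real n powr (- (2 * \<theta>))"
      unfolding powr_diff[symmetric] by (simp add: algebra_simps)
    finally show ?thesis .
  qed
  \<comment> \<open>From this size on, rounding \<open>lag\<close> down costs at most a factor 2 and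
    leaves it positive.\<close>
  have ev_lag: "eventually (\<lambda>n. 2 \<le> real n powr (H\<^sup>2 + 4 * \<theta>)) sequentially"
  proof -
    have "eventually (\<lambda>n. 2 * real n powr 0 \<le> real n powr (H\<^sup>2 + 4 * \<theta>)) sequentially"
      using e(4) by (intro eventually_powr_less) (auto intro!: add_nonneg_pos)
    then show ?thesis using eventually_gt_at_top[of 0] by eventually_elim simp
  qed
  have P4: "eventually (\<lambda>n. prob (E4 n) \<le> (5 * C4) * real n powr (H - 3 * H\<^sup>2 + 2 * H * H\<^sup>2 + 8 * (H * \<theta>))) sequentially"
    using ev_lag eventually_gt_at_top[of 0]
  proof eventually_elim
    fix n :: nat assume l2: "2 \<le> real n powr (H\<^sup>2 + 4 * \<theta>)" and n: "0 < n"
    have lg: "real n powr (H\<^sup>2 + 4 * \<theta>) / 2 \<le> real (lag n)" using l2 floor_ge(2)[of n] by linarith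
    then have lag0: "0 < lag n" using l2 by linarith
    have "real (2 * w n) / real (lag n) + 1 \<le> (2 * real n powr (H + 2 * \<theta>)) / (real n powr (H\<^sup>2 + 4 * \<theta>) / 2) + 1"
      using lg l2 n floor_le(1)[of n] by (intro add_right_mono frac_le) auto
    also have "\<dots> = 4 * (real n powr (H + 2 * \<theta>) / real n powr (H\<^sup>2 + 4 * \<theta>)) + 1" by simp
    also have "real n powr (H + 2 * \<theta>) / real n powr (H\<^sup>2 + 4 * \<theta>) = real n powr (H - H\<^sup>2 - 2 * \<theta>)"
      unfolding powr_diff[symmetric] by (simp add: algebra_simps)
    also have "1 \<le> real n powr (H - H\<^sup>2 - 2 * \<theta>)"
      using n pe by (intro ge_one_powr_ge_zero) auto
    finally have cnt: "real (2 * w n) / real (lag n) + 1 \<le> 5 * real n powr (H - H\<^sup>2 - 2 * \<theta>)" by simp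
    have "prob (E4 n) \<le> C4 * (real (2 * w n) / real (lag n) + 1) * real (lag n) powr (2 * H) / (B4 n)\<^sup>2"
      unfolding E4_def using n lag0 by (intro C4(2)) (simp_all add: B4_def)
    also have "\<dots> \<le> C4 * (5 * real n powr (H - H\<^sup>2 - 2 * \<theta>)) * (real n powr (H\<^sup>2 + 4 * \<theta>)) powr (2 * H) / (B4 n)\<^sup>2"
      using C4(1) cnt floor_le(2)[of n] Hb by (intro divide_right_mono mult_mono mult_left_mono powr_mono2) auto
    also have "\<dots> = (5 * C4) * (real n powr (H - H\<^sup>2 - 2 * \<theta>) * real n powr ((H\<^sup>2 + 4 * \<theta>) * (2 * H)) / real n powr (2 * (H\<^sup>2 - \<theta>)))"
      unfolding B4_def sqp by (simp add: powr_powr)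
    also have "real n powr (H - H\<^sup>2 - 2 * \<theta>) * real n powr ((H\<^sup>2 + 4 * \<theta>) * (2 * H)) / real n powr (2 * (H\<^sup>2 - \<theta>))
      = real n powr (H - 3 * H\<^sup>2 + 2 * H * H\<^sup>2 + 8 * (H * \<theta>))"
      unfolding powr_diff[symmetric] powr_add[symmetric] by (simp add: algebra_simps)
    finally show "prob (E4 n) \<le> (5 * C4) * real n powr (H - 3 * H\<^sup>2 + 2 * H * H\<^sup>2 + 8 * (H * \<theta>))" .
  qed
  have e10: "8 * (H * \<theta>) < H * ((1 - H) * (2 * H - 1))"
  proof -
    have "H * (8 * \<theta>) < H * ((1 - H) * (2 * H - 1))" using Hb e(6) by (intro mult_strict_left_mono) auto
    then show ?thesis by (simp only: mult_ac)
  qed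
  have bad_lim: "(\<lambda>n. prob (bad n)) \<longlonglongrightarrow> 0"
  proof (rule tendsto_sandwich[OF _ _ tendsto_const])
    let ?u = "\<lambda>n. (C1 * 2 powr (2 * H)) * real n powr (- (2 * \<theta>)) + (C1 * 2 powr (2 * H) * 4) * real n powr (4 * (H * \<theta>) - 6 * \<theta>)
      + (C3 * 2 powr (2 * H')) * real n powr (- (2 * \<theta>)) + (5 * C4) * real n powr (H - 3 * H\<^sup>2 + 2 * H * H\<^sup>2 + 8 * (H * \<theta>))"
    show "eventually (\<lambda>n. 0 \<le> prob (bad n)) sequentially" by simp
    show "eventually (\<lambda>n. prob (bad n) \<le> ?u n) sequentially"
      using P4 eventually_gt_at_top[of 0]
    proof eventually_elim
      fix n :: nat assume p4: "prob (E4 n) \<le> (5 * C4) * real n powr (H - 3 * H\<^sup>2 + 2 * H * H\<^sup>2 + 8 * (H * \<theta>))" and n: "0 < n"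
      have "prob (bad n) \<le> prob (E1 n \<union> E2 n \<union> E3 n) + prob (E4 n)"
        unfolding bad_def by (rule measure_Un_le) auto
      also have "prob (E1 n \<union> E2 n \<union> E3 n) \<le> prob (E1 n \<union> E2 n) + prob (E3 n)"
        by (rule measure_Un_le) auto
      also have "prob (E1 n \<union> E2 n) \<le> prob (E1 n) + prob (E2 n)"
        by (rule measure_Un_le) auto
      finally show "prob (bad n) \<le> ?u n" using p4 P1[OF n] P2[OF n] P3[OF n] by linarith
    qed
    have "- (2 * \<theta>) < 0" "4 * (H * \<theta>) - 6 * \<theta> < 0" "H - 3 * H\<^sup>2 + 2 * H * H\<^sup>2 + 8 * (H * \<theta>) < 0"
      using e(4) Ht e10 cube by linarith+
    then have "?u \<longlonglongrightarrow> 0 + 0 + 0 + 0" by (intro tendsto_add powr_neg_tendsto_0)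
    then show "?u \<longlonglongrightarrow> 0" by simp
  qed
  have approx: "eventually (\<lambda>n. \<forall>T \<omega>. 0 \<le> T \<longrightarrow> nat \<lfloor>T\<rfloor> = n \<longrightarrow> \<omega> \<in> space M - bad n \<longrightarrow>
      near_residual \<epsilon> n T \<omega>) sequentially" if \<epsilon>: "\<epsilon> > 0" for \<epsilon>
  proof -
    \<comment> \<open>The window and the lag are each divided into thirds, for \<open>B\<close> or
      \<open>B2\<close>, for \<open>B3\<close>, and for the constants: 9 is three times
      \<open>2 + 1\<close>, and 15 three times \<open>4 + 1\<close>, the 1 being lost in the floor.
      The allowed error is divided into quarters, with 8 for \<open>B3\<close> because it occurs
      twice.\<close>
    have "eventually (\<lambda>n. (3 / \<mu>) * real n powr (H + \<theta>) \<le> real n powr (H + 2 * \<theta>)) sequentially"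
      "eventually (\<lambda>n. (3 / \<mu>) * real n powr (H' + \<theta>) \<le> real n powr (H + 2 * \<theta>)) sequentially"
      "eventually (\<lambda>n. 9 * real n powr 0 \<le> real n powr (H + 2 * \<theta>)) sequentially"
      "eventually (\<lambda>n. 1 * real n powr (H + 2 * \<theta>) \<le> real n powr 1) sequentially"
      "eventually (\<lambda>n. (3 / \<mu>) * real n powr (H\<^sup>2 + 3 * \<theta>) \<le> real n powr (H\<^sup>2 + 4 * \<theta>)) sequentially"
      "eventually (\<lambda>n. (3 / \<mu>) * real n powr (H' + \<theta>) \<le> real n powr (H\<^sup>2 + 4 * \<theta>)) sequentially"
      "eventually (\<lambda>n. 15 * real n powr 0 \<le> real n powr (H\<^sup>2 + 4 * \<theta>)) sequentially"
      "eventually (\<lambda>n. (4 / \<epsilon> * \<mu>) * real n powr 0 \<le> real n powr H\<^sup>2) sequentially"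
      "eventually (\<lambda>n. (4 / \<epsilon>) * real n powr (H\<^sup>2 - \<theta>) \<le> real n powr H\<^sup>2) sequentially"
      "eventually (\<lambda>n. (8 / \<epsilon>) * real n powr (H' + \<theta>) \<le> real n powr H\<^sup>2) sequentially"
      "eventually (\<lambda>n. (4 / \<epsilon>) * real n powr r \<le> real n powr H\<^sup>2) sequentially"
      using e Hb HH r by (intro eventually_powr_less; force)+
    moreover have "eventually (\<lambda>n. \<forall>p u. p \<le> 2 * n \<longrightarrow> real (gap n p) \<le> real n powr (H + 2 * \<theta>) \<longrightarrow> \<bar>u\<bar> \<le> 2 * real n powr (H + \<theta>) \<longrightarrow>
        \<bar>regr n p * u\<bar> \<le> real n powr r) sequentially"
      using r(1) by (rule regr_small)
    ultimately show ?thesis using eventually_gt_at_top[of 0]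
    proof eventually_elim
      fix n :: nat
      assume c1: "(3 / \<mu>) * real n powr (H + \<theta>) \<le> real n powr (H + 2 * \<theta>)"
        and c2: "(3 / \<mu>) * real n powr (H' + \<theta>) \<le> real n powr (H + 2 * \<theta>)"
        and c3: "9 * real n powr 0 \<le> real n powr (H + 2 * \<theta>)"
        and c4: "1 * real n powr (H + 2 * \<theta>) \<le> real n powr 1"
        and c5: "(3 / \<mu>) * real n powr (H\<^sup>2 + 3 * \<theta>) \<le> real n powr (H\<^sup>2 + 4 * \<theta>)"
        and c6: "(3 / \<mu>) * real n powr (H' + \<theta>) \<le> real n powr (H\<^sup>2 + 4 * \<theta>)"
        and c7: "15 * real n powr 0 \<le> real n powr (H\<^sup>2 + 4 * \<theta>)"
        and c8: "(4 / \<epsilon> * \<mu>) * real n powr 0 \<le> real n powr H\<^sup>2"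
        and c9: "(4 / \<epsilon>) * real n powr (H\<^sup>2 - \<theta>) \<le> real n powr H\<^sup>2"
        and c10: "(8 / \<epsilon>) * real n powr (H' + \<theta>) \<le> real n powr H\<^sup>2"
        and c12: "(4 / \<epsilon>) * real n powr r \<le> real n powr H\<^sup>2"
        and c11: "\<forall>p u. p \<le> 2 * n \<longrightarrow> real (gap n p) \<le> real n powr (H + 2 * \<theta>) \<longrightarrow> \<bar>u\<bar> \<le> 2 * real n powr (H + \<theta>) \<longrightarrow>
          \<bar>regr n p * u\<bar> \<le> real n powr r"
        and n: "0 < n"
      show "\<forall>T \<omega>. 0 \<le> T \<longrightarrow> nat \<lfloor>T\<rfloor> = n \<longrightarrow> \<omega> \<in> space M - bad n \<longrightarrow>
        near_residual \<epsilon> n T \<omega>"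
      proof (intro allI impI)
        fix T :: real and \<omega>
        assume T: "0 \<le> T" "nat \<lfloor>T\<rfloor> = n" and \<omega>: "\<omega> \<in> space M - bad n"
        have n0: "real n powr 0 = 1" "real n powr 1 = real n" using n by auto
        have wn: "w n \<le> n" using c4 floor_le(1)[of n] unfolding n0 by linarith
        have s2: "(n - w n) + 2 * w n = n + w n" "(n - w n) + w n = n" using wn by auto
        have Sb0: "Sb 0 \<omega> = 0" by (simp add: Sb_def)
        have m1: "\<bar>Sb k \<omega>\<bar> \<le> B n" if "k \<le> 2 * n" for k
        proof -
          have "\<not> B n \<le> \<bar>Sb (0 + k) \<omega> - Sb 0 \<omega>\<bar>"
            using \<omega> that unfolding bad_def E1_def by blast
          then show ?thesis unfolding Sb0 add_0 by linarith
        qed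
        have m2: "\<bar>Sb ((n - w n) + j) \<omega> - Sb (n - w n) \<omega>\<bar> \<le> B2 n / 2" if "j \<le> 2 * w n" for j
        proof -
          have "\<not> B2 n / 2 \<le> \<bar>Sb ((n - w n) + j) \<omega> - Sb (n - w n) \<omega>\<bar>"
            using \<omega> that unfolding bad_def E2_def by blast
          then show ?thesis by linarith
        qed
        have m3: "\<bar>R k \<omega>\<bar> \<le> B3 n" if "k \<le> 2 * n" for k
        proof -
          have "\<not> B3 n \<le> \<bar>R k \<omega>\<bar>"
            using \<omega> that unfolding bad_def E3_def by blast
          then show ?thesis by linarith
        qed
        have m4: "\<bar>Sb k' \<omega> - Sb k \<omega>\<bar> \<le> B4 n" if "n - w n \<le> k" "k \<le> k'" "k' \<le> k + lag n" "k' \<le> n + w n" for k k'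
        proof -
          have "\<not> B4 n < \<bar>Sb k' \<omega> - Sb k \<omega>\<bar>"
            using \<omega> that unfolding bad_def E4_def s2 by blast
          then show ?thesis by linarith
        qed
        obtain q where q: "vervaat_process \<mu> (\<lambda>j \<omega>. G (\<eta>' j \<omega>)) T \<omega> = ereal q"
          "\<bar>q + a * (Z (crossing n (Z n \<omega>)) \<omega> - Z n \<omega>)\<bar> \<le> \<mu> + B4 n + 2 * B3 n"
          "n - w n \<le> crossing n (Z n \<omega>)" "crossing n (Z n \<omega>) \<le> n + w n" "\<bar>a * Z n \<omega>\<bar> \<le> B n + B3 n"
        proof (rule vervaat_process_approximation[where \<mu>=\<mu> and Y="\<lambda>j \<omega>. G (\<eta>' j \<omega>)" and \<omega>=\<omega> and T=T
            and Sb="\<lambda>k. Sb k \<omega>" and Z="\<lambda>k. Z k \<omega>" and R="\<lambda>k. R k \<omega>" and n=n and w="w n" and lag="lag n" and K="2 * n"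
            and a=a and B="B n" and ?B2.0="B2 n" and ?B3.0="B3 n" and ?B4.0="B4 n" and p="crossing n (Z n \<omega>)"])
          show "0 < \<mu>" by (rule mu_pos)
          show "Sb k \<omega> = (\<Sum>i<k. G (\<eta>' (Suc i) \<omega>) - \<mu>)" for k by (simp add: Sb_def X_def)
          show "Sb k \<omega> = a * Z k \<omega> + R k \<omega>" for k unfolding a_def by (rule Sb_decomposition)
          show "(B n + B3 n) / \<mu> + 2 \<le> real (w n)"
            using c1 c2 c3 floor_ge(1)[of n] unfolding n0 B_def B3_def add_divide_distrib by simp
          show "(B2 n + B3 n) / \<mu> + 4 \<le> real (lag n)"
            using c5 c6 c7 floor_ge(2)[of n] unfolding n0 B2_def B3_def add_divide_distrib by simp
          show "\<bar>Sb k \<omega> - Sb n \<omega>\<bar> \<le> B2 n" if "n - w n \<le> k" "k \<le> n + w n" for k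
          proof -
            have "k - (n - w n) \<le> 2 * w n" "(n - w n) + (k - (n - w n)) = k" using that wn by linarith+
            then have "\<bar>Sb k \<omega> - Sb (n - w n) \<omega>\<bar> \<le> B2 n / 2" using m2 by metis
            moreover have "\<bar>Sb n \<omega> - Sb (n - w n) \<omega>\<bar> \<le> B2 n / 2" using m2[of "w n"] unfolding s2 by simp
            ultimately have "\<bar>Sb k \<omega> - Sb (n - w n) \<omega>\<bar> + \<bar>Sb n \<omega> - Sb (n - w n) \<omega>\<bar> \<le> B2 n / 2 + B2 n / 2"
              by (rule add_mono)
            then show ?thesis
              using abs_triangle_ineq4[of "Sb k \<omega> - Sb (n - w n) \<omega>" "Sb n \<omega> - Sb (n - w n) \<omega>"] by simp
          qed
        qed (use m1 m3 m4 T wn in \<open>auto simp: crossing_def\<close>)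
        let ?p = "crossing n (Z n \<omega>)"
        have "B3 n \<le> real n powr (H + \<theta>)"
          unfolding B3_def using n e HH by (intro powr_mono) auto
        then have u: "\<bar>a * Z n \<omega>\<bar> \<le> 2 * real n powr (H + \<theta>)" using q(5) by (simp add: B_def)
        have "gap n ?p \<le> w n" using q(3,4) by (auto simp: gap_def)
        then have gap: "real (gap n ?p) \<le> real n powr (H + 2 * \<theta>)" using floor_le(1)[of n] by linarith
        have "?p \<le> 2 * n" using q(4) wn by linarith
        then have rg: "\<bar>regr n ?p * (a * Z n \<omega>)\<bar> \<le> real n powr r" using c11 gap u by blast
        have "q + a * W n ?p \<omega> = (q + a * (Z ?p \<omega> - Z n \<omega>)) - regr n ?p * (a * Z n \<omega>)"
          by (simp add: W_def algebra_simps)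
        then have "\<bar>q + a * W n ?p \<omega>\<bar> \<le> \<mu> + B4 n + 2 * B3 n + real n powr r"
          using q(2) rg by linarith
        also have "\<dots> \<le> \<epsilon> * real n powr H\<^sup>2"
        proof -
          have "4 * \<mu> \<le> \<epsilon> * real n powr H\<^sup>2" "4 * B4 n \<le> \<epsilon> * real n powr H\<^sup>2"
            "8 * B3 n \<le> \<epsilon> * real n powr H\<^sup>2" "4 * real n powr r \<le> \<epsilon> * real n powr H\<^sup>2"
            using c8 c9 c10 c12 \<epsilon> unfolding n0 B3_def B4_def by (simp_all add: field_simps)
          then show ?thesis by linarith
        qed
        finally show "near_residual \<epsilon> n T \<omega>"
          using q(1) unfolding near_residual_def Q_def by blast
      qed
    qed
  qed
  show ?thesis using that[of bad] bad_lim approx by (auto simp: bad_def)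
qed

end

abbreviation (input) "\<Phi> \<equiv> cdf std_normal_distribution"

lemma std_normal_cdf_isCont: "isCont \<Phi> x"
proof -
  interpret N: real_distribution std_normal_distribution by (rule real_dist_normal_dist)
  have "emeasure std_normal_distribution {x} = (\<integral>\<^sup>+y. ennreal (std_normal_density y) * indicator {x} y \<partial>lborel)"
    by (rule emeasure_density) auto
  also have "\<dots> = 0"
  proof (subst nn_integral_0_iff_AE)
    show "AE y in lborel. ennreal (std_normal_density y) * indicator {x} y = 0"
      using AE_lborel_singleton[of x] by eventually_elim auto
  qed auto
  finally show ?thesis unfolding N.isCont_cdf by (simp add: measure_def)
qed

lemma std_normal_AE_nonzero: "AE x in std_normal_distribution. x \<noteq> 0"
  by (subst AE_density) (use AE_lborel_singleton[of 0] in \<open>auto elim!: eventually_mono\<close>)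

lemma borel_measurable_std_normal_cdf[measurable]: "\<Phi> \<in> borel_measurable borel"
  by (intro borel_measurable_continuous_onI continuous_at_imp_continuous_on ballI std_normal_cdf_isCont)

lemma std_normal_cdf_abs_le: "\<bar>\<Phi> x\<bar> \<le> 1"
proof -
  interpret N: real_distribution std_normal_distribution by (rule real_dist_normal_dist)
  show ?thesis using N.cdf_bounded_prob[of x] N.cdf_nonneg[of x] by simp
qed

text \<open>Replaces an infimum over reals by one over integers with value infinity where the level
  is not passed; being countable, it yields measurability.\<close>

lemma renewal_time_eq_INF:
  "renewal_time Y t \<omega> = (INF k\<in>{1::nat..}. if t < (\<Sum>i<k. Y (Suc i) \<omega>) then ereal (real k) else \<infinity>)"
  unfolding renewal_time_def
proof (rule antisym)
  show "Inf (ereal ` {s. 1 \<le> s \<and> t < partial_sum Y s \<omega>}) \<le> (INF k\<in>{1::nat..}. if t < (\<Sum>i<k. Y (Suc i) \<omega>) then ereal (real k) else \<infinity>)"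
  proof (rule INF_greatest)
    fix k :: nat assume "k \<in> {1..}"
    then show "Inf (ereal ` {s. 1 \<le> s \<and> t < partial_sum Y s \<omega>}) \<le> (if t < (\<Sum>i<k. Y (Suc i) \<omega>) then ereal (real k) else \<infinity>)"
      by (auto intro!: Inf_lower simp: partial_sum_eq)
  qed
  show "(INF k\<in>{1::nat..}. if t < (\<Sum>i<k. Y (Suc i) \<omega>) then ereal (real k) else \<infinity>) \<le> Inf (ereal ` {s. 1 \<le> s \<and> t < partial_sum Y s \<omega>})"
  proof (rule Inf_greatest)
    fix x assume "x \<in> ereal ` {s. 1 \<le> s \<and> t < partial_sum Y s \<omega>}"
    then obtain s where s: "x = ereal s" "1 \<le> s" "t < (\<Sum>i<nat \<lfloor>s\<rfloor>. Y (Suc i) \<omega>)" by (auto simp: partial_sum_eq)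
    have "(INF k\<in>{1::nat..}. if t < (\<Sum>i<k. Y (Suc i) \<omega>) then ereal (real k) else \<infinity>) \<le> (if t < (\<Sum>i<nat \<lfloor>s\<rfloor>. Y (Suc i) \<omega>) then ereal (real (nat \<lfloor>s\<rfloor>)) else \<infinity>)"
      using s(2) by (intro INF_lower) (simp add: le_nat_floor)
    also have "\<dots> \<le> x" using s by simp
    finally show "(INF k\<in>{1::nat..}. if t < (\<Sum>i<k. Y (Suc i) \<omega>) then ereal (real k) else \<infinity>) \<le> x" .
  qed
qed

lemma borel_measurable_vervaat_process:
  assumes [measurable]: "\<And>j. Y j \<in> borel_measurable M"
  shows "vervaat_process \<mu> Y t \<in> borel_measurable M"
proof -
  have [measurable]: "renewal_time Y s \<in> borel_measurable M" for s
    unfolding renewal_time_eq_INF[abs_def] by (intro borel_measurable_INF) auto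
  have [measurable]: "partial_sum Y s \<in> borel_measurable M" for s
    unfolding partial_sum_def[abs_def] by measurable
  show ?thesis unfolding vervaat_process_def[abs_def] by measurable
qed

section \<open>Conditional laws and their mixture\<close>

context vervaat_setting
begin

lemma crossing_measurable[measurable]: "crossing n \<in> measurable borel (count_space UNIV)"
  unfolding crossing_def[abs_def] by measurable

lemma sqrt_var_sum_limit: "(\<lambda>n. sqrt (var_sum n) / real n powr H) \<longlonglongrightarrow> kappa \<alpha>"
proof -
  have "(\<lambda>n. sqrt (var_sum n / real n powr (2 - \<alpha>))) \<longlonglongrightarrow> sqrt ((kappa \<alpha>)\<^sup>2)"
    by (intro tendsto_real_sqrt var_sum_limit)
  moreover have "sqrt (real n powr (2 - \<alpha>)) = real n powr H" for n
    unfolding H_bounds(4) by (simp add: powr_half_sqrt[symmetric] powr_powr)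
  ultimately show ?thesis using kappa_pos by (simp add: real_sqrt_divide)
qed

text \<open>If \<open>Z n\<close> has the value \<open>sqrt (var_sum n) * x\<close>, the crossing
  lies at distance about \<open>g * n powr H\<close> from \<open>n\<close>. The variance over that
  distance is of order \<open>(n powr H) powr (2 * H)\<close>, the origin of the exponent
  \<open>2 * H^2\<close>. The condition \<open>x \<noteq> 0\<close> makes the distance diverge, so
  that the asymptotics of \<open>var_sum\<close> apply.\<close>

lemma res_var_limit:
  assumes x: "x \<noteq> 0"
  shows "(\<lambda>n. res_var n (crossing n (sqrt (var_sum n) * x)) / real n powr (2 * H\<^sup>2)) \<longlonglongrightarrow>
    (kappa \<alpha>)\<^sup>2 * (\<bar>a\<bar> * kappa \<alpha> * \<bar>x\<bar> / \<mu>) powr (2 * H)"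
proof -
  define g where "g = \<bar>a\<bar> * kappa \<alpha> * \<bar>x\<bar> / \<mu>"
  have g: "g > 0" using a_nz kappa_pos x mu_pos by (simp add: g_def)
  define D where "D n = a * (sqrt (var_sum n) * x) / \<mu>" for n
  define p where "p n = crossing n (sqrt (var_sum n) * x)" for n
  have pD: "p n = nat \<lfloor>real n - D n\<rfloor>" for n by (simp add: p_def crossing_def D_def)
  have D1: "(\<lambda>n. \<bar>D n\<bar> / real n powr H) \<longlonglongrightarrow> g"
  proof -
    have "(\<lambda>n. \<bar>a * x / \<mu>\<bar> * \<bar>sqrt (var_sum n) / real n powr H\<bar>) \<longlonglongrightarrow> \<bar>a * x / \<mu>\<bar> * \<bar>kappa \<alpha>\<bar>"
      by (intro tendsto_intros sqrt_var_sum_limit)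
    moreover have "\<bar>a * x / \<mu>\<bar> * \<bar>kappa \<alpha>\<bar> = g" using kappa_pos mu_pos by (simp add: g_def abs_mult)
    moreover have "\<bar>a * x / \<mu>\<bar> * \<bar>sqrt (var_sum n) / real n powr H\<bar> = \<bar>D n\<bar> / real n powr H" for n
      by (simp add: D_def abs_mult)
    ultimately show ?thesis by simp
  qed
  have D2: "eventually (\<lambda>n. \<bar>D n\<bar> \<le> real n) sequentially"
  proof -
    have "eventually (\<lambda>n. \<bar>D n\<bar> / real n powr H < g + 1) sequentially"
      using D1 by (rule order_tendstoD) simp
    moreover have "eventually (\<lambda>n. (g + 1) * real n powr H \<le> real n powr 1) sequentially"
      using H_bounds(2) by (rule eventually_powr_less)
    ultimately show ?thesis using eventually_gt_at_top[of 0]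
    proof eventually_elim
      case (elim n)
      then have "\<bar>D n\<bar> < (g + 1) * real n powr H" by (simp add: field_simps)
      then show ?case using elim by simp
    qed
  qed
  have gapD: "eventually (\<lambda>n. \<bar>real (gap n (p n)) - \<bar>D n\<bar>\<bar> \<le> 1) sequentially"
    using D2
  proof eventually_elim
    case (elim n)
    then have "0 \<le> real n - D n" by linarith
    then have "real (p n) \<le> real n - D n" "real n - D n < real (p n) + 1" unfolding pD by linarith+
    moreover have "real (gap n (p n)) = \<bar>real (p n) - real n\<bar>" by (auto simp: gap_def)
    ultimately show ?case by linarith
  qed
  have gap1: "(\<lambda>n. real (gap n (p n)) / real n powr H) \<longlonglongrightarrow> g"
  proof -
    have "(\<lambda>n. real (gap n (p n)) / real n powr H - \<bar>D n\<bar> / real n powr H) \<longlonglongrightarrow> 0"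
    proof (rule Lim_null_comparison)
      show "eventually (\<lambda>n. norm (real (gap n (p n)) / real n powr H - \<bar>D n\<bar> / real n powr H) \<le> real n powr (-H)) sequentially"
        using gapD
      proof eventually_elim
        case (elim n)
        have "norm (real (gap n (p n)) / real n powr H - \<bar>D n\<bar> / real n powr H) = \<bar>real (gap n (p n)) - \<bar>D n\<bar>\<bar> / real n powr H"
          by (simp add: diff_divide_distrib[symmetric] abs_divide)
        also have "\<dots> \<le> 1 / real n powr H" using elim by (intro divide_right_mono) auto
        finally show ?case by (simp add: powr_minus_divide)
      qed
      show "(\<lambda>n. real n powr (-H)) \<longlonglongrightarrow> 0" using powr_neg_tendsto_0[of "-H" 1] H_bounds(1) by simp
    qed
    from tendsto_add[OF this D1] show ?thesis by simp
  qed
  have gap_inf: "filterlim (\<lambda>n. gap n (p n)) at_top sequentially"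
  proof -
    have "filterlim (\<lambda>n. real n powr H) at_top sequentially" using H_bounds(1) by real_asymp
    from filterlim_tendsto_pos_mult_at_top[OF gap1 g this]
    have "filterlim (\<lambda>n. real (gap n (p n)) / real n powr H * real n powr H) at_top sequentially" .
    moreover have "eventually (\<lambda>n. real (gap n (p n)) / real n powr H * real n powr H = real (gap n (p n))) sequentially"
      using eventually_gt_at_top[of 0] by eventually_elim simp
    ultimately have "filterlim (\<lambda>n. real (gap n (p n))) at_top sequentially"
      by (simp add: filterlim_cong)
    then show ?thesis by (simp add: filterlim_sequentially_iff_filterlim_real)
  qed
  have main: "(\<lambda>n. var_sum (gap n (p n)) / real n powr (2 * H\<^sup>2)) \<longlonglongrightarrow> (kappa \<alpha>)\<^sup>2 * g powr (2 * H)"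
  proof -
    have "(\<lambda>n. var_sum (gap n (p n)) / real (gap n (p n)) powr (2 - \<alpha>) * (real (gap n (p n)) / real n powr H) powr (2 * H)) \<longlonglongrightarrow> (kappa \<alpha>)\<^sup>2 * g powr (2 * H)"
      using g by (intro tendsto_mult filterlim_compose[OF var_sum_limit gap_inf] tendsto_powr gap1 tendsto_const) auto
    moreover have "eventually (\<lambda>n. gap n (p n) \<ge> 1) sequentially"
      using gap_inf unfolding filterlim_at_top by blast
    then have "eventually (\<lambda>n. var_sum (gap n (p n)) / real (gap n (p n)) powr (2 - \<alpha>) * (real (gap n (p n)) / real n powr H) powr (2 * H)
       = var_sum (gap n (p n)) / real n powr (2 * H\<^sup>2)) sequentially"
    proof eventually_elim
      case (elim n)
      have "(real (gap n (p n)) / real n powr H) powr (2 * H) = real (gap n (p n)) powr (2 - \<alpha>) / real n powr (2 * H\<^sup>2)"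
        unfolding H_bounds(4) by (simp add: powr_divide powr_powr power2_eq_square mult_ac)
      then show ?case using elim by simp
    qed
    ultimately show ?thesis by (rule Lim_transform_eventually)
  qed
  have reg: "(\<lambda>n. (regr n (p n))\<^sup>2 * var_sum n / real n powr (2 * H\<^sup>2)) \<longlonglongrightarrow> 0"
  proof -
    \<comment> \<open>The slack between \<open>2 * H - 1\<close> and \<open>H^2\<close>. Half of it
      enlarges the exponent of the distance and a quarter lowers \<open>r\<close> below
      \<open>H^2\<close>, which leaves a quarter for strict inequality.\<close>
    define d where "d = (1 - H)\<^sup>2"
    have "d > 0" using H_bounds(2) by (simp add: d_def)
    moreover have "d = 1 - 2 * H + H\<^sup>2" by (simp add: d_def power2_eq_square algebra_simps)
    ultimately have d: "d > 0" "d = 1 - 2 * H + H\<^sup>2" .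
    define r where "r = H\<^sup>2 - d / 4"
    have st: "(H + d / 2) + H < 1 + r" using d by (simp add: r_def field_simps)
    have "eventually (\<lambda>n. \<forall>p u. p \<le> 2 * n \<longrightarrow> real (gap n p) \<le> real n powr (H + d / 2) \<longrightarrow> \<bar>u\<bar> \<le> (kappa \<alpha> + 1) * real n powr H \<longrightarrow>
      \<bar>regr n p * u\<bar> \<le> real n powr r) sequentially"
      by (rule regr_small[OF st])
    moreover have "eventually (\<lambda>n. sqrt (var_sum n) / real n powr H < kappa \<alpha> + 1) sequentially"
      using sqrt_var_sum_limit by (rule order_tendstoD) simp
    moreover have "eventually (\<lambda>n. real (gap n (p n)) / real n powr H < g + 1) sequentially"
      using gap1 by (rule order_tendstoD) simp
    moreover have "eventually (\<lambda>n. (g + 1) * real n powr H \<le> real n powr (H + d / 2)) sequentially"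
      using d by (intro eventually_powr_less) simp
    ultimately have "eventually (\<lambda>n. norm ((regr n (p n))\<^sup>2 * var_sum n / real n powr (2 * H\<^sup>2)) \<le> 1 * real n powr (- (d / 2))) sequentially"
      using D2 eventually_gt_at_top[of 0]
    proof eventually_elim
      fix n :: nat
      assume r1: "\<forall>p u. p \<le> 2 * n \<longrightarrow> real (gap n p) \<le> real n powr (H + d / 2) \<longrightarrow> \<bar>u\<bar> \<le> (kappa \<alpha> + 1) * real n powr H \<longrightarrow>
          \<bar>regr n p * u\<bar> \<le> real n powr r"
        and v: "sqrt (var_sum n) / real n powr H < kappa \<alpha> + 1"
        and gp: "real (gap n (p n)) / real n powr H < g + 1"
        and gp2: "(g + 1) * real n powr H \<le> real n powr (H + d / 2)"
        and D2: "\<bar>D n\<bar> \<le> real n" and n: "0 < n"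
      have v0: "var_sum n \<ge> 0" using gaussian_Z by (rule gaussian_nonneg)
      have "p n \<le> 2 * n" unfolding pD using D2 by linarith
      moreover have "real (gap n (p n)) \<le> real n powr (H + d / 2)"
        using gp gp2 n by (simp add: divide_less_eq)
      moreover have "\<bar>sqrt (var_sum n)\<bar> \<le> (kappa \<alpha> + 1) * real n powr H"
        using v n v0 by (simp add: divide_less_eq)
      ultimately have "\<bar>regr n (p n) * sqrt (var_sum n)\<bar> \<le> real n powr r" using r1 by blast
      then have "(\<bar>regr n (p n) * sqrt (var_sum n)\<bar>)\<^sup>2 \<le> (real n powr r)\<^sup>2" by (intro power_mono) auto
      then have "(regr n (p n))\<^sup>2 * var_sum n \<le> real n powr (2 * r)"
        using v0 by (simp add: power_mult_distrib power2_eq_square[of "real n powr r"] powr_add[symmetric])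
      then have "(regr n (p n))\<^sup>2 * var_sum n / real n powr (2 * H\<^sup>2) \<le> real n powr (2 * r) / real n powr (2 * H\<^sup>2)"
        by (intro divide_right_mono) auto
      also have "\<dots> = real n powr (- (d / 2))" unfolding powr_diff[symmetric] by (simp add: r_def)
      finally show "norm ((regr n (p n))\<^sup>2 * var_sum n / real n powr (2 * H\<^sup>2)) \<le> 1 * real n powr (- (d / 2))"
        using v0 by simp
    qed
    then show ?thesis by (rule Lim_null_comparison) (rule powr_neg_tendsto_0, use d in simp)
  qed
  from tendsto_diff[OF main reg] show ?thesis
    unfolding res_var_def p_def[symmetric] g_def[symmetric] by (simp add: diff_divide_distrib)
qed

definition res_cdf :: "nat \<Rightarrow> nat \<Rightarrow> real \<Rightarrow> real" where
  "res_cdf n q c = prob {\<omega>\<in>space M. (- a) * W n q \<omega> \<le> c}"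

text \<open>At \<open>x = 0\<close> the denominator vanishes and the quotient is 0 by convention;
  this affects only a null set.\<close>

definition limit_scale :: "real \<Rightarrow> real" where
  "limit_scale x = \<sigma> powr (2 - \<alpha> / 2) * \<mu> powr (1 - \<alpha> / 2) /
     (\<bar>x\<bar> powr (1 - \<alpha> / 2) * (\<bar>J1\<bar> * kappa \<alpha>) powr (2 - \<alpha> / 2))"

definition limit_cdf :: "real \<Rightarrow> real" where
  "limit_cdf z = (LINT x|std_normal_distribution. \<Phi> (z * limit_scale x))"

lemma limit_scale_measurable[measurable]: "limit_scale \<in> borel_measurable borel"
  unfolding limit_scale_def[abs_def] by measurable

text \<open>The constant \<open>\<bar>a\<bar> * kappa \<alpha>\<close> enters once as the scale of
  the increment and once more to the power \<open>H\<close> through the length of the window, hence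
  the exponent \<open>1 + H = 2 - \<alpha> / 2\<close>.\<close>

lemma scale_identity:
  assumes x: "x \<noteq> 0"
  shows "z / (\<bar>a\<bar> * (kappa \<alpha> * (\<bar>a\<bar> * kappa \<alpha> * \<bar>x\<bar> / \<mu>) powr H)) =
    z * limit_scale x"
proof -
  define c where "c = \<bar>J1\<bar> * kappa \<alpha>"
  have c: "c > 0" using J1_nz kappa_pos by (simp add: c_def)
  have ac: "\<bar>a\<bar> * kappa \<alpha> = c / \<sigma>" using sigma_pos by (simp add: a_def c_def)
  have e: "2 - \<alpha> / 2 = 1 + H" "1 - \<alpha> / 2 = H" by (auto simp: H_def)
  have "\<bar>a\<bar> * (kappa \<alpha> * (\<bar>a\<bar> * kappa \<alpha> * \<bar>x\<bar> / \<mu>) powr H) = (c / \<sigma>) * (c / \<sigma> * \<bar>x\<bar> / \<mu>) powr H"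
    by (simp only: ac mult.assoc[symmetric])
  also have "\<dots> = (\<bar>x\<bar> powr H * c powr (1 + H)) / (\<sigma> powr (1 + H) * \<mu> powr H)"
    using c sigma_pos mu_pos x by (simp add: powr_divide powr_mult powr_add mult_ac)
  finally show ?thesis unfolding limit_scale_def e c_def[symmetric] using c sigma_pos mu_pos x by simp
qed

text \<open>For a fixed index the residual is exactly normal, so convergence of its standard
  deviation and continuity of the normal distribution function suffice. The sign of \<open>a\<close>
  disappears because the law is symmetric.\<close>

lemma prob_W_limit:
  assumes x: "x \<noteq> 0"
  shows "(\<lambda>n. res_cdf n (crossing n (sqrt (var_sum n) * x)) (z * real n powr H\<^sup>2)) \<longlonglongrightarrow>
    \<Phi> (z * limit_scale x)"
proof -
  define v where "v n = res_var n (crossing n (sqrt (var_sum n) * x))" for n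
  define g where "g = \<bar>a\<bar> * kappa \<alpha> * \<bar>x\<bar> / \<mu>"
  have g: "g > 0" using a_nz kappa_pos x mu_pos by (simp add: g_def)
  have lim: "(\<lambda>n. v n / real n powr (2 * H\<^sup>2)) \<longlonglongrightarrow> (kappa \<alpha>)\<^sup>2 * g powr (2 * H)"
    unfolding v_def g_def by (rule res_var_limit[OF x])
  have sq: "sqrt ((kappa \<alpha>)\<^sup>2 * g powr (2 * H)) = kappa \<alpha> * g powr H"
  proof -
    have "(kappa \<alpha>)\<^sup>2 * g powr (2 * H) = (kappa \<alpha> * g powr H)\<^sup>2"
      by (simp add: power_mult_distrib power2_eq_square[of "g powr H"] powr_add[symmetric])
    then show ?thesis using kappa_pos by (simp add: real_sqrt_mult)
  qed
  have pos: "\<bar>a\<bar> * (kappa \<alpha> * g powr H) > 0" using a_nz kappa_pos g by simp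
  have "(\<lambda>n. \<Phi> (z / (\<bar>a\<bar> * sqrt (v n / real n powr (2 * H\<^sup>2))))) \<longlonglongrightarrow>
      \<Phi> (z / (\<bar>a\<bar> * (kappa \<alpha> * g powr H)))"
  proof (rule isCont_tendsto_compose[OF std_normal_cdf_isCont])
    show "(\<lambda>n. z / (\<bar>a\<bar> * sqrt (v n / real n powr (2 * H\<^sup>2)))) \<longlonglongrightarrow> z / (\<bar>a\<bar> * (kappa \<alpha> * g powr H))"
      unfolding sq[symmetric] using pos sq by (intro tendsto_intros lim) auto
  qed
  moreover have "eventually (\<lambda>n. \<Phi> (z / (\<bar>a\<bar> * sqrt (v n / real n powr (2 * H\<^sup>2)))) =
      res_cdf n (crossing n (sqrt (var_sum n) * x)) (z * real n powr H\<^sup>2)) sequentially"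
  proof -
    have "eventually (\<lambda>n. 0 < v n / real n powr (2 * H\<^sup>2)) sequentially"
      using lim by (rule order_tendstoD(1)) (use kappa_pos g in auto)
    moreover have "eventually (\<lambda>n. 0 < sqrt (var_sum n) / real n powr H) sequentially"
      using sqrt_var_sum_limit kappa_pos by (rule order_tendstoD(1))
    ultimately show ?thesis using eventually_gt_at_top[of 0]
    proof eventually_elim
      fix n :: nat assume v1: "0 < v n / real n powr (2 * H\<^sup>2)" and v2: "0 < sqrt (var_sum n) / real n powr H" and n: "0 < n"
      have vs: "var_sum n > 0" using v2 n by (simp add: zero_less_divide_iff)
      have vn: "v n > 0" using v1 n by (simp add: zero_less_divide_iff)
      have "res_cdf n (crossing n (sqrt (var_sum n) * x)) (z * real n powr H\<^sup>2)
         = \<Phi> (z * real n powr H\<^sup>2 / sqrt ((- a)\<^sup>2 * v n))"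
        using vn a_nz unfolding v_def res_cdf_def
        by (intro gaussian_prob_le gaussian_cmult gaussian_W vs) auto
      also have "sqrt ((- a)\<^sup>2 * v n) = \<bar>a\<bar> * sqrt (v n)" by (simp add: real_sqrt_mult)
      also have "z * real n powr H\<^sup>2 / (\<bar>a\<bar> * sqrt (v n)) = z / (\<bar>a\<bar> * sqrt (v n / real n powr (2 * H\<^sup>2)))"
      proof -
        have "sqrt (real n powr (2 * H\<^sup>2)) = real n powr H\<^sup>2"
          by (simp add: powr_half_sqrt[symmetric] powr_powr)
        then show ?thesis using n by (simp add: real_sqrt_divide)
      qed
      finally show "\<Phi> (z / (\<bar>a\<bar> * sqrt (v n / real n powr (2 * H\<^sup>2)))) =
        res_cdf n (crossing n (sqrt (var_sum n) * x)) (z * real n powr H\<^sup>2)" by simp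
    qed
  qed
  ultimately have "(\<lambda>n. res_cdf n (crossing n (sqrt (var_sum n) * x)) (z * real n powr H\<^sup>2)) \<longlonglongrightarrow>
      \<Phi> (z / (\<bar>a\<bar> * (kappa \<alpha> * g powr H)))"
    by (rule Lim_transform_eventually)
  then show ?thesis unfolding g_def scale_identity[OF x] .
qed

text \<open>Conditioning on \<open>Z n\<close> writes the probability as a mixture over a standard
  normal \<open>x\<close>; probabilities are bounded by 1, so the pointwise limits may be
  integrated.\<close>

lemma prob_W_crossing_limit:
  "(\<lambda>n. prob {\<omega>\<in>space M. (- a) * W n (crossing n (Z n \<omega>)) \<omega> \<le> z * real n powr H\<^sup>2}) \<longlonglongrightarrow> limit_cdf z"
proof -
  interpret N: real_distribution std_normal_distribution by (rule real_dist_normal_dist)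
  have "(\<lambda>n. LINT x|std_normal_distribution. res_cdf n (crossing n (sqrt (var_sum n) * x)) (z * real n powr H\<^sup>2)) \<longlonglongrightarrow> limit_cdf z"
    unfolding limit_cdf_def
  proof (rule integral_dominated_convergence[where w="\<lambda>_. 1"])
    show "AE x in std_normal_distribution. (\<lambda>n. res_cdf n (crossing n (sqrt (var_sum n) * x)) (z * real n powr H\<^sup>2)) \<longlonglongrightarrow>
      \<Phi> (z * limit_scale x)"
      using std_normal_AE_nonzero by eventually_elim (rule prob_W_limit)
    show "(\<lambda>x. res_cdf n (crossing n (sqrt (var_sum n) * x)) (z * real n powr H\<^sup>2)) \<in> borel_measurable std_normal_distribution" for n
    proof -
      have 1: "(\<lambda>u. res_cdf n (crossing n u) (z * real n powr H\<^sup>2)) \<in> borel_measurable borel"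
        by (rule measurable_compose[OF crossing_measurable]) simp
      show ?thesis by (rule measurable_compose[OF _ 1]) simp
    qed
  qed (auto simp: res_cdf_def)
  moreover have "eventually (\<lambda>n. (LINT x|std_normal_distribution. res_cdf n (crossing n (sqrt (var_sum n) * x)) (z * real n powr H\<^sup>2))
      = prob {\<omega>\<in>space M. (- a) * W n (crossing n (Z n \<omega>)) \<omega> \<le> z * real n powr H\<^sup>2}) sequentially"
  proof -
    have "eventually (\<lambda>n. 0 < sqrt (var_sum n) / real n powr H) sequentially"
      using sqrt_var_sum_limit kappa_pos by (rule order_tendstoD(1))
    then show ?thesis using eventually_gt_at_top[of 0]
    proof eventually_elim
      case (elim n)
      then have "var_sum n > 0" by (simp add: zero_less_divide_iff)
      then show ?case unfolding res_cdf_def by (subst prob_W_random_index) auto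
    qed
  qed
  ultimately show ?thesis by (rule Lim_transform_eventually)
qed

text \<open>Continuity of the limit lets a perturbation of the argument by
  \<open>2 * \<epsilon>\<close> be absorbed.\<close>

lemma limit_cdf_isCont: "isCont limit_cdf y"
  unfolding continuous_at_sequentially
proof (intro allI impI)
  interpret N: real_distribution std_normal_distribution by (rule real_dist_normal_dist)
  fix s :: "nat \<Rightarrow> real" assume s: "s \<longlonglongrightarrow> y"
  show "(limit_cdf \<circ> s) \<longlonglongrightarrow> limit_cdf y"
    unfolding comp_def limit_cdf_def
  proof (rule integral_dominated_convergence[where w="\<lambda>_. 1"])
    show "AE x in std_normal_distribution. (\<lambda>n. \<Phi> (s n * limit_scale x)) \<longlonglongrightarrow>
      \<Phi> (y * limit_scale x)"
    proof (rule AE_I2)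
      fix x :: real
      show "(\<lambda>n. \<Phi> (s n * limit_scale x)) \<longlonglongrightarrow> \<Phi> (y * limit_scale x)"
        by (intro isCont_tendsto_compose[OF std_normal_cdf_isCont] tendsto_mult s tendsto_const)
    qed
  qed (auto simp: std_normal_cdf_abs_le)
qed

text \<open>A sandwich: outside the bad event, the event for \<open>Q\<close> lies between the
  events for the residual at \<open>y - 2 * \<epsilon>\<close> and
  \<open>y + 2 * \<epsilon>\<close>. One \<epsilon> pays for the approximation of \<open>Q\<close>,
  the other for normalising with the integer part of \<open>T\<close> in place of
  \<open>T\<close>.\<close>

lemma vervaat_process_limit:
  "((\<lambda>T. prob {\<omega>\<in>space M. Q T \<omega> * ereal (T powr (- (H\<^sup>2))) \<le> ereal y})
     \<longlongrightarrow> limit_cdf y) at_top"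
proof (rule tendstoI)
  fix \<delta> :: real assume \<delta>: "\<delta> > 0"
  let ?P = "\<lambda>T. prob {\<omega>\<in>space M. Q T \<omega> * ereal (T powr (- (H\<^sup>2))) \<le> ereal y}"
  define F where "F n z = {\<omega>\<in>space M. (- a) * W n (crossing n (Z n \<omega>)) \<omega> \<le> z * real n powr H\<^sup>2}" for n z
  have Wm[measurable]: "(\<lambda>\<omega>. W n (crossing n (Z n \<omega>)) \<omega>) \<in> borel_measurable M" for n
    by (rule measurable_compose_countable[where g="\<lambda>\<omega>. crossing n (Z n \<omega>)" and f="\<lambda>q \<omega>. W n q \<omega>"]) measurable
  have [measurable]: "F n z \<in> sets M" for n z unfolding F_def by measurable
  have [measurable]: "Q T \<in> borel_measurable M" for T
    unfolding Q_def by (rule borel_measurable_vervaat_process) measurable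
  obtain e0 where e0: "e0 > 0" "\<And>z. \<bar>z - y\<bar> < e0 \<Longrightarrow> \<bar>limit_cdf z - limit_cdf y\<bar> < \<delta> / 4"
    using limit_cdf_isCont[of y] \<delta> unfolding continuous_at_eps_delta dist_real_def
    by (metis divide_pos_pos zero_less_numeral)
  define \<epsilon> where "\<epsilon> = e0 / 4"
  have \<epsilon>: "\<epsilon> > 0" "2 * \<epsilon> < e0" using e0(1) by (auto simp: \<epsilon>_def)
  have z1: "\<bar>limit_cdf (y - 2 * \<epsilon>) - limit_cdf y\<bar> < \<delta> / 4"
    by (rule e0(2)) (use \<epsilon> in simp)
  have z2: "\<bar>limit_cdf (y + 2 * \<epsilon>) - limit_cdf y\<bar> < \<delta> / 4"
    by (rule e0(2)) (use \<epsilon> in simp)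
  obtain bad where bad: "\<And>n. bad n \<in> sets M" "(\<lambda>n. prob (bad n)) \<longlonglongrightarrow> 0"
    "\<And>\<epsilon>. \<epsilon> > 0 \<Longrightarrow> eventually (\<lambda>n. \<forall>T \<omega>. 0 \<le> T \<longrightarrow> nat \<lfloor>T\<rfloor> = n \<longrightarrow> \<omega> \<in> space M - bad n \<longrightarrow> near_residual \<epsilon> n T \<omega>) sequentially"
    using good_event by blast
  note bad(1)[measurable]
  \<comment> \<open>The powers \<open>H^2\<close> of \<open>n\<close> and \<open>n + 1\<close>
    differ by a vanishing fraction, so all \<open>T\<close> with integer part \<open>n\<close> share
    one normalisation.\<close>
  have "(\<lambda>n. \<bar>y\<bar> * (((real n + 1) powr H\<^sup>2 - real n powr H\<^sup>2) / real n powr H\<^sup>2)) \<longlonglongrightarrow> \<bar>y\<bar> * 0"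
  proof (intro tendsto_mult tendsto_const)
    define h2 where "h2 = H\<^sup>2"
    have "h2 > 0" using H_bounds(3) unfolding h2_def by linarith
    then show "(\<lambda>n. ((real n + 1) powr H\<^sup>2 - real n powr H\<^sup>2) / real n powr H\<^sup>2) \<longlonglongrightarrow> 0"
      unfolding h2_def[symmetric] by real_asymp
  qed
  then have inc: "eventually (\<lambda>n. \<bar>y\<bar> * (((real n + 1) powr H\<^sup>2 - real n powr H\<^sup>2) / real n powr H\<^sup>2) < \<epsilon>) sequentially"
    using \<epsilon> by (intro order_tendstoD(2)) auto
  have lim1: "eventually (\<lambda>n. \<bar>prob (F n (y - 2 * \<epsilon>)) - limit_cdf (y - 2 * \<epsilon>)\<bar> < \<delta> / 4) sequentially"
    and lim2: "eventually (\<lambda>n. \<bar>prob (F n (y + 2 * \<epsilon>)) - limit_cdf (y + 2 * \<epsilon>)\<bar> < \<delta> / 4) sequentially"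
    using tendstoD[OF prob_W_crossing_limit, of "\<delta> / 4"] \<delta> unfolding F_def dist_real_def by auto
  have lim3: "eventually (\<lambda>n. prob (bad n) < \<delta> / 4) sequentially"
    using bad(2) \<delta> by (intro order_tendstoD(2)) auto
  \<comment> \<open>Uniformity over all \<open>T\<close> with integer part \<open>n\<close> is what
    carries a limit along integers over to real \<open>T\<close>.\<close>
  have ev: "eventually (\<lambda>n. \<forall>T\<ge>0. nat \<lfloor>T\<rfloor> = n \<longrightarrow> dist (?P T) (limit_cdf y) < \<delta>) sequentially"
    using inc lim1 lim2 lim3 bad(3)[OF \<epsilon>(1)] eventually_gt_at_top[of 0]
  proof eventually_elim
    fix n :: nat
    assume inc: "\<bar>y\<bar> * (((real n + 1) powr H\<^sup>2 - real n powr H\<^sup>2) / real n powr H\<^sup>2) < \<epsilon>"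
      and l1: "\<bar>prob (F n (y - 2 * \<epsilon>)) - limit_cdf (y - 2 * \<epsilon>)\<bar> < \<delta> / 4"
      and l2: "\<bar>prob (F n (y + 2 * \<epsilon>)) - limit_cdf (y + 2 * \<epsilon>)\<bar> < \<delta> / 4"
      and l3: "prob (bad n) < \<delta> / 4"
      and ap: "\<forall>T \<omega>. 0 \<le> T \<longrightarrow> nat \<lfloor>T\<rfloor> = n \<longrightarrow> \<omega> \<in> space M - bad n \<longrightarrow> near_residual \<epsilon> n T \<omega>"
      and n: "0 < n"
    show "\<forall>T\<ge>0. nat \<lfloor>T\<rfloor> = n \<longrightarrow> dist (?P T) (limit_cdf y) < \<delta>"
    proof (intro allI impI)
      fix T :: real assume T: "0 \<le> T" "nat \<lfloor>T\<rfloor> = n"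
      have nT: "real n \<le> T" "T < real n + 1" using T by linarith+
      have Tpos: "0 < T" using n nT by linarith
      let ?E = "{\<omega>\<in>space M. Q T \<omega> * ereal (T powr (- (H\<^sup>2))) \<le> ereal y}"
      have E_meas: "?E \<in> sets M" by measurable
      have pm: "real n powr H\<^sup>2 \<le> T powr H\<^sup>2" "T powr H\<^sup>2 \<le> (real n + 1) powr H\<^sup>2"
        using nT by (auto intro!: powr_mono2)
      have yT: "\<bar>y * T powr H\<^sup>2 - y * real n powr H\<^sup>2\<bar> \<le> \<epsilon> * real n powr H\<^sup>2"
      proof -
        have "\<bar>y * T powr H\<^sup>2 - y * real n powr H\<^sup>2\<bar> = \<bar>y\<bar> * (T powr H\<^sup>2 - real n powr H\<^sup>2)"
          using pm by (simp add: right_diff_distrib[symmetric] abs_mult)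
        also have "\<dots> \<le> \<bar>y\<bar> * ((real n + 1) powr H\<^sup>2 - real n powr H\<^sup>2)"
          using pm by (intro mult_left_mono) auto
        also have "\<dots> \<le> \<epsilon> * real n powr H\<^sup>2" using inc n by (simp add: divide_less_eq)
        finally show ?thesis .
      qed
      have Eq: "\<omega> \<in> ?E \<longleftrightarrow> q \<le> y * T powr H\<^sup>2" if "\<omega> \<in> space M" "Q T \<omega> = ereal q" for \<omega> q
        using that Tpos by (simp add: powr_minus field_simps)
      have up: "?E \<subseteq> bad n \<union> F n (y + 2 * \<epsilon>)"
      proof
        fix \<omega> assume \<omega>: "\<omega> \<in> ?E"
        show "\<omega> \<in> bad n \<union> F n (y + 2 * \<epsilon>)"
        proof (cases "\<omega> \<in> bad n")
          case False
          then obtain q where q: "Q T \<omega> = ereal q" "\<bar>q + a * W n (crossing n (Z n \<omega>)) \<omega>\<bar> \<le> \<epsilon> * real n powr H\<^sup>2"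
            using ap T \<omega> unfolding near_residual_def by blast
          have "q \<le> y * T powr H\<^sup>2" using Eq[OF _ q(1)] \<omega> by blast
          then have "(- a) * W n (crossing n (Z n \<omega>)) \<omega> \<le> y * real n powr H\<^sup>2 + \<epsilon> * real n powr H\<^sup>2 + \<epsilon> * real n powr H\<^sup>2"
            using q(2) yT unfolding mult_minus_left by linarith
          then show ?thesis using \<omega> by (simp add: F_def algebra_simps)
        qed simp
      qed
      have low: "F n (y - 2 * \<epsilon>) \<subseteq> bad n \<union> ?E"
      proof
        fix \<omega> assume \<omega>: "\<omega> \<in> F n (y - 2 * \<epsilon>)"
        show "\<omega> \<in> bad n \<union> ?E"
        proof (cases "\<omega> \<in> bad n")
          case False
          have s: "\<omega> \<in> space M" using \<omega> by (simp add: F_def)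
          obtain q where q: "Q T \<omega> = ereal q" "\<bar>q + a * W n (crossing n (Z n \<omega>)) \<omega>\<bar> \<le> \<epsilon> * real n powr H\<^sup>2"
            using ap T s False unfolding near_residual_def by blast
          have "- (a * W n (crossing n (Z n \<omega>)) \<omega>) \<le> y * real n powr H\<^sup>2 - \<epsilon> * real n powr H\<^sup>2 - \<epsilon> * real n powr H\<^sup>2"
            using \<omega> by (simp add: F_def algebra_simps)
          then have "q \<le> y * T powr H\<^sup>2" using q(2) yT by linarith
          then show ?thesis using Eq[OF s q(1)] by blast
        qed simp
      qed
      have "prob ?E \<le> prob (bad n \<union> F n (y + 2 * \<epsilon>))" using up by (intro finite_measure_mono) auto
      also have "\<dots> \<le> prob (bad n) + prob (F n (y + 2 * \<epsilon>))" by (rule measure_Un_le) auto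
      finally have u: "prob ?E \<le> prob (bad n) + prob (F n (y + 2 * \<epsilon>))" .
      have "prob (F n (y - 2 * \<epsilon>)) \<le> prob (bad n \<union> ?E)" using low E_meas by (intro finite_measure_mono) auto
      also have "\<dots> \<le> prob (bad n) + prob ?E" using E_meas by (intro measure_Un_le) auto
      finally have l: "prob (F n (y - 2 * \<epsilon>)) \<le> prob (bad n) + prob ?E" .
      define d4 where "d4 = \<delta> / 4"
      have d4: "\<delta> = 4 * d4" "d4 > 0" using \<delta> by (simp_all add: d4_def)
      show "dist (?P T) (limit_cdf y) < \<delta>"
        using u l l1 l2 l3 z1 z2 d4(2) unfolding dist_real_def d4_def[symmetric] d4(1) by linarith
    qed
  qed
  have fl: "filterlim (\<lambda>T::real. nat \<lfloor>T\<rfloor>) sequentially at_top"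
    by (rule filterlim_compose[OF filterlim_nat_sequentially filterlim_floor_sequentially])
  have "eventually (\<lambda>T::real. \<forall>T'\<ge>0. nat \<lfloor>T'\<rfloor> = nat \<lfloor>T\<rfloor> \<longrightarrow> dist (?P T') (limit_cdf y) < \<delta>) at_top"
    using fl[unfolded filterlim_iff, rule_format, OF ev] .
  then show "eventually (\<lambda>T. dist (?P T) (limit_cdf y) < \<delta>) at_top"
    using eventually_ge_at_top[of 0] by eventually_elim blast
qed

end

theorem theorem3p3:
  fixes M :: "'a measure" and \<xi> :: "int \<Rightarrow> 'a \<Rightarrow> real" and \<psi> :: "nat \<Rightarrow> real"
    and G :: "real \<Rightarrow> real" and \<alpha> \<sigma> \<mu> J\<^sub>1 :: real
    and \<eta> \<eta>' Y :: "nat \<Rightarrow> 'a \<Rightarrow> real"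
  assumes "prob_space M"
    and "0 < \<alpha>" and "\<alpha> < 2 - sqrt 2"
    and "prob_space.indep_vars M (\<lambda>_. borel) \<xi> UNIV"
    and "\<And>k. distributed M lborel (\<xi> k) (\<lambda>x. ennreal (std_normal_density x))"
    and "\<psi> \<sim>[at_top] (\<lambda>k. real k powr (- (1 + \<alpha>) / 2))"
    and "\<And>j \<omega>. \<eta> j \<omega> = linear_process \<psi> \<xi> j \<omega>"
    and "\<sigma> = sqrt (prob_space.expectation M (\<lambda>\<omega>. (\<eta> 0 \<omega>)\<^sup>2))"
    and "\<And>j \<omega>. \<eta>' j \<omega> = \<eta> j \<omega> / \<sigma>"
    and "G \<in> borel_measurable borel"
    and "J\<^sub>1 = prob_space.expectation M (\<lambda>\<omega>. G (\<eta>' 0 \<omega>) * \<eta>' 0 \<omega>)" and "J\<^sub>1 \<noteq> 0"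
    and "\<And>j \<omega>. Y j \<omega> = G (\<eta>' j \<omega>)"
    and "\<mu> = prob_space.expectation M (Y 0)" and "0 < \<mu>"
    and "integrable M (\<lambda>\<omega>. (Y 0 \<omega>)\<^sup>2)"
  shows "\<forall>y::real.
    ((\<lambda>T. prob_space.prob M
        {\<omega> \<in> space M. vervaat_process \<mu> Y T \<omega> * ereal (T powr (- ((1 - \<alpha> / 2)\<^sup>2))) \<le> ereal y})
      \<longlongrightarrow>
      (LINT x|lborel. std_normal_density x *
         cdf std_normal_distribution
           (y * \<sigma> powr (2 - \<alpha> / 2) * \<mu> powr (1 - \<alpha> / 2) /
             (\<bar>x\<bar> powr (1 - \<alpha> / 2) * (\<bar>J\<^sub>1\<bar> * kappa \<alpha>) powr (2 - \<alpha> / 2))))) at_top"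
proof -
  interpret prob_space M by fact
  let ?N = std_normal_distribution
  have xi: "gaussian M (\<xi> k) 1" for k
  proof -
    have d: "distributed M lborel (\<xi> k) (\<lambda>x. ennreal (std_normal_density x))" by fact
    have [measurable]: "\<xi> k \<in> borel_measurable M" using distributed_measurable[OF d] by simp
    have "distr M borel (\<xi> k) = distr M lborel (\<xi> k)" by (rule distr_cong) auto
    also have "\<dots> = ?N" by (rule distributed_distr_eq_density[OF d])
    also have "\<dots> = distr ?N borel (\<lambda>x. sqrt 1 * x)"
    proof -
      have "distr ?N borel (\<lambda>x. x) = ?N" by (rule distr_id2) simp
      then show ?thesis by (simp cong: distr_cong)
    qed
    finally show ?thesis by (simp add: gaussian_def)
  qed
  have w: "(\<lambda>k. \<psi> k / real k powr (- (1 + \<alpha>) / 2)) \<longlonglongrightarrow> 1"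
  proof (rule Lim_transform_eventually)
    show "(\<lambda>k. if \<psi> k = 0 \<and> real k powr (- (1 + \<alpha>) / 2) = 0 then 1 else \<psi> k / real k powr (- (1 + \<alpha>) / 2)) \<longlonglongrightarrow> 1"
      using assms(6) by (simp only: asymp_equiv_def)
    \<comment> \<open>Asymptotic equivalence counts \<open>0 / 0\<close> as 1; this can matter only
      where the power vanishes, which is at \<open>k = 0\<close>.\<close>
    show "eventually (\<lambda>k. (if \<psi> k = 0 \<and> real k powr (- (1 + \<alpha>) / 2) = 0 then 1 else \<psi> k / real k powr (- (1 + \<alpha>) / 2)) =
        \<psi> k / real k powr (- (1 + \<alpha>) / 2)) sequentially"
      using eventually_gt_at_top[of 0] by eventually_elim simp
  qed
  have "1 < sqrt (2::real)" by simp
  then have \<alpha>: "\<alpha> < 1" using assms(3) by linarith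
  interpret P: gaussian_linear_process M \<xi> \<psi> \<alpha>
    by unfold_locales (use assms(2,4) \<alpha> xi w in auto)
  have \<eta>: "\<eta> j = P.\<eta> j" for j using assms(7) by (simp add: P.\<eta>_def fun_eq_iff)
  have \<sigma>: "\<sigma> = sqrt (P.autocov 0)"
    using assms(8) gaussian_second_moment(2)[OF P.gaussian_eta] by (simp add: \<eta>)
  have \<sigma>_pos: "\<sigma> > 0" using P.autocov_0_pos by (simp add: \<sigma>)
  have \<eta>': "gaussian M (\<eta>' 0) 1"
  proof -
    have "gaussian M (\<lambda>\<omega>. (1 / \<sigma>) * P.\<eta> 0 \<omega>) ((1 / \<sigma>)\<^sup>2 * P.autocov 0)"
      by (rule gaussian_cmult[OF P.gaussian_eta])
    moreover have "(\<lambda>\<omega>. (1 / \<sigma>) * P.\<eta> 0 \<omega>) = \<eta>' 0" by (simp add: assms(9) \<eta> fun_eq_iff)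
    moreover have "(1 / \<sigma>)\<^sup>2 * P.autocov 0 = 1" using P.autocov_0_pos by (simp add: \<sigma> power_divide)
    ultimately show ?thesis by simp
  qed
  have [measurable]: "G \<in> borel_measurable borel" by fact
  have Y0: "Y 0 = (\<lambda>\<omega>. G (\<eta>' 0 \<omega>))" by (simp add: assms(13) fun_eq_iff)
  interpret S: subordinated_process M \<xi> \<psi> \<alpha> G
  proof
    show "integrable ?N (\<lambda>x. (G x)\<^sup>2)"
      using assms(16) gaussian_integrable_iff[OF \<eta>', of "\<lambda>x. (G x)\<^sup>2"] by (simp add: Y0)
  qed fact
  have S\<sigma>: "S.\<sigma> = \<sigma>" by (simp add: S.\<sigma>_def \<sigma>)
  have S\<eta>: "S.\<eta>' j \<omega> = \<eta>' j \<omega>" for j \<omega> by (simp add: S.\<eta>'_def S\<sigma> assms(9) \<eta>)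
  have S\<mu>: "S.\<mu> = \<mu>"
    using gaussian_expectation[OF \<eta>', of G] assms(14) by (simp add: S.\<mu>_def Y0)
  have SJ: "S.J1 = J\<^sub>1"
    using gaussian_expectation[OF \<eta>', of "\<lambda>x. x * G x"] assms(11) by (simp add: S.J1_def mult.commute)
  interpret V: vervaat_setting M \<xi> \<psi> \<alpha> G
    by unfold_locales (use assms(3,12,15) in \<open>simp_all add: SJ S\<mu>\<close>)
  have Yeq: "(\<lambda>j \<omega>. G (S.\<eta>' j \<omega>)) = Y" by (simp add: S\<eta> assms(13) fun_eq_iff)
  show ?thesis
  proof
    fix y
    have "V.limit_cdf y = (LINT x|lborel. std_normal_density x *\<^sub>R
         cdf ?N (y * \<sigma> powr (2 - \<alpha> / 2) * \<mu> powr (1 - \<alpha> / 2) /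
             (\<bar>x\<bar> powr (1 - \<alpha> / 2) * (\<bar>J\<^sub>1\<bar> * kappa \<alpha>) powr (2 - \<alpha> / 2))))"
      unfolding V.limit_cdf_def V.limit_scale_def S\<sigma> S\<mu> SJ times_divide_eq_right mult.assoc[symmetric]
      by (rule integral_density) auto
    then show "((\<lambda>T. prob {\<omega> \<in> space M. vervaat_process \<mu> Y T \<omega> * ereal (T powr (- ((1 - \<alpha> / 2)\<^sup>2))) \<le> ereal y})
      \<longlongrightarrow> (LINT x|lborel. std_normal_density x *
         cdf ?N (y * \<sigma> powr (2 - \<alpha> / 2) * \<mu> powr (1 - \<alpha> / 2) /
             (\<bar>x\<bar> powr (1 - \<alpha> / 2) * (\<bar>J\<^sub>1\<bar> * kappa \<alpha>) powr (2 - \<alpha> / 2))))) at_top"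
      using V.vervaat_process_limit[of y] unfolding V.Q_def Yeq S\<mu> V.H_def by simp
  qed
qed

end
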